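(* First-order Lie algebroids (as objects) together with first-order Lie algebroid morphisms (as morphisms), with the composition and identities of vector bundle morphisms, form a category.
   Context: Smoothness is in the sense of Bastiani calculus; locally convex spaces are real and Hausdorff; manifolds are Hausdorff and modelled on locally convex spaces. A vector bundle $p:E\to M$ has locally convex fibers and local trivializations $\phi:E|_U\to U\times\mathsf F_\phi$ (diffeomorphisms over $U$, topological linear isomorphisms on fibers, whose transition maps are smooth, fiberwise linear bundle isomorphisms). A vector bundle morphism over a smooth map $f$ is a smooth map covering $f$ that is fiberwise linear. In a local trivialization $\phi$ over $U$, the local representative of a section $\xi$ is $\xi^\phi:=\mathrm{pr}_2\circ\phi\circ\xi\in C^\infty(U,\mathsf F_\phi)$. For a vector field $X$ and a smooth map $h$ into a locally convex space, $X.h:=\mathrm{pr}_2\circ Th\circ X$. First-order Lie algebroid: a vector bundle $p:A\to M$ with a vector bundle morphism $\mathbf a:A\to TM$ over $\mathrm{id}_M$ (the anchor) and a morphism of sheaves of $\mathbb R$-modules $[\cdot,\cdot]:\mathcal A\otimes_{\mathbb R}\mathcal A\to\mathcal A$ on the sheaf $\mathcal A$ of smooth sections of $A$ such that: (1) $[\cdot,\cdot]$ makes each $\mathcal A(U)$ a Lie algebra; (2) $[\xi,h\eta]=h[\xi,\eta]+(\mathbf a(\xi).h)\eta$ for $\xi,\eta\in\mathcal A(U)$, $h\in C^\infty(U)$; (3) for every local trivialization $\phi:A|_U\to U\times\mathsf F_\phi$ there is a smooth map $C_\phi:U\times\mathsf F_\phi\times\mathsf F_\phi\to\mathsf F_\phi$,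 alternating bilinear in the last two arguments, with $[\xi,\eta]^\phi(x)=\mathbf a(\xi).\eta^\phi(x)-\mathbf a(\eta).\xi^\phi(x)+C_\phi(x,\xi^\phi(x),\eta^\phi(x))$ for all $\xi,\eta\in\mathcal A(U)$. Forms: for $k\ge1$, $\Omega^k_A(U)$ is the space of families $\omega=(\omega_x)_{x\in U}$ of continuous alternating $k$-linear maps $\omega_x:A_x^k\to\mathbb R$ such that in local trivializations $\phi$ of $A$ the map $(x,v_1,\dots,v_k)\mapsto\omega_x(\phi^{-1}(x,v_1),\dots,\phi^{-1}(x,v_k))$ is smooth; $\Omega^0_A(U)=C^\infty(U)$. The differential is $(d_A\omega)(\xi_0,\dots,\xi_k)=\sum_j(-1)^j\mathbf a(\xi_j).\omega(\xi_0,\dots,\widehat{\xi_j},\dots,\xi_k)+\sum_{i<j}(-1)^{i+j}\omega([\xi_i,\xi_j],\xi_0,\dots,\widehat{\xi_i},\dots,\widehat{\xi_j},\dots,\xi_k)$, and $\Omega^\bullet_A$ with the (shuffle) wedge product is a sheaf of differential graded (dg) $\mathbb R$-algebras. Morphisms: for a vector bundle morphism $F:A\to\widetilde A$ over $f:M\to\widetilde M$, let $F^\sharp:f^{-1}\Omega^\bullet_{\widetilde A}\to\Omega^\bullet_A$ be the morphism of sheaves induced on representatives by $[\widetilde U,\alpha]\mapsto F^*\alpha$ (with $\widetilde U\supseteq f(U)$ open, $\alpha\in\Omega^k_{\widetilde A}(\widetilde U)$), where $(F^*\alpha)_x(a_1,\dots,a_k)=\alpha_{f(x)}(F(a_1),\dots,F(a_k))$,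 and $g\mapsto g\circ f$ for $k=0$. $F$ is a first-order Lie algebroid morphism if $F^\sharp$ is a morphism of sheaves of dg $\mathbb R$-algebras, i.e. $F^\sharp\circ f^{-1}d_{\widetilde A}=d_A\circ F^\sharp$. *)

theory Defs
  imports "HOL-Analysis.Analysis" "HOL-Library.Function_Algebras"
begin

section \<open>Categories\<close>

locale category =
  fixes Obj :: "'o set" and Arr :: "'c set"
    and Dom Cod :: "'c \<Rightarrow> 'o" and Id :: "'o \<Rightarrow> 'c" and Comp :: "'c \<Rightarrow> 'c \<Rightarrow> 'c"
  assumes dom_obj: "u \<in> Arr \<Longrightarrow> Dom u \<in> Obj"
    and cod_obj: "u \<in> Arr \<Longrightarrow> Cod u \<in> Obj"
    and id_arr: "A \<in> Obj \<Longrightarrow> Id A \<in> Arr"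
    and id_dom: "A \<in> Obj \<Longrightarrow> Dom (Id A) = A"
    and id_cod: "A \<in> Obj \<Longrightarrow> Cod (Id A) = A"
    and comp_arr: "\<lbrakk>u \<in> Arr; v \<in> Arr; Cod u = Dom v\<rbrakk> \<Longrightarrow> Comp v u \<in> Arr"
    and comp_dom: "\<lbrakk>u \<in> Arr; v \<in> Arr; Cod u = Dom v\<rbrakk> \<Longrightarrow> Dom (Comp v u) = Dom u"
    and comp_cod: "\<lbrakk>u \<in> Arr; v \<in> Arr; Cod u = Dom v\<rbrakk> \<Longrightarrow> Cod (Comp v u) = Cod v"
    and comp_assoc: "\<lbrakk>u \<in> Arr; v \<in> Arr; w \<in> Arr; Cod u = Dom v; Cod v = Dom w\<rbrakk>
        \<Longrightarrow> Comp w (Comp v u) = Comp (Comp w v) u"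
    and comp_id: "u \<in> Arr \<Longrightarrow> Comp u (Id (Dom u)) = u"
    and id_comp: "u \<in> Arr \<Longrightarrow> Comp (Id (Cod u)) u = u"


section \<open>Locally convex spaces\<close>

text \<open>
  A locally convex space is a linear subspace of an ambient real vector space type
  (a mere set-theoretic universe, without topology) together with a topology on that subspace; the
  subspace is the \<^const>\<open>topspace\<close> of the topology. In this way one type accommodates
  locally convex spaces varying with the chart or with the fibre.
\<close>

definition lcs :: "'e::real_vector topology \<Rightarrow> bool" where
  "lcs T \<longleftrightarrow>
     subspace (topspace T) \<and> Hausdorff_space T \<and>
     continuous_map (prod_topology T T) T (\<lambda>(v, w). v + w) \<and>
     continuous_map (prod_topology euclideanreal T) T (\<lambda>(r, v). r *\<^sub>R v) \<and>
     (\<forall>W. openin T W \<and> 0 \<in> W \<longrightarrow> (\<exists>C. openin T C \<and> convex C \<and> 0 \<in> C \<and> C \<subseteq> W))"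

instantiation "fun" :: (type, real_vector) real_vector
begin

definition scaleR_fun :: "real \<Rightarrow> ('a \<Rightarrow> 'b) \<Rightarrow> 'a \<Rightarrow> 'b" where
  "scaleR_fun r h = (\<lambda>i. r *\<^sub>R h i)"

instance
  by standard (auto simp: scaleR_fun_def fun_eq_iff scaleR_add_right scaleR_add_left)

end

text \<open>
  The power \<open>F\<^sup>k\<close> consists of the functions on the naturals that take values in \<open>F\<close> below \<open>k\<close> and
  vanish from \<open>k\<close> on; in \<^const>\<open>product_topology\<close> the tuples are \<^const>\<open>undefined\<close> there,
  so that its carrier is not a linear subspace.
\<close>

definition power_top :: "'f::real_vector topology \<Rightarrow> nat \<Rightarrow> (nat \<Rightarrow> 'f) topology" where
  "power_top F k =
     pullback_topology {h. (\<forall>i<k. h i \<in> topspace F) \<and> (\<forall>i\<ge>k. h i = 0)}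
       (\<lambda>h. restrict h {..<k}) (product_topology (\<lambda>_. F) {..<k})"


section \<open>Bastiani calculus\<close>

definition difference_quotient :: "('e::real_vector \<Rightarrow> 'f::real_vector) \<Rightarrow> 'e \<Rightarrow> 'e \<Rightarrow> real \<Rightarrow> 'f" where
  "difference_quotient f x v t = (1 / t) *\<^sub>R (f (x + t *\<^sub>R v) - f x)"

definition dir_deriv ::
    "'f topology \<Rightarrow> ('e::real_vector \<Rightarrow> 'f::real_vector) \<Rightarrow> 'e \<Rightarrow> 'e \<Rightarrow> 'f" where
  "dir_deriv S f x v = (THE l. limitin S (difference_quotient f x v) l (at 0))"

primrec iter_deriv ::
    "'f topology \<Rightarrow> ('e::real_vector \<Rightarrow> 'f::real_vector) \<Rightarrow> 'e list \<Rightarrow> 'e \<Rightarrow> 'f" where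
  "iter_deriv S f [] = f"
| "iter_deriv S f (v # vs) = (\<lambda>x. dir_deriv S (iter_deriv S f vs) x v)"

text \<open>
  Smoothness on the open set \<open>U\<close>: all iterated directional derivatives
  exist on \<open>U\<close> and define continuous maps \<open>U \<times> E\<^sup>k \<rightarrow> F\<close>.
\<close>

definition smooth_on ::
    "'e::real_vector topology \<Rightarrow> 'e set \<Rightarrow> 'f::real_vector topology \<Rightarrow> ('e \<Rightarrow> 'f) \<Rightarrow> bool" where
  "smooth_on T U S f \<longleftrightarrow>
     openin T U \<and> f ` U \<subseteq> topspace S \<and>
     (\<forall>vs v x. set vs \<subseteq> topspace T \<and> v \<in> topspace T \<and> x \<in> U \<longrightarrow>
        (\<exists>l. limitin S (difference_quotient (iter_deriv S f vs) x v) l (at 0))) \<and>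
     (\<forall>k. continuous_map
        (prod_topology (subtopology T U) (product_topology (\<lambda>_. T) {..<k})) S
        (\<lambda>(x, h). iter_deriv S f (map h [0..<k]) x))"


section \<open>Manifolds\<close>

record ('m, 'e) chart =
  cdom :: "'m set"
  cmap :: "'m \<Rightarrow> 'e"
  cmodel :: "'e topology"

record ('m, 'e) manifold =
  mtop :: "'m topology"
  atlas :: "('m, 'e) chart set"

abbreviation points :: "('m, 'e) manifold \<Rightarrow> 'm set" where
  "points M \<equiv> topspace (mtop M)"

definition cinv :: "('m, 'e) chart \<Rightarrow> 'e \<Rightarrow> 'm" where
  "cinv \<phi> = inv_into (cdom \<phi>) (cmap \<phi>)"

definition charts_at :: "('m, 'e) manifold \<Rightarrow> 'm \<Rightarrow> ('m, 'e) chart set" where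
  "charts_at M x = {\<phi> \<in> atlas M. x \<in> cdom \<phi>}"

definition is_chart :: "'m topology \<Rightarrow> ('m, 'e::real_vector) chart \<Rightarrow> bool" where
  "is_chart X \<phi> \<longleftrightarrow>
     openin X (cdom \<phi>) \<and> lcs (cmodel \<phi>) \<and> openin (cmodel \<phi>) (cmap \<phi> ` cdom \<phi>) \<and>
     homeomorphic_map (subtopology X (cdom \<phi>))
       (subtopology (cmodel \<phi>) (cmap \<phi> ` cdom \<phi>)) (cmap \<phi>)"

definition is_manifold :: "('m, 'e::real_vector) manifold \<Rightarrow> bool" where
  "is_manifold M \<longleftrightarrow>
     Hausdorff_space (mtop M) \<and>
     (\<forall>\<phi>\<in>atlas M. is_chart (mtop M) \<phi>) \<and>
     points M = (\<Union>\<phi>\<in>atlas M. cdom \<phi>) \<and>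
     (\<forall>\<phi>\<in>atlas M. \<forall>\<psi>\<in>atlas M.
        smooth_on (cmodel \<phi>) (cmap \<phi> ` (cdom \<phi> \<inter> cdom \<psi>)) (cmodel \<psi>) (cmap \<psi> \<circ> cinv \<phi>))"

definition smooth_map ::
    "('m, 'e::real_vector) manifold \<Rightarrow> ('n, 'f::real_vector) manifold \<Rightarrow> ('m \<Rightarrow> 'n) \<Rightarrow> bool" where
  "smooth_map M N f \<longleftrightarrow>
     continuous_map (mtop M) (mtop N) f \<and>
     (\<forall>\<phi>\<in>atlas M. \<forall>\<psi>\<in>atlas N.
        smooth_on (cmodel \<phi>) (cmap \<phi> ` {x \<in> cdom \<phi>. f x \<in> cdom \<psi>}) (cmodel \<psi>)
          (cmap \<psi> \<circ> f \<circ> cinv \<phi>))"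

definition diffeo ::
    "('m, 'e::real_vector) manifold \<Rightarrow> ('n, 'f::real_vector) manifold \<Rightarrow> ('m \<Rightarrow> 'n) \<Rightarrow> bool" where
  "diffeo M N f \<longleftrightarrow>
     smooth_map M N f \<and>
     (\<exists>g. smooth_map N M g \<and> (\<forall>x\<in>points M. g (f x) = x) \<and> (\<forall>y\<in>points N. f (g y) = y))"

definition open_submanifold :: "('m, 'e) manifold \<Rightarrow> 'm set \<Rightarrow> ('m, 'e) manifold" where
  "open_submanifold M U =
     \<lparr>mtop = subtopology (mtop M) U, atlas = (\<lambda>\<phi>. \<phi>\<lparr>cdom := cdom \<phi> \<inter> U\<rparr>) ` atlas M\<rparr>"

definition prod_manifold ::
    "('m, 'e) manifold \<Rightarrow> ('n, 'f) manifold \<Rightarrow> ('m \<times> 'n, 'e \<times> 'f) manifold" where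
  "prod_manifold M N =
     \<lparr>mtop = prod_topology (mtop M) (mtop N),
      atlas = {\<lparr>cdom = cdom \<phi> \<times> cdom \<psi>, cmap = map_prod (cmap \<phi>) (cmap \<psi>),
                cmodel = prod_topology (cmodel \<phi>) (cmodel \<psi>)\<rparr> | \<phi> \<psi>.
               \<phi> \<in> atlas M \<and> \<psi> \<in> atlas N}\<rparr>"

definition id_chart :: "'e topology \<Rightarrow> ('e, 'e) chart" where
  "id_chart T = \<lparr>cdom = topspace T, cmap = (\<lambda>v. v), cmodel = T\<rparr>"

definition lcs_manifold :: "'e topology \<Rightarrow> ('e, 'e) manifold" where
  "lcs_manifold T = \<lparr>mtop = T, atlas = {id_chart T}\<rparr>"

definition smooth_functions :: "('m, 'e::real_vector) manifold \<Rightarrow> 'm set \<Rightarrow> ('m \<Rightarrow> real) set" where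
  "smooth_functions M U = {h. smooth_map (open_submanifold M U) (lcs_manifold euclideanreal) h}"


section \<open>Vector bundles\<close>

text \<open>
  In \<open>('m, 'e, 'a, 'f) vbundle\<close> the base is modelled on spaces in \<open>'e\<close>, the typical fibres live
  in \<open>'f\<close>, and hence the total space is modelled on spaces in \<open>'e \<times> 'f\<close>.
\<close>

record ('m, 'e, 'a, 'f) vbundle =
  base :: "('m, 'e) manifold"
  total :: "('a, 'e \<times> 'f) manifold"
  proj :: "'a \<Rightarrow> 'm"
  vadd :: "'a \<Rightarrow> 'a \<Rightarrow> 'a"
  vscale :: "real \<Rightarrow> 'a \<Rightarrow> 'a"
  vzero :: "'m \<Rightarrow> 'a"

abbreviation opens :: "('m, 'e, 'a, 'f) vbundle \<Rightarrow> 'm set \<Rightarrow> bool" where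
  "opens A U \<equiv> openin (mtop (base A)) U"

definition over :: "('m, 'e, 'a, 'f) vbundle \<Rightarrow> 'm set \<Rightarrow> 'a set" where
  "over A U = {a \<in> points (total A). proj A a \<in> U}"

abbreviation fibre :: "('m, 'e, 'a, 'f) vbundle \<Rightarrow> 'm \<Rightarrow> 'a set" where
  "fibre A x \<equiv> over A {x}"

definition vector_space_ops ::
    "'a set \<Rightarrow> ('a \<Rightarrow> 'a \<Rightarrow> 'a) \<Rightarrow> (real \<Rightarrow> 'a \<Rightarrow> 'a) \<Rightarrow> 'a \<Rightarrow> bool" where
  "vector_space_ops V add scl z \<longleftrightarrow>
     z \<in> V \<and> (\<forall>a\<in>V. \<forall>b\<in>V. add a b \<in> V) \<and> (\<forall>r. \<forall>a\<in>V. scl r a \<in> V) \<and>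
     (\<forall>a\<in>V. \<forall>b\<in>V. add a b = add b a) \<and>
     (\<forall>a\<in>V. \<forall>b\<in>V. \<forall>c\<in>V. add (add a b) c = add a (add b c)) \<and>
     (\<forall>a\<in>V. add z a = a) \<and> (\<forall>a\<in>V. add a (scl (- 1) a) = z) \<and>
     (\<forall>r. \<forall>a\<in>V. \<forall>b\<in>V. scl r (add a b) = add (scl r a) (scl r b)) \<and>
     (\<forall>r s. \<forall>a\<in>V. scl (r + s) a = add (scl r a) (scl s a)) \<and>
     (\<forall>r s. \<forall>a\<in>V. scl r (scl s a) = scl (r * s) a) \<and>
     (\<forall>a\<in>V. scl 1 a = a)"

text \<open>
  A local trivialization with typical fibre \<open>F\<close> is a diffeomorphism over \<open>U\<close>. Since the fibres carry
  the subspace topology of the total space, it is automatically a homeomorphism on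
  each fibre, and transition maps are automatically smooth.
\<close>

definition local_triv ::
    "('m, 'e::real_vector, 'a, 'f::real_vector) vbundle \<Rightarrow> 'm set \<Rightarrow> 'f topology
      \<Rightarrow> ('a \<Rightarrow> 'm \<times> 'f) \<Rightarrow> bool" where
  "local_triv A U F \<phi> \<longleftrightarrow>
     opens A U \<and> lcs F \<and>
     diffeo (open_submanifold (total A) (over A U))
       (prod_manifold (open_submanifold (base A) U) (lcs_manifold F)) \<phi> \<and>
     (\<forall>a\<in>over A U. fst (\<phi> a) = proj A a) \<and>
     (\<forall>x\<in>U. \<forall>a\<in>fibre A x. \<forall>b\<in>fibre A x. snd (\<phi> (vadd A a b)) = snd (\<phi> a) + snd (\<phi> b)) \<and>
     (\<forall>x\<in>U. \<forall>a\<in>fibre A x. \<forall>r. snd (\<phi> (vscale A r a)) = r *\<^sub>R snd (\<phi> a))"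

definition vector_bundle ::
    "('m, 'e::real_vector, 'a, 'f::real_vector) vbundle \<Rightarrow> bool" where
  "vector_bundle A \<longleftrightarrow>
     is_manifold (base A) \<and> is_manifold (total A) \<and> smooth_map (total A) (base A) (proj A) \<and>
     (\<forall>x\<in>points (base A). vector_space_ops (fibre A x) (vadd A) (vscale A) (vzero A x)) \<and>
     (\<forall>x\<in>points (base A). \<exists>U F \<phi>. x \<in> U \<and> local_triv A U F \<phi>)"

definition vb_morphism ::
    "('m, 'e::real_vector, 'a, 'f::real_vector) vbundle
      \<Rightarrow> ('n, 'g::real_vector, 'b, 'h::real_vector) vbundle
      \<Rightarrow> ('a \<Rightarrow> 'b) \<Rightarrow> ('m \<Rightarrow> 'n) \<Rightarrow> bool" where
  "vb_morphism A B F f \<longleftrightarrow>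
     smooth_map (base A) (base B) f \<and> smooth_map (total A) (total B) F \<and>
     (\<forall>a\<in>points (total A). proj B (F a) = f (proj A a)) \<and>
     (\<forall>x\<in>points (base A). \<forall>a\<in>fibre A x. \<forall>b\<in>fibre A x. F (vadd A a b) = vadd B (F a) (F b)) \<and>
     (\<forall>x\<in>points (base A). \<forall>a\<in>fibre A x. \<forall>r. F (vscale A r a) = vscale B r (F a))"

definition sections ::
    "('m, 'e::real_vector, 'a, 'f::real_vector) vbundle \<Rightarrow> 'm set \<Rightarrow> ('m \<Rightarrow> 'a) set" where
  "sections A U =
     {\<xi> \<in> extensional U. smooth_map (open_submanifold (base A) U) (total A) \<xi> \<and>
                         (\<forall>x\<in>U. proj A (\<xi> x) = x)}"

definition sec_add :: "('m, 'e, 'a, 'f) vbundle \<Rightarrow> 'm set \<Rightarrow> ('m \<Rightarrow> 'a) \<Rightarrow> ('m \<Rightarrow> 'a) \<Rightarrow> 'm \<Rightarrow> 'a" where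
  "sec_add A U \<xi> \<eta> = (\<lambda>x\<in>U. vadd A (\<xi> x) (\<eta> x))"

definition sec_mult :: "('m, 'e, 'a, 'f) vbundle \<Rightarrow> 'm set \<Rightarrow> ('m \<Rightarrow> real) \<Rightarrow> ('m \<Rightarrow> 'a) \<Rightarrow> 'm \<Rightarrow> 'a" where
  "sec_mult A U h \<xi> = (\<lambda>x\<in>U. vscale A (h x) (\<xi> x))"

definition sec_zero :: "('m, 'e, 'a, 'f) vbundle \<Rightarrow> 'm set \<Rightarrow> 'm \<Rightarrow> 'a" where
  "sec_zero A U = (\<lambda>x\<in>U. vzero A x)"


section \<open>Tangent bundles\<close>

text \<open>
  A tangent vector at \<open>x\<close> is a pair of \<open>x\<close> and the function assigning to each chart around \<open>x\<close> the vector
  of the model space that represents it in this chart, compatibly with the chart changes.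
\<close>

type_synonym ('m, 'e) tangent = "'m \<times> (('m, 'e) chart \<Rightarrow> 'e)"

definition tangent_vectors :: "('m, 'e::real_vector) manifold \<Rightarrow> ('m, 'e) tangent set" where
  "tangent_vectors M =
     {(x, t). x \<in> points M \<and> t \<in> extensional (charts_at M x) \<and>
        (\<forall>\<phi>\<in>charts_at M x. t \<phi> \<in> topspace (cmodel \<phi>)) \<and>
        (\<forall>\<phi>\<in>charts_at M x. \<forall>\<psi>\<in>charts_at M x.
           t \<psi> = dir_deriv (cmodel \<psi>) (cmap \<psi> \<circ> cinv \<phi>) (cmap \<phi> x) (t \<phi>))}"

definition tangent_chart ::
    "('m, 'e::real_vector) manifold \<Rightarrow> ('m, 'e) chart \<Rightarrow> (('m, 'e) tangent, 'e \<times> 'e) chart" where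
  "tangent_chart M \<phi> =
     \<lparr>cdom = {t \<in> tangent_vectors M. fst t \<in> cdom \<phi>},
      cmap = (\<lambda>t. (cmap \<phi> (fst t), snd t \<phi>)),
      cmodel = prod_topology (cmodel \<phi>) (cmodel \<phi>)\<rparr>"

definition tangent_manifold ::
    "('m, 'e::real_vector) manifold \<Rightarrow> (('m, 'e) tangent, 'e \<times> 'e) manifold" where
  "tangent_manifold M =
     \<lparr>mtop = topology_generated_by
        {{t \<in> cdom (tangent_chart M \<phi>). cmap (tangent_chart M \<phi>) t \<in> W} | \<phi> W.
         \<phi> \<in> atlas M \<and> openin (cmodel (tangent_chart M \<phi>)) W},
      atlas = tangent_chart M ` atlas M\<rparr>"

definition tangent_bundle ::
    "('m, 'e::real_vector) manifold \<Rightarrow> ('m, 'e, ('m, 'e) tangent, 'e) vbundle" where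
  "tangent_bundle M =
     \<lparr>base = M, total = tangent_manifold M, proj = fst,
      vadd = (\<lambda>(x, t) (_, s). (x, \<lambda>\<phi>\<in>charts_at M x. t \<phi> + s \<phi>)),
      vscale = (\<lambda>r (x, t). (x, \<lambda>\<phi>\<in>charts_at M x. r *\<^sub>R t \<phi>)),
      vzero = (\<lambda>x. (x, \<lambda>\<phi>\<in>charts_at M x. 0))\<rparr>"

definition tangent_map ::
    "('m, 'e::real_vector) manifold \<Rightarrow> ('n, 'f::real_vector) manifold \<Rightarrow> ('m \<Rightarrow> 'n)
      \<Rightarrow> ('m, 'e) tangent \<Rightarrow> ('n, 'f) tangent" where
  "tangent_map M N f = (\<lambda>(x, t).
     (f x, \<lambda>\<psi>\<in>charts_at N (f x).
        let \<phi> = (SOME \<phi>. \<phi> \<in> charts_at M x)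
        in dir_deriv (cmodel \<psi>) (cmap \<psi> \<circ> f \<circ> cinv \<phi>) (cmap \<phi> x) (t \<phi>)))"

text \<open>
  \<open>X.h = pr\<^sub>2 \<circ> Th \<circ> X\<close>, where \<open>TF = F \<times> F\<close> by means of the chart \<^term>\<open>id_chart F\<close>. As
  directional derivatives are local, \<open>h\<close> need only be defined near \<open>x\<close>.
\<close>

definition vf_deriv ::
    "('m, 'e::real_vector) manifold \<Rightarrow> 'f::real_vector topology
      \<Rightarrow> ('m \<Rightarrow> ('m, 'e) tangent) \<Rightarrow> ('m \<Rightarrow> 'f) \<Rightarrow> 'm \<Rightarrow> 'f" where
  "vf_deriv M F X h x = snd (tangent_map M (lcs_manifold F) h (X x)) (id_chart F)"


section \<open>First-order Lie algebroids\<close>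

record ('m, 'e, 'a, 'f) algebroid =
  vb :: "('m, 'e, 'a, 'f) vbundle"
  anchor :: "'a \<Rightarrow> ('m, 'e) tangent"
  bracket :: "'m set \<Rightarrow> ('m \<Rightarrow> 'a) \<Rightarrow> ('m \<Rightarrow> 'a) \<Rightarrow> 'm \<Rightarrow> 'a"

definition bracket_sheaf_morphism ::
    "('m, 'e::real_vector, 'a, 'f::real_vector) algebroid \<Rightarrow> bool" where
  "bracket_sheaf_morphism L \<longleftrightarrow>
     (\<forall>U. opens (vb L) U \<longrightarrow>
       (\<forall>\<xi>\<in>sections (vb L) U. \<forall>\<eta>\<in>sections (vb L) U.
          bracket L U \<xi> \<eta> \<in> sections (vb L) U \<and>
          (\<forall>V. opens (vb L) V \<and> V \<subseteq> U \<longrightarrow>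
             bracket L V (restrict \<xi> V) (restrict \<eta> V) = restrict (bracket L U \<xi> \<eta>) V) \<and>
          (\<forall>r. bracket L U (sec_mult (vb L) U (\<lambda>_. r) \<xi>) \<eta>
                 = sec_mult (vb L) U (\<lambda>_. r) (bracket L U \<xi> \<eta>) \<and>
               bracket L U \<xi> (sec_mult (vb L) U (\<lambda>_. r) \<eta>)
                 = sec_mult (vb L) U (\<lambda>_. r) (bracket L U \<xi> \<eta>)) \<and>
          (\<forall>\<zeta>\<in>sections (vb L) U.
             bracket L U (sec_add (vb L) U \<xi> \<eta>) \<zeta>
               = sec_add (vb L) U (bracket L U \<xi> \<zeta>) (bracket L U \<eta> \<zeta>) \<and>
             bracket L U \<zeta> (sec_add (vb L) U \<xi> \<eta>)
               = sec_add (vb L) U (bracket L U \<zeta> \<xi>) (bracket L U \<zeta> \<eta>))))"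

definition bracket_lie ::
    "('m, 'e::real_vector, 'a, 'f::real_vector) algebroid \<Rightarrow> bool" where
  "bracket_lie L \<longleftrightarrow>
     (\<forall>U. opens (vb L) U \<longrightarrow>
       (\<forall>\<xi>\<in>sections (vb L) U. bracket L U \<xi> \<xi> = sec_zero (vb L) U) \<and>
       (\<forall>\<xi>\<in>sections (vb L) U. \<forall>\<eta>\<in>sections (vb L) U. \<forall>\<zeta>\<in>sections (vb L) U.
          sec_add (vb L) U (bracket L U \<xi> (bracket L U \<eta> \<zeta>))
            (sec_add (vb L) U (bracket L U \<eta> (bracket L U \<zeta> \<xi>)) (bracket L U \<zeta> (bracket L U \<xi> \<eta>)))
          = sec_zero (vb L) U))"

definition bracket_leibniz ::
    "('m, 'e::real_vector, 'a, 'f::real_vector) algebroid \<Rightarrow> bool" where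
  "bracket_leibniz L \<longleftrightarrow>
     (\<forall>U. opens (vb L) U \<longrightarrow>
       (\<forall>\<xi>\<in>sections (vb L) U. \<forall>\<eta>\<in>sections (vb L) U. \<forall>h\<in>smooth_functions (base (vb L)) U.
          bracket L U \<xi> (sec_mult (vb L) U h \<eta>)
          = sec_add (vb L) U (sec_mult (vb L) U h (bracket L U \<xi> \<eta>))
              (sec_mult (vb L) U (vf_deriv (base (vb L)) euclideanreal (anchor L \<circ> \<xi>) h) \<eta>)))"

definition alternating_bilinear :: "'f::real_vector set \<Rightarrow> ('f \<Rightarrow> 'f \<Rightarrow> 'f) \<Rightarrow> bool" where
  "alternating_bilinear V c \<longleftrightarrow>
     (\<forall>u\<in>V. \<forall>v\<in>V. \<forall>w\<in>V. c (u + v) w = c u w + c v w \<and> c w (u + v) = c w u + c w v) \<and>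
     (\<forall>r. \<forall>u\<in>V. \<forall>v\<in>V. c (r *\<^sub>R u) v = r *\<^sub>R c u v \<and> c u (r *\<^sub>R v) = r *\<^sub>R c u v) \<and>
     (\<forall>u\<in>V. c u u = 0)"

definition bracket_first_order ::
    "('m, 'e::real_vector, 'a, 'f::real_vector) algebroid \<Rightarrow> bool" where
  "bracket_first_order L \<longleftrightarrow>
     (\<forall>U F \<phi>. local_triv (vb L) U F \<phi> \<longrightarrow>
       (\<exists>C. smooth_map
              (prod_manifold (open_submanifold (base (vb L)) U) (lcs_manifold (prod_topology F F)))
              (lcs_manifold F) (\<lambda>(x, v, w). C x v w) \<and>
            (\<forall>x\<in>U. alternating_bilinear (topspace F) (C x)) \<and>
            (\<forall>\<xi>\<in>sections (vb L) U. \<forall>\<eta>\<in>sections (vb L) U. \<forall>x\<in>U.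
               snd (\<phi> (bracket L U \<xi> \<eta> x))
               = vf_deriv (base (vb L)) F (anchor L \<circ> \<xi>) (\<lambda>y. snd (\<phi> (\<eta> y))) x
                 - vf_deriv (base (vb L)) F (anchor L \<circ> \<eta>) (\<lambda>y. snd (\<phi> (\<xi> y))) x
                 + C x (snd (\<phi> (\<xi> x))) (snd (\<phi> (\<eta> x))))))"

definition first_order_lie_algebroid ::
    "('m, 'e::real_vector, 'a, 'f::real_vector) algebroid \<Rightarrow> bool" where
  "first_order_lie_algebroid L \<longleftrightarrow>
     vector_bundle (vb L) \<and>
     vb_morphism (vb L) (tangent_bundle (base (vb L))) (anchor L) (\<lambda>x. x) \<and>
     bracket_sheaf_morphism L \<and> bracket_lie L \<and> bracket_leibniz L \<and> bracket_first_order L"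


section \<open>Sheaves of graded algebras with differential\<close>

text \<open>
  The data of a sheaf of dg algebras: homogeneous sections of degree \<open>k\<close> over \<open>U\<close>, restriction to a
  smaller open set, and the operations (indexed by degrees and open set).
\<close>

record ('m, 's) dga_sheaf =
  dg_top :: "'m topology"
  dg_sec :: "nat \<Rightarrow> 'm set \<Rightarrow> 's set"
  dg_res :: "'m set \<Rightarrow> 's \<Rightarrow> 's"
  dg_add :: "nat \<Rightarrow> 'm set \<Rightarrow> 's \<Rightarrow> 's \<Rightarrow> 's"
  dg_scale :: "nat \<Rightarrow> 'm set \<Rightarrow> real \<Rightarrow> 's \<Rightarrow> 's"
  dg_mult :: "nat \<Rightarrow> nat \<Rightarrow> 'm set \<Rightarrow> 's \<Rightarrow> 's \<Rightarrow> 's"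
  dg_one :: "'m set \<Rightarrow> 's"
  dg_d :: "nat \<Rightarrow> 'm set \<Rightarrow> 's \<Rightarrow> 's"

definition dga_sheaf_morphism ::
    "('m, 's) dga_sheaf \<Rightarrow> ('m, 't) dga_sheaf \<Rightarrow> (nat \<Rightarrow> 'm set \<Rightarrow> 's \<Rightarrow> 't) \<Rightarrow> bool" where
  "dga_sheaf_morphism X Y H \<longleftrightarrow>
     dg_top X = dg_top Y \<and>
     (\<forall>U. openin (dg_top X) U \<longrightarrow>
       H 0 U (dg_one X U) = dg_one Y U \<and>
       (\<forall>k. \<forall>s\<in>dg_sec X k U.
          H k U s \<in> dg_sec Y k U \<and>
          (\<forall>V. openin (dg_top X) V \<and> V \<subseteq> U \<longrightarrow> H k V (dg_res X V s) = dg_res Y V (H k U s)) \<and>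
          (\<forall>t\<in>dg_sec X k U. H k U (dg_add X k U s t) = dg_add Y k U (H k U s) (H k U t)) \<and>
          (\<forall>r. H k U (dg_scale X k U r s) = dg_scale Y k U r (H k U s)) \<and>
          (\<forall>l. \<forall>t\<in>dg_sec X l U.
             H (k + l) U (dg_mult X k l U s t) = dg_mult Y k l U (H k U s) (H l U t)) \<and>
          H (Suc k) U (dg_d X k U s) = dg_d Y k U (H k U s)))"

text \<open>
  The germ \<open>[V, s]\<close> at \<open>y\<close> is the set of all representatives.
\<close>

definition germ :: "('n, 's) dga_sheaf \<Rightarrow> 'n \<Rightarrow> 'n set \<times> 's \<Rightarrow> ('n set \<times> 's) set" where
  "germ X y = (\<lambda>(V, s).
     {(V', s'). openin (dg_top X) V' \<and> y \<in> V' \<and>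
        (\<exists>W. openin (dg_top X) W \<and> y \<in> W \<and> W \<subseteq> V \<inter> V' \<and> dg_res X W s = dg_res X W s')})"

definition germ_rep :: "('n set \<times> 's) set \<Rightarrow> 'n set \<times> 's" where
  "germ_rep g = (SOME p. p \<in> g)"

text \<open>
  The inverse image sheaf \<open>f\<^sup>-\<^sup>1X\<close> for a continuous map \<open>f\<close> from \<open>T\<close>, as sheafification by germs: a
  section over \<open>U\<close> assigns to \<open>x\<close> an element of the stalk of \<open>X\<close> at \<open>f x\<close> such that locally
  all these germs are represented by a single section \<open>[V, t]\<close> of \<open>X\<close> with \<open>V \<supseteq> f(W)\<close>.
\<close>

definition inverse_image ::
    "'m topology \<Rightarrow> ('m \<Rightarrow> 'n) \<Rightarrow> ('n, 's) dga_sheaf \<Rightarrow> ('m, 'm \<Rightarrow> ('n set \<times> 's) set) dga_sheaf" where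
  "inverse_image T f X =
     \<lparr>dg_top = T,
      dg_sec = (\<lambda>k U. {s \<in> extensional U. \<forall>x\<in>U. \<exists>W V t.
         openin T W \<and> x \<in> W \<and> W \<subseteq> U \<and> openin (dg_top X) V \<and> f ` W \<subseteq> V \<and> t \<in> dg_sec X k V \<and>
         (\<forall>z\<in>W. s z = germ X (f z) (V, t))}),
      dg_res = (\<lambda>V s. restrict s V),
      dg_add = (\<lambda>k U s t. \<lambda>x\<in>U. let (V, s') = germ_rep (s x); (W, t') = germ_rep (t x) in
         germ X (f x) (V \<inter> W, dg_add X k (V \<inter> W) (dg_res X (V \<inter> W) s') (dg_res X (V \<inter> W) t'))),
      dg_scale = (\<lambda>k U r s. \<lambda>x\<in>U. let (V, s') = germ_rep (s x) in
         germ X (f x) (V, dg_scale X k V r s')),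
      dg_mult = (\<lambda>k l U s t. \<lambda>x\<in>U. let (V, s') = germ_rep (s x); (W, t') = germ_rep (t x) in
         germ X (f x) (V \<inter> W, dg_mult X k l (V \<inter> W) (dg_res X (V \<inter> W) s') (dg_res X (V \<inter> W) t'))),
      dg_one = (\<lambda>U. \<lambda>x\<in>U. germ X (f x) (topspace (dg_top X), dg_one X (topspace (dg_top X)))),
      dg_d = (\<lambda>k U s. \<lambda>x\<in>U. let (V, s') = germ_rep (s x) in germ X (f x) (V, dg_d X k V s'))\<rparr>"


section \<open>Differential forms\<close>

text \<open>
  A family of \<open>k\<close>-linear maps \<open>\<omega>\<^sub>x : (A\<^sub>x)\<^sup>k \<rightarrow> \<real>\<close> for \<open>x \<in> U\<close> is a function of \<open>x\<close> and a list of vectors,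
  extended by \<open>0\<close> outside its domain \<open>tuples A U k\<close>. For \<open>k = 0\<close> this is the
  function \<open>x \<mapsto> \<omega> x []\<close>.
\<close>

type_synonym ('m, 'a) form = "'m \<Rightarrow> 'a list \<Rightarrow> real"

definition tuples :: "('m, 'e, 'a, 'f) vbundle \<Rightarrow> 'm set \<Rightarrow> nat \<Rightarrow> ('m \<times> 'a list) set" where
  "tuples A U k = {(x, vs). x \<in> U \<and> length vs = k \<and> set vs \<subseteq> fibre A x}"

definition cut_off :: "('m \<times> 'a list) set \<Rightarrow> ('m, 'a) form \<Rightarrow> ('m, 'a) form" where
  "cut_off D \<omega> = (\<lambda>x vs. if (x, vs) \<in> D then \<omega> x vs else 0)"

definition alternating_multilinear ::
    "('m, 'e, 'a, 'f) vbundle \<Rightarrow> 'm \<Rightarrow> nat \<Rightarrow> ('a list \<Rightarrow> real) \<Rightarrow> bool" where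
  "alternating_multilinear A x k \<alpha> \<longleftrightarrow>
     (\<forall>vs. length vs = k \<and> set vs \<subseteq> fibre A x \<longrightarrow>
       (\<forall>i<k. \<forall>a\<in>fibre A x. \<forall>b\<in>fibre A x.
          \<alpha> (vs[i := vadd A a b]) = \<alpha> (vs[i := a]) + \<alpha> (vs[i := b])) \<and>
       (\<forall>i<k. \<forall>a\<in>fibre A x. \<forall>r. \<alpha> (vs[i := vscale A r a]) = r * \<alpha> (vs[i := a])) \<and>
       (\<forall>i<k. \<forall>j<k. i \<noteq> j \<and> vs ! i = vs ! j \<longrightarrow> \<alpha> vs = 0))"

definition forms ::
    "('m, 'e::real_vector, 'a, 'f::real_vector) vbundle \<Rightarrow> nat \<Rightarrow> 'm set \<Rightarrow> ('m, 'a) form set" where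
  "forms A k U =
     {\<omega>. (\<forall>x vs. (x, vs) \<notin> tuples A U k \<longrightarrow> \<omega> x vs = 0) \<and>
         (if k = 0 then (\<lambda>x. \<omega> x []) \<in> smooth_functions (base A) U
          else
            (\<forall>x\<in>U. alternating_multilinear A x k (\<omega> x) \<and>
               continuous_map
                 (product_topology (\<lambda>_. subtopology (mtop (total A)) (fibre A x)) {..<k})
                 euclideanreal (\<lambda>h. \<omega> x (map h [0..<k]))) \<and>
            (\<forall>W F \<phi>. local_triv A W F \<phi> \<longrightarrow>
               smooth_map
                 (prod_manifold (open_submanifold (base A) (U \<inter> W)) (lcs_manifold (power_top F k)))
                 (lcs_manifold euclideanreal)
                 (\<lambda>(x, h). \<omega> x (map (\<lambda>i. inv_into (over A W) \<phi> (x, h i)) [0..<k]))))}"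

text \<open>
  Shuffles of type \<open>(k, l)\<close> are encoded by the set \<open>S\<close> of the \<open>k\<close> positions that go to the first
  factor; the sign counts the inversions.
\<close>

definition wedge :: "nat \<Rightarrow> nat \<Rightarrow> ('m, 'a) form \<Rightarrow> ('m, 'a) form \<Rightarrow> ('m, 'a) form" where
  "wedge k l \<alpha> \<beta> = (\<lambda>x vs. if length vs = k + l then
     (\<Sum>S | S \<subseteq> {..<k + l} \<and> card S = k.
        (- 1) ^ card {(i, j). i \<in> S \<and> j \<in> {..<k + l} - S \<and> j < i}
        * \<alpha> x (nths vs S) * \<beta> x (nths vs (- S)))
     else 0)"

text \<open>The right-hand side of the formula for \<open>(d\<omega>)(\<xi>\<^sub>0, \<dots>, \<xi>\<^sub>k)\<close> at \<open>x\<close>, for sections over \<open>V\<close>.\<close>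

definition koszul ::
    "('m, 'e::real_vector, 'a, 'f) algebroid \<Rightarrow> 'm set \<Rightarrow> nat \<Rightarrow> ('m, 'a) form
      \<Rightarrow> ('m \<Rightarrow> 'a) list \<Rightarrow> 'm \<Rightarrow> real" where
  "koszul L V k \<omega> \<xi>s x =
     (\<Sum>j\<le>k. (- 1) ^ j *
        vf_deriv (base (vb L)) euclideanreal (anchor L \<circ> \<xi>s ! j)
          (\<lambda>y. \<omega> y (map (\<lambda>\<xi>. \<xi> y) (nths \<xi>s (- {j})))) x)
     + (\<Sum>(i, j) | i < j \<and> j \<le> k. (- 1) ^ (i + j) *
        \<omega> x (bracket L V (\<xi>s ! i) (\<xi>s ! j) x # map (\<lambda>\<xi>. \<xi> x) (nths \<xi>s (- {i, j}))))"

text \<open>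
  The form \<open>d\<omega>\<close> is evaluated at \<open>x\<close> on vectors \<open>vs\<close> by extending these to arbitrary local
  sections; the value does not depend on the choice.
\<close>

definition lie_d ::
    "('m, 'e::real_vector, 'a, 'f::real_vector) algebroid \<Rightarrow> nat \<Rightarrow> 'm set
      \<Rightarrow> ('m, 'a) form \<Rightarrow> ('m, 'a) form" where
  "lie_d L k U \<omega> = cut_off (tuples (vb L) U (Suc k)) (\<lambda>x vs.
     THE r. \<forall>V \<xi>s. opens (vb L) V \<and> x \<in> V \<and> V \<subseteq> U \<and>
       set \<xi>s \<subseteq> sections (vb L) V \<and> map (\<lambda>\<xi>. \<xi> x) \<xi>s = vs \<longrightarrow> koszul L V k \<omega> \<xi>s x = r)"

definition forms_sheaf ::
    "('m, 'e::real_vector, 'a, 'f::real_vector) algebroid \<Rightarrow> ('m, ('m, 'a) form) dga_sheaf" where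
  "forms_sheaf L =
     \<lparr>dg_top = mtop (base (vb L)),
      dg_sec = forms (vb L),
      dg_res = (\<lambda>V. cut_off (V \<times> UNIV)),
      dg_add = (\<lambda>k U \<alpha> \<beta> x vs. \<alpha> x vs + \<beta> x vs),
      dg_scale = (\<lambda>k U r \<alpha> x vs. r * \<alpha> x vs),
      dg_mult = (\<lambda>k l U. wedge k l),
      dg_one = (\<lambda>U. cut_off (tuples (vb L) U 0) (\<lambda>_ _. 1)),
      dg_d = lie_d L\<rparr>"


section \<open>Morphisms\<close>

definition pullback ::
    "('m, 'e, 'a, 'f) vbundle \<Rightarrow> ('a \<Rightarrow> 'b) \<Rightarrow> ('m \<Rightarrow> 'n) \<Rightarrow> nat \<Rightarrow> 'm set
      \<Rightarrow> ('n, 'b) form \<Rightarrow> ('m, 'a) form" where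
  "pullback A F f k U \<alpha> = cut_off (tuples A U k) (\<lambda>x vs. \<alpha> (f x) (map F vs))"

definition sharp ::
    "('m, 'e, 'a, 'f) vbundle \<Rightarrow> ('a \<Rightarrow> 'b) \<Rightarrow> ('m \<Rightarrow> 'n) \<Rightarrow> nat \<Rightarrow> 'm set
      \<Rightarrow> ('m \<Rightarrow> ('n set \<times> ('n, 'b) form) set) \<Rightarrow> ('m, 'a) form" where
  "sharp A F f k U s = (\<lambda>x. pullback A F f k U (snd (germ_rep (s x))) x)"

definition algebroid_morphism ::
    "('m, 'e::real_vector, 'a, 'f::real_vector) algebroid
      \<Rightarrow> ('n, 'g::real_vector, 'b, 'h::real_vector) algebroid
      \<Rightarrow> ('a \<Rightarrow> 'b) \<Rightarrow> ('m \<Rightarrow> 'n) \<Rightarrow> bool" where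
  "algebroid_morphism L L' F f \<longleftrightarrow>
     vb_morphism (vb L) (vb L') F f \<and>
     dga_sheaf_morphism (inverse_image (mtop (base (vb L))) f (forms_sheaf L')) (forms_sheaf L)
       (sharp (vb L) F f)"

text \<open>
  Arrows remember source and target; their maps are \<^const>\<open>extensional\<close>, so that equality of
  arrows is equality of maps on the total space and on the base.
\<close>

record ('m, 'e, 'a, 'f) algebroid_arrow =
  source :: "('m, 'e, 'a, 'f) algebroid"
  target :: "('m, 'e, 'a, 'f) algebroid"
  total_map :: "'a \<Rightarrow> 'a"
  base_map :: "'m \<Rightarrow> 'm"

definition algebroids :: "('m, 'e::real_vector, 'a, 'f::real_vector) algebroid set" where
  "algebroids = {L. first_order_lie_algebroid L}"

definition algebroid_arrows ::
    "('m, 'e::real_vector, 'a, 'f::real_vector) algebroid_arrow set" where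
  "algebroid_arrows =
     {u. source u \<in> algebroids \<and> target u \<in> algebroids \<and>
         algebroid_morphism (source u) (target u) (total_map u) (base_map u) \<and>
         total_map u \<in> extensional (points (total (vb (source u)))) \<and>
         base_map u \<in> extensional (points (base (vb (source u))))}"

definition id_arrow ::
    "('m, 'e, 'a, 'f) algebroid \<Rightarrow> ('m, 'e, 'a, 'f) algebroid_arrow" where
  "id_arrow L =
     \<lparr>source = L, target = L,
      total_map = (\<lambda>a\<in>points (total (vb L)). a), base_map = (\<lambda>x\<in>points (base (vb L)). x)\<rparr>"

definition comp_arrow ::
    "('m, 'e, 'a, 'f) algebroid_arrow \<Rightarrow> ('m, 'e, 'a, 'f) algebroid_arrow
      \<Rightarrow> ('m, 'e, 'a, 'f) algebroid_arrow" where
  "comp_arrow v u =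
     \<lparr>source = source u, target = target v,
      total_map = compose (points (total (vb (source u)))) (total_map v) (total_map u),
      base_map = compose (points (base (vb (source u)))) (base_map v) (base_map u)\<rparr>"

end

theory Submission
  imports Defs
begin

text \<open>
  Only two of the category laws carry content: identities and composites have to be first-order Lie
  algebroid morphisms. Equality of arrows is equality of extensional maps, so associativity and the unit
  laws are immediate.

  That composites are bundle morphisms requires the chain rule of Bastiani calculus in arbitrary locally
  convex spaces. It is proved here in the form of the formula of Faa di Bruno: every
  iterated directional derivative of \<open>g \<circ> f\<close> is a sum of iterated derivatives of \<open>g\<close> whose directions are
  iterated derivatives of \<open>f\<close> (\<open>iter_deriv_compose\<close>). Differentiating one such term takes a mean value
  theorem, stated with convex neighbourhoods (\<open>average_slope_in_convex\<close>), and the multilinearity of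
  iterated derivatives that follows from it (\<open>iter_deriv_affine_slot\<close>). Working with lists of directions
  avoids the iterated tangent maps \<open>T\<^sup>kf\<close>, which live on spaces of growing type. Smoothness being
  local, the chain rule passes to manifolds (\<open>smooth_map_compose\<close>).

  The condition that \<open>F\<^sup>\<sharp>\<close> is a morphism of sheaves of dg algebras is formulated on the inverse image
  sheaf, whose sections are families of germs. It is equivalent to a condition on honest forms
  (\<open>algebroid_morphism_iff\<close>): for every open \<open>V\<close> the pullback maps forms over \<open>V\<close> to forms over the
  preimage of \<open>V\<close> and commutes with the differentials. This rests on the sheaf property of forms
  (\<open>forms_glue\<close>) and on the locality of the differential (\<open>lie_d_local\<close>). The condition on honest
  forms holds trivially for identities, and it holds for composites because
  \<open>(G \<circ> F)\<^sup>*t = F\<^sup>*(G\<^sup>*t)\<close>, where \<open>G\<^sup>*t\<close> is again a form.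
\<close>

section \<open>Limits in locally convex spaces\<close>

lemma lcsD:
  assumes "lcs T"
  shows lcs_subspace: "subspace (topspace T)"
    and lcs_Hausdorff: "Hausdorff_space T"
    and lcs_continuous_add: "continuous_map (prod_topology T T) T (\<lambda>(v, w). v + w)"
    and lcs_continuous_scale: "continuous_map (prod_topology euclideanreal T) T (\<lambda>(r, v). r *\<^sub>R v)"
    and lcs_convex_nhd: "openin T W \<Longrightarrow> 0 \<in> W \<Longrightarrow> \<exists>C. openin T C \<and> convex C \<and> 0 \<in> C \<and> C \<subseteq> W"
  using assms unfolding lcs_def by blast+

lemma limitin_add:
  assumes "lcs T" "limitin T f a F" "limitin T g b F"
  shows "limitin T (\<lambda>z. f z + g z) (a + b) F"
proof -
  have "limitin (prod_topology T T) (\<lambda>z. (f z, g z)) (a, b) F"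
    using assms by (simp add: limitin_pairwise o_def)
  from continuous_map_limit[OF lcs_continuous_add[OF assms(1)] this]
  show ?thesis by (simp add: o_def)
qed

lemma limitin_scale:
  assumes "lcs T" "(r \<longlongrightarrow> r0) F" "limitin T f a F"
  shows "limitin T (\<lambda>z. r z *\<^sub>R f z) (r0 *\<^sub>R a) F"
proof -
  have "limitin (prod_topology euclideanreal T) (\<lambda>z. (r z, f z)) (r0, a) F"
    using assms by (simp add: limitin_pairwise o_def)
  from continuous_map_limit[OF lcs_continuous_scale[OF assms(1)] this]
  show ?thesis by (simp add: o_def)
qed

lemma limitin_sum_list:
  assumes "lcs T" "\<And>i. i \<in> set xs \<Longrightarrow> limitin T (f i) (a i) F"
  shows "limitin T (\<lambda>z. \<Sum>i\<leftarrow>xs. f i z) (\<Sum>i\<leftarrow>xs. a i) F"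
  using assms(2)
proof (induction xs)
  case Nil
  show ?case using subspace_0[OF lcs_subspace[OF assms(1)]] by simp
next
  case (Cons x xs)
  then show ?case by (auto intro!: limitin_add[OF assms(1)])
qed

lemma continuous_map_sum_list:
  assumes "lcs T" "\<And>i. i \<in> set xs \<Longrightarrow> continuous_map Z T (f i)"
  shows "continuous_map Z T (\<lambda>z. \<Sum>i\<leftarrow>xs. f i z)"
  using assms(2)
proof (induction xs)
  case Nil
  show ?case using subspace_0[OF lcs_subspace[OF assms(1)]] by simp
next
  case (Cons x xs)
  have "continuous_map Z (prod_topology T T) (\<lambda>z. (f x z, \<Sum>i\<leftarrow>xs. f i z))"
    using Cons by (simp add: continuous_map_pairwise o_def)
  from continuous_map_compose[OF this lcs_continuous_add[OF assms(1)]]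
  show ?case by (simp add: o_def)
qed

text \<open>
  Translations are homeomorphisms, so the convex neighbourhoods of the origin can be moved to any point.
\<close>

lemma lcs_convex_nhd_at:
  assumes "lcs T" "openin T W" "l \<in> W"
  obtains C where "openin T C" "convex C" "l \<in> C" "C \<subseteq> W"
proof -
  have l: "l \<in> topspace T" using assms openin_subset by blast
  have shift: "continuous_map T T (\<lambda>v. v + a)" if "a \<in> topspace T" for a
  proof -
    have "continuous_map T (prod_topology T T) (\<lambda>v. (v, a))"
      using that by (simp add: continuous_map_pairwise o_def)
    from continuous_map_compose[OF this lcs_continuous_add[OF assms(1)]]
    show ?thesis by (simp add: o_def)
  qed
  have ml: "- l \<in> topspace T" "0 \<in> topspace T"
    using l lcs_subspace[OF assms(1)] by (auto simp: subspace_neg subspace_0)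
  have "openin T {v \<in> topspace T. v + l \<in> W}"
    using openin_continuous_map_preimage[OF shift[OF l] assms(2)] .
  then obtain C where C: "openin T C" "convex C" "0 \<in> C" "C \<subseteq> {v \<in> topspace T. v + l \<in> W}"
    using lcs_convex_nhd[OF assms(1)] assms(3) ml(2)
    by (smt (verit, ccfv_threshold) add_0 mem_Collect_eq)
  have sub: "C \<subseteq> topspace T" using C(1) openin_subset by blast
  define D where "D = {v \<in> topspace T. v + (- l) \<in> C}"
  have "openin T D" unfolding D_def
    using openin_continuous_map_preimage[OF shift[OF ml(1)] C(1)] .
  moreover have D: "D = (\<lambda>v. v + l) ` C"
  proof
    show "D \<subseteq> (\<lambda>v. v + l) ` C" by (force simp: D_def image_iff)
    show "(\<lambda>v. v + l) ` C \<subseteq> D"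
      using sub l lcs_subspace[OF assms(1)] by (auto simp: D_def subspace_add)
  qed
  moreover have "convex D" unfolding D using C(2)
    by (metis (no_types, lifting) ext add.commute convex_translation_eq)
  ultimately show thesis using that[of D] C by force
qed

section \<open>A mean value theorem in convex form\<close>

text \<open>
  Over adjacent intervals the average slope is a convex combination of the two average slopes. This is
  what makes the property in the next lemma transitive in the sense of \<open>Bolzano\<close>.
\<close>

lemma convex_average_slope:
  fixes p q :: "'a::real_vector"
  assumes C: "convex C" and "u < v" "v < w"
    and "(1 / (v - u)) *\<^sub>R p \<in> C" "(1 / (w - v)) *\<^sub>R q \<in> C"
  shows "(1 / (w - u)) *\<^sub>R (p + q) \<in> C"
proof -
  have "((v - u) / (w - u)) *\<^sub>R ((1 / (v - u)) *\<^sub>R p) + ((w - v) / (w - u)) *\<^sub>R ((1 / (w - v)) *\<^sub>R q) \<in> C"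
    by (rule convexD[OF C assms(4,5)]) (use assms(2,3) in \<open>simp_all add: add_divide_distrib[symmetric]\<close>)
  moreover have "((v - u) / (w - u)) *\<^sub>R ((1 / (v - u)) *\<^sub>R p) = (1 / (w - u)) *\<^sub>R p"
    "((w - v) / (w - u)) *\<^sub>R ((1 / (w - v)) *\<^sub>R q) = (1 / (w - u)) *\<^sub>R q"
    using assms(2,3) by simp_all
  ultimately show ?thesis by (simp only: scaleR_add_right)
qed

text \<open>
  By bisection it suffices to look at short intervals around one point, where the differentiability at
  that point puts the slopes on either side of it into the open set \<open>C\<close>.
\<close>

lemma average_slope_in_convex:
  fixes c :: "real \<Rightarrow> 'a::real_vector"
  assumes C: "convex C" "openin S C" and ab: "a < b"
    and der: "\<And>s. a \<le> s \<Longrightarrow> s \<le> b \<Longrightarrow> limitin S (difference_quotient c s 1) (c' s) (at 0)"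
    and in_C: "\<And>s. a \<le> s \<Longrightarrow> s \<le> b \<Longrightarrow> c' s \<in> C"
  shows "(1 / (b - a)) *\<^sub>R (c b - c a) \<in> C"
proof -
  define P where "P u v \<longleftrightarrow> (u < v \<longrightarrow> (1 / (v - u)) *\<^sub>R (c v - c u) \<in> C)" for u v
  have trans: "P u w" if "P u v" "P v w" "u \<le> v" "v \<le> w" for u v w
    using convex_average_slope[OF C(1), of u v w "c v - c u" "c w - c v"] that
    by (cases "u < v"; cases "v < w") (auto simp: P_def)
  have "a \<le> b" using ab by simp
  then have "P a b"
  proof (induct rule: Bolzano)
    case (trans u v w)
    then show ?case using \<open>\<And>w v u. P u v \<Longrightarrow> P v w \<Longrightarrow> u \<le> v \<Longrightarrow> v \<le> w \<Longrightarrow> P u w\<close> by blast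
  next
    case (local x)
    have "eventually (\<lambda>t. difference_quotient c x 1 t \<in> C) (at 0)"
      by (rule limitinD[OF der[OF local] C(2) in_C[OF local]])
    then obtain d where d: "d > 0" "\<And>t. t \<noteq> 0 \<Longrightarrow> \<bar>t\<bar> < d \<Longrightarrow> difference_quotient c x 1 t \<in> C"
      unfolding eventually_at dist_real_def by auto
    have right: "P x v" if "v - x < d" for v
      using d(2)[of "v - x"] that by (auto simp: difference_quotient_def P_def)
    have left: "P u x" if "x - u < d" for u
    proof -
      have "(1 / (x - u)) *\<^sub>R (c x - c u) = difference_quotient c x 1 (u - x)"
      proof -
        have a: "1 / (u - x) = - (1 / (x - u))" by (metis minus_diff_eq minus_divide_right)
        have b: "c u - c x = - (c x - c u)" by simp
        have "(1 / (x - u)) *\<^sub>R (c x - c u) = (1 / (u - x)) *\<^sub>R (c u - c x)"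
          by (simp only: a b scaleR_minus_left scaleR_minus_right minus_minus)
        then show ?thesis by (simp add: difference_quotient_def)
      qed
      moreover have "difference_quotient c x 1 (u - x) \<in> C" if "u < x"
        using d(2)[of "u - x"] that \<open>x - u < d\<close> by simp
      ultimately show ?thesis by (simp only: P_def) blast
    qed
    show ?case
    proof (intro exI conjI allI impI)
      show "d > 0" by fact
      fix u v assume uv: "u \<le> x \<and> x \<le> v \<and> v - u < d"
      then have "P u x" "P x v" using left[of u] right[of v] by linarith+
      then show "P u v" using trans uv by blast
    qed
  qed
  then show ?thesis using ab unfolding P_def by simp
qed

text \<open>
  The analytic core of the chain rule. The function \<open>h t\<close>, the base point \<open>y t\<close> and the direction \<open>q t\<close>
  may all vary with \<open>t\<close>; all that counts is that the derivatives on the segment from \<open>y t\<close> to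
  \<open>y t + t q t\<close> converge as \<open>t \<rightarrow> 0\<close>, uniformly along the segment. The product with the principal filter of
  \<open>[0,1]\<close> expresses this uniformity, and it lets limits along the segment be computed with the usual rules
  for limits.
\<close>

lemma quotient_limit_from_derivative:
  fixes h :: "real \<Rightarrow> 'e::real_vector \<Rightarrow> 'f::real_vector"
  assumes S: "lcs S"
    and der: "eventually (\<lambda>(t, s). limitin S (difference_quotient (h t) (y t + (s * t) *\<^sub>R q t) (q t)) (D t s) (at 0))
           (at 0 \<times>\<^sub>F principal {0..1})"
    and D: "limitin S (\<lambda>(t, s). D t s) l (at 0 \<times>\<^sub>F principal {0..1})"
  shows "limitin S (\<lambda>t. (1 / t) *\<^sub>R (h t (y t + t *\<^sub>R q t) - h t (y t))) l (at 0)"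
  unfolding limitin_def
proof (intro conjI allI impI)
  show "l \<in> topspace S" by (rule limitin_topspace[OF D])
  fix W assume "openin S W \<and> l \<in> W"
  then obtain C where C: "openin S C" "convex C" "l \<in> C" "C \<subseteq> W"
    using lcs_convex_nhd_at[OF S] by metis
  have "eventually (\<lambda>(t, s). D t s \<in> C) (at 0 \<times>\<^sub>F principal {0..1})"
    using D C unfolding limitin_def by (simp add: case_prod_unfold)
  with der have "eventually (\<lambda>(t, s). D t s \<in> C \<and>
      limitin S (difference_quotient (h t) (y t + (s * t) *\<^sub>R q t) (q t)) (D t s) (at 0))
      (at 0 \<times>\<^sub>F principal {0..1})"
    by eventually_elim auto
  then have "eventually (\<lambda>t. \<forall>s\<in>{0..1}. D t s \<in> C \<and>
      limitin S (difference_quotient (h t) (y t + (s * t) *\<^sub>R q t) (q t)) (D t s) (at 0)) (at 0)"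
    unfolding eventually_prod_filter eventually_principal by (auto elim!: eventually_mono)
  moreover have "eventually (\<lambda>t. t \<noteq> (0::real)) (at 0)"
    by (simp add: eventually_at_filter)
  ultimately show "eventually (\<lambda>t. (1 / t) *\<^sub>R (h t (y t + t *\<^sub>R q t) - h t (y t)) \<in> W) (at 0)"
  proof eventually_elim
    case (elim t)
    \<comment> \<open>The curve \<open>c\<close> runs along the segment with velocity \<open>q t\<close>, for \<open>s\<close> between \<open>0\<close> and \<open>t\<close>; its parameter
       in \<open>[0,1]\<close> is \<open>s / t\<close>, also when \<open>t\<close> is negative.\<close>
    define c where "c s = h t (y t + s *\<^sub>R q t)" for s
    have quot: "difference_quotient c s 1 = difference_quotient (h t) (y t + s *\<^sub>R q t) (q t)" for s
      by (auto simp: fun_eq_iff difference_quotient_def c_def algebra_simps)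
    have der_c: "limitin S (difference_quotient c s 1) (D t (s / t)) (at 0) \<and> D t (s / t) \<in> C"
      if "s / t \<in> {0..1}" for s
      using bspec[OF elim(1) that] elim(2) by (simp add: quot)
    have "(1 / t) *\<^sub>R (c t - c 0) \<in> C"
    proof (cases "t > 0")
      case True
      then show ?thesis
        using average_slope_in_convex[OF C(2,1), of 0 t c "\<lambda>s. D t (s / t)"] der_c by auto
    next
      case False
      with elim have neg: "t < 0" by simp
      have "(1 / (0 - t)) *\<^sub>R (c 0 - c t) \<in> C"
        by (rule average_slope_in_convex[OF C(2,1) neg, of c "\<lambda>s. D t (s / t)"])
          (use der_c neg in \<open>auto simp: divide_simps\<close>)
      then show ?thesis by (simp add: scaleR_right_diff_distrib)
    qed
    then show ?case using C(4) by (auto simp: c_def)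
  qed
qed

section \<open>Iterated directional derivatives\<close>

text \<open>
  Directional derivatives depend only on the germ of a function as soon as \<open>t \<mapsto> x + t v\<close> is continuous at
  \<open>0\<close>. Isolating this property makes locality applicable to \<^const>\<open>power_top\<close>, the space in which the
  arguments of a form live, where it can be checked componentwise.
\<close>

definition lines_continuous :: "'e::real_vector topology \<Rightarrow> bool" where
  "lines_continuous T \<longleftrightarrow>
     (\<forall>x\<in>topspace T. \<forall>v\<in>topspace T. limitin T (\<lambda>t. x + t *\<^sub>R v) x (at 0))"

lemma lcs_lines_continuous:
  assumes "lcs T"
  shows "lines_continuous T"
  unfolding lines_continuous_def
proof (intro ballI)
  fix x v assume "x \<in> topspace T" "v \<in> topspace T"
  then have "limitin T (\<lambda>t. x + t *\<^sub>R v) (x + 0 *\<^sub>R v) (at 0)"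
    by (intro limitin_add[OF assms] limitin_scale[OF assms]) auto
  then show "limitin T (\<lambda>t. x + t *\<^sub>R v) x (at 0)" by simp
qed

lemma eventually_on_line:
  assumes "lines_continuous T" "openin T U" "x \<in> U" "v \<in> topspace T"
  shows "eventually (\<lambda>t. x + t *\<^sub>R v \<in> U) (at 0)"
proof -
  have "x \<in> topspace T" using assms(2,3) openin_subset by blast
  then have "limitin T (\<lambda>t. x + t *\<^sub>R v) x (at 0)"
    using assms(1,4) unfolding lines_continuous_def by simp
  from limitinD[OF this assms(2,3)] show ?thesis .
qed

lemma difference_quotient_limit_cong:
  assumes "lines_continuous T" "openin T U" "x \<in> U" "v \<in> topspace T" "\<And>y. y \<in> U \<Longrightarrow> f y = g y"
  shows "limitin S (difference_quotient f x v) l (at 0) \<longleftrightarrow> limitin S (difference_quotient g x v) l (at 0)"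
proof -
  have eq: "eventually (\<lambda>t. difference_quotient f x v t = difference_quotient g x v t) (at 0)"
    using eventually_on_line[OF assms(1-4)]
    by eventually_elim (simp add: difference_quotient_def assms(3,5))
  then have eq': "eventually (\<lambda>t. difference_quotient g x v t = difference_quotient f x v t) (at 0)"
    by eventually_elim simp
  show ?thesis
    by (rule iffI) (erule limitin_transform_eventually[OF eq] limitin_transform_eventually[OF eq'])+
qed

lemma dir_deriv_cong_open:
  assumes "lines_continuous T" "openin T U" "x \<in> U" "v \<in> topspace T" "\<And>y. y \<in> U \<Longrightarrow> f y = g y"
  shows "dir_deriv S f x v = dir_deriv S g x v"
  unfolding dir_deriv_def using difference_quotient_limit_cong[OF assms] by simp

lemma iter_deriv_cong_open:
  assumes "lines_continuous T" "openin T U" "\<And>y. y \<in> U \<Longrightarrow> f y = g y"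
    and "set vs \<subseteq> topspace T" "x \<in> U"
  shows "iter_deriv S f vs x = iter_deriv S g vs x"
  using assms(4,5)
proof (induction vs arbitrary: x)
  case Nil
  then show ?case by (simp add: assms(3))
next
  case (Cons v vs)
  then show ?case by (auto intro!: dir_deriv_cong_open[OF assms(1,2)])
qed

lemma dir_deriv_eqI:
  assumes "Hausdorff_space S" "limitin S (difference_quotient f x v) l (at 0)"
  shows "dir_deriv S f x v = l"
  unfolding dir_deriv_def
proof (rule the_equality)
  show "k = l" if "limitin S (difference_quotient f x v) k (at 0)" for k
    by (rule limitin_Hausdorff_unique[OF that assms(2) _ assms(1)]) simp
qed fact

lemma smooth_on_openin: "smooth_on T U S f \<Longrightarrow> openin T U"
  by (simp add: smooth_on_def)

lemma smooth_on_image: "smooth_on T U S f \<Longrightarrow> f ` U \<subseteq> topspace S"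
  by (simp add: smooth_on_def)

lemma smooth_on_has_derivative:
  assumes "smooth_on T U S f" "Hausdorff_space S" "set vs \<subseteq> topspace T" "v \<in> topspace T" "x \<in> U"
  shows "limitin S (difference_quotient (iter_deriv S f vs) x v) (iter_deriv S f (v # vs) x) (at 0)"
proof -
  obtain l where l: "limitin S (difference_quotient (iter_deriv S f vs) x v) l (at 0)"
    using assms(1,3,4,5) unfolding smooth_on_def by blast
  then show ?thesis using dir_deriv_eqI[OF assms(2) l] by simp
qed

lemma map_restrict_nth_upt: "map (\<lambda>i\<in>{..<length ls}. A (ls ! i)) [0..<length ls] = map A ls"
  by (rule nth_equalityI) auto

text \<open>
  Joint continuity of the iterated derivatives, in the form in which it is applied: the base point and all
  directions may converge simultaneously along any filter. The index list \<open>ls\<close> avoids reference to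
  positions in tuples.
\<close>

lemma smooth_on_limit:
  assumes f: "smooth_on T U S f" and y: "limitin T y y0 F" "y0 \<in> U"
    and A: "\<And>i. i \<in> set ls \<Longrightarrow> limitin T (A i) (A0 i) F"
  shows "limitin S (\<lambda>z. iter_deriv S f (map (\<lambda>i. A i z) ls) (y z)) (iter_deriv S f (map A0 ls) y0) F"
proof -
  let ?n = "length ls"
  let ?h = "\<lambda>z. \<lambda>i\<in>{..<?n}. A (ls ! i) z" and ?k = "\<lambda>i\<in>{..<?n}. A0 (ls ! i)"
  have A': "limitin T (A (ls ! i)) (A0 (ls ! i)) F" if "i < ?n" for i
    using A that by simp
  have ev: "eventually (\<lambda>z. A (ls ! i) z \<in> topspace T) F" if "i < ?n" for i
    using limitinD[OF A'[OF that] openin_topspace limitin_topspace[OF A'[OF that]]] .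
  have "eventually (\<lambda>z. \<forall>i\<in>{..<?n}. A (ls ! i) z \<in> topspace T) F"
    using ev by (simp add: eventually_ball_finite)
  then have "limitin (product_topology (\<lambda>_. T) {..<?n}) ?h ?k F"
    unfolding limitin_componentwise using A'
    by (auto elim!: eventually_mono simp: PiE_iff)
  moreover have "limitin (subtopology T U) y y0 F"
    unfolding limitin_subtopology using y limitinD[OF y(1) smooth_on_openin[OF f] y(2)] by simp
  ultimately have "limitin (prod_topology (subtopology T U) (product_topology (\<lambda>_. T) {..<?n}))
      (\<lambda>z. (y z, ?h z)) (y0, ?k) F"
    by (simp add: limitin_pairwise o_def)
  moreover have cont: "continuous_map (prod_topology (subtopology T U) (product_topology (\<lambda>_. T) {..<?n})) S
        (\<lambda>(x, h). iter_deriv S f (map h [0..<?n]) x)"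
    using f unfolding smooth_on_def by blast
  ultimately have "limitin S ((\<lambda>(x, h). iter_deriv S f (map h [0..<?n]) x) \<circ> (\<lambda>z. (y z, ?h z)))
      ((\<lambda>(x, h). iter_deriv S f (map h [0..<?n]) x) (y0, ?k)) F"
    by (intro continuous_map_limit[OF cont])
  then show ?thesis by (simp only: o_def case_prod_conv map_restrict_nth_upt[where A = A0]
        map_restrict_nth_upt[where A = "\<lambda>i. A i z" for z])
qed

lemma smooth_on_continuous_map:
  assumes f: "smooth_on T U S f" and y: "continuous_map Z (subtopology T U) y"
    and A: "\<And>i. i \<in> set ls \<Longrightarrow> continuous_map Z T (A i)"
  shows "continuous_map Z S (\<lambda>z. iter_deriv S f (map (\<lambda>i. A i z) ls) (y z))"
proof -
  let ?n = "length ls"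
  let ?h = "\<lambda>z. \<lambda>i\<in>{..<?n}. A (ls ! i) z"
  have "continuous_map Z (product_topology (\<lambda>_. T) {..<?n}) ?h"
    unfolding continuous_map_componentwise using A by auto
  with y have "continuous_map Z (prod_topology (subtopology T U) (product_topology (\<lambda>_. T) {..<?n}))
      (\<lambda>z. (y z, ?h z))"
    by (simp add: continuous_map_pairwise o_def)
  moreover have cont: "continuous_map (prod_topology (subtopology T U) (product_topology (\<lambda>_. T) {..<?n})) S
        (\<lambda>(x, h). iter_deriv S f (map h [0..<?n]) x)"
    using f unfolding smooth_on_def by blast
  ultimately have "continuous_map Z S ((\<lambda>(x, h). iter_deriv S f (map h [0..<?n]) x) \<circ> (\<lambda>z. (y z, ?h z)))"
    by (intro continuous_map_compose[OF _ cont])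
  then show ?thesis by (simp only: o_def case_prod_conv map_restrict_nth_upt[where A = "\<lambda>i. A i z" for z])
qed

lemma smooth_on_iter_deriv_closed:
  assumes "smooth_on T U S f" "x \<in> U" "set vs \<subseteq> topspace T"
  shows "iter_deriv S f vs x \<in> topspace S"
proof -
  have "x \<in> topspace T" using assms openin_subset[OF smooth_on_openin] by blast
  then have "limitin S (\<lambda>z. iter_deriv S f (map (\<lambda>i. i) vs) x) (iter_deriv S f (map (\<lambda>i. i) vs) x) (at (0::real))"
    using assms by (intro smooth_on_limit[OF assms(1)]) auto
  from limitin_topspace[OF this] show ?thesis by simp
qed

lemma difference_quotient_limit_continuous:
  fixes c :: "real \<Rightarrow> 'e::real_vector"
  assumes S: "lcs S" and "c 0 \<in> topspace S" and "limitin S (difference_quotient c 0 1) l (at 0)"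
  shows "limitin S c (c 0) (at 0)"
proof -
  have "limitin S (\<lambda>t. c 0 + t *\<^sub>R difference_quotient c 0 1 t) (c 0 + 0 *\<^sub>R l) (at 0)"
    using assms by (intro limitin_add[OF S] limitin_scale[OF S]) auto
  moreover have "eventually (\<lambda>t. c 0 + t *\<^sub>R difference_quotient c 0 1 t = c t) (at 0)"
    unfolding eventually_at_filter by (simp add: difference_quotient_def)
  ultimately show ?thesis by (simp add: limitin_transform_eventually)
qed

section \<open>The chain rule for Bastiani calculus\<close>

lemma limitin_fst_param:
  assumes "limitin X f l F"
  shows "limitin X (\<lambda>z. f (fst z)) l (F \<times>\<^sub>F G)"
  unfolding limitin_def
proof (intro conjI allI impI)
  show "l \<in> topspace X" by (rule limitin_topspace[OF assms])
  fix W assume "openin X W \<and> l \<in> W"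
  then have "eventually (\<lambda>t. f t \<in> W) F" using limitinD[OF assms] by simp
  then have "eventually (\<lambda>z. f (fst z) \<in> W \<and> True) (F \<times>\<^sub>F G)"
    using eventually_prodI[of "\<lambda>t. f t \<in> W" F "\<lambda>_. True" G] by simp
  then show "eventually (\<lambda>z. f (fst z) \<in> W) (F \<times>\<^sub>F G)" by simp
qed

lemma tendsto_fst_param: "((\<lambda>z. fst z) \<longlongrightarrow> (0::real)) (at 0 \<times>\<^sub>F G)"
  using limitin_fst_param[of euclidean "\<lambda>t. t" "0::real" "at 0" G] by simp

text \<open>
  In the pair \<open>(t, s)\<close> the second component \<open>s \<in> [0,1]\<close> is the position on the segment.
\<close>

lemma tendsto_segment_param:
  "((\<lambda>z. snd z * fst z) \<longlongrightarrow> (0::real)) (at 0 \<times>\<^sub>F principal {0..1})"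
proof (rule Lim_null_comparison)
  show "((\<lambda>z. \<bar>fst z\<bar>) \<longlongrightarrow> (0::real)) (at 0 \<times>\<^sub>F principal {0..1::real})"
    using tendsto_rabs_zero[OF tendsto_fst_param] .
  have "eventually (\<lambda>z. True \<and> snd z \<in> {0..1}) ((at (0::real)) \<times>\<^sub>F principal {0..1::real})"
    by (intro eventually_prodI) (auto simp: eventually_principal)
  then show "eventually (\<lambda>z. norm (snd z * fst z) \<le> \<bar>fst z\<bar>) (at (0::real) \<times>\<^sub>F principal {0..1::real})"
    by eventually_elim (auto simp: abs_mult intro: mult_left_le_one_le)
qed

text \<open>
  Bastiani calculus does not postulate that the derivative is additive in the direction. It follows from
  continuity: the increment along \<open>v + w\<close> is the increment along \<open>v\<close> followed by the one along \<open>w\<close> from the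
  moving point \<open>x + t v\<close>.
\<close>

lemma iter_deriv_add_head:
  assumes T: "lcs T" and S: "lcs S" and f: "smooth_on T U S f"
    and vs: "set vs \<subseteq> topspace T" "v \<in> topspace T" "w \<in> topspace T" and x: "x \<in> U"
  shows "iter_deriv S f ((v + w) # vs) x = iter_deriv S f (v # vs) x + iter_deriv S f (w # vs) x"
proof -
  let ?h = "iter_deriv S f vs" and ?F = "at (0::real) \<times>\<^sub>F principal {0..1::real}"
  let ?p = "\<lambda>z. x + fst z *\<^sub>R v + (snd z * fst z) *\<^sub>R w"
  have H: "Hausdorff_space S" by (rule lcs_Hausdorff[OF S])
  have xT: "x \<in> topspace T" using x openin_subset[OF smooth_on_openin[OF f]] by blast
  have "limitin T ?p (x + 0 *\<^sub>R v + 0 *\<^sub>R w) ?F"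
    by (intro limitin_add[OF T] limitin_scale[OF T] tendsto_fst_param tendsto_segment_param)
      (use vs xT in simp_all)
  then have p: "limitin T ?p x ?F" by simp
  have der: "eventually (\<lambda>z. limitin S (difference_quotient ?h (?p z) w)
      (iter_deriv S f (w # vs) (?p z)) (at 0)) ?F"
    using limitinD[OF p smooth_on_openin[OF f] x]
    by eventually_elim (rule smooth_on_has_derivative[OF f H vs(1,3)])
  have "limitin S (\<lambda>z. iter_deriv S f (map (\<lambda>u. u) (w # vs)) (?p z))
      (iter_deriv S f (map (\<lambda>u. u) (w # vs)) x) ?F"
    by (rule smooth_on_limit[OF f p x]) (use vs in auto)
  then have cont: "limitin S (\<lambda>z. iter_deriv S f (w # vs) (?p z)) (iter_deriv S f (w # vs) x) ?F"
    by simp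
  have "limitin S (\<lambda>t. (1 / t) *\<^sub>R (?h ((x + t *\<^sub>R v) + t *\<^sub>R w) - ?h (x + t *\<^sub>R v)))
      (iter_deriv S f (w # vs) x) (at 0)"
    by (rule quotient_limit_from_derivative[OF S, where h = "\<lambda>_. ?h" and y = "\<lambda>t. x + t *\<^sub>R v"
          and q = "\<lambda>_. w" and D = "\<lambda>t s. iter_deriv S f (w # vs) (?p (t, s))"])
      (use der cont in \<open>simp_all only: case_prod_unfold fst_conv snd_conv\<close>)
  from limitin_add[OF S this smooth_on_has_derivative[OF f H vs(1,2) x]]
  have "limitin S (difference_quotient ?h x (v + w))
      (iter_deriv S f (w # vs) x + iter_deriv S f (v # vs) x) (at 0)"
    by (simp add: difference_quotient_def[abs_def] scaleR_right_diff_distrib scaleR_add_right add.assoc)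
  from dir_deriv_eqI[OF H this] show ?thesis by (simp add: add.commute)
qed

lemma iter_deriv_scale_head:
  assumes S: "Hausdorff_space S" "lcs S" and f: "smooth_on T U S f"
    and vs: "set vs \<subseteq> topspace T" "v \<in> topspace T" and x: "x \<in> U"
  shows "iter_deriv S f ((r *\<^sub>R v) # vs) x = r *\<^sub>R iter_deriv S f (v # vs) x"
proof -
  let ?h = "iter_deriv S f vs"
  note lim = smooth_on_has_derivative[OF f S(1) vs x]
  have "limitin S (difference_quotient ?h x (r *\<^sub>R v)) (r *\<^sub>R iter_deriv S f (v # vs) x) (at 0)"
  proof (cases "r = 0")
    case True
    then show ?thesis using subspace_0[OF lcs_subspace[OF S(2)]]
      by (simp add: difference_quotient_def[abs_def])
  next
    case False
    \<comment> \<open>Up to the factor \<open>r\<close>, the difference quotient along \<open>r v\<close> is the one along \<open>v\<close> at time \<open>r t\<close>.\<close>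
    have "filterlim (\<lambda>t. r * t) (at 0) (at 0)"
      unfolding filterlim_at using False
      by (auto intro!: tendsto_mult_right_zero simp: eventually_at_filter)
    then have "limitin S (\<lambda>t. difference_quotient ?h x v (r * t)) (iter_deriv S f (v # vs) x) (at 0)"
      using lim unfolding limitin_def by (auto intro: eventually_compose_filterlim)
    from limitin_scale[OF S(2) tendsto_const this, of r] False
    show ?thesis by (simp add: difference_quotient_def[abs_def] mult.commute)
  qed
  from dir_deriv_eqI[OF S(1) this] show ?thesis by simp
qed

text \<open>
  Linearity in the direction of the outermost of the differentiations in \<open>a # ws\<close> holds on the whole open
  set \<open>U\<close>, so it is an identity of functions, which the further differentiations \<open>us\<close> preserve.
\<close>

lemma iter_deriv_affine_slot:
  assumes T: "lcs T" and S: "lcs S" and f: "smooth_on T U S f"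
    and ws: "set ws \<subseteq> topspace T" "a \<in> topspace T" "b \<in> topspace T"
  shows "set us \<subseteq> topspace T \<Longrightarrow> x \<in> U \<Longrightarrow> iter_deriv S f (us @ (a + r *\<^sub>R b) # ws) x
    = iter_deriv S f (us @ a # ws) x + r *\<^sub>R iter_deriv S f (us @ b # ws) x"
proof (induction us arbitrary: x)
  case Nil
  have "r *\<^sub>R b \<in> topspace T" using ws(3) lcs_subspace[OF T] by (simp add: subspace_scale)
  then show ?case
    using iter_deriv_add_head[OF T S f ws(1,2) _ Nil(2)]
      iter_deriv_scale_head[OF lcs_Hausdorff[OF S] S f ws(1,3) Nil(2)] by simp
next
  case (Cons u us)
  let ?s = "\<lambda>x. iter_deriv S f (us @ a # ws) x + r *\<^sub>R iter_deriv S f (us @ b # ws) x"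
  have u: "u \<in> topspace T" "set (us @ a # ws) \<subseteq> topspace T" "set (us @ b # ws) \<subseteq> topspace T"
    using Cons.prems ws by auto
  note lim = smooth_on_has_derivative[OF f lcs_Hausdorff[OF S] _ u(1) Cons.prems(2)]
  have "dir_deriv S (iter_deriv S f (us @ (a + r *\<^sub>R b) # ws)) x u = dir_deriv S ?s x u"
    using Cons by (intro dir_deriv_cong_open[OF lcs_lines_continuous[OF T] smooth_on_openin[OF f]]) auto
  also have "\<dots> = iter_deriv S f (u # us @ a # ws) x + r *\<^sub>R iter_deriv S f (u # us @ b # ws) x"
  proof (rule dir_deriv_eqI[OF lcs_Hausdorff[OF S]])
    show "limitin S (difference_quotient ?s x u)
      (iter_deriv S f (u # us @ a # ws) x + r *\<^sub>R iter_deriv S f (u # us @ b # ws) x) (at 0)"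
      using limitin_add[OF S lim[OF u(2)] limitin_scale[OF S tendsto_const lim[OF u(3)], of r]]
      by (simp add: difference_quotient_def[abs_def] algebra_simps)
  qed
  finally show ?case by simp
qed

text \<open>
  With \<open>\<delta>\<close> standing for differentiation, these lists index the summands in the Leibniz rule for a
  multilinear expression.
\<close>

primrec replace_one :: "('a \<Rightarrow> 'a) \<Rightarrow> 'a list \<Rightarrow> 'a list list" where
  "replace_one \<delta> [] = []"
| "replace_one \<delta> (i # is) = (\<delta> i # is) # map ((#) i) (replace_one \<delta> is)"

text \<open>
  Leibniz rule at a fixed base point, by the usual telescoping: the entries \<open>js\<close> have already been moved
  from time \<open>0\<close> to time \<open>t\<close>, the entries \<open>is\<close> are still to be moved. Multilinearity turns the increment
  in one slot into \<open>t\<close> times the value at its difference quotient. The indices \<open>i\<close> name curves \<open>A i\<close>, and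
  \<open>\<delta> i\<close> names a curve whose value at \<open>0\<close> is the velocity of \<open>A i\<close> there.
\<close>

lemma slots_derivative:
  fixes A :: "'i \<Rightarrow> real \<Rightarrow> 'e::real_vector"
  assumes T: "lcs T" and S: "lcs S" and f: "smooth_on T U S f" and y: "y \<in> U"
    and js: "\<And>j. j \<in> set js \<Longrightarrow> limitin T (A j) (A j 0) (at 0)"
    and ders: "\<And>i. i \<in> set is \<Longrightarrow> A i 0 \<in> topspace T"
      "\<And>i. i \<in> set is \<Longrightarrow> limitin T (difference_quotient (A i) 0 1) (A (\<delta> i) 0) (at 0)"
  shows "limitin S
     (\<lambda>t. (1 / t) *\<^sub>R (iter_deriv S f (map (\<lambda>j. A j t) js @ map (\<lambda>i. A i t) is) y
                     - iter_deriv S f (map (\<lambda>j. A j t) js @ map (\<lambda>i. A i 0) is) y))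
     (\<Sum>ks\<leftarrow>replace_one \<delta> is. iter_deriv S f (map (\<lambda>j. A j 0) (js @ ks)) y) (at 0)"
  using js ders
proof (induction "is" arbitrary: js)
  case Nil
  then show ?case using subspace_0[OF lcs_subspace[OF S]] by simp
next
  case (Cons i "is")
  let ?q = "difference_quotient (A i) 0 1"
  have Ai: "A i 0 \<in> topspace T" "limitin T ?q (A (\<delta> i) 0) (at 0)" using Cons.prems by auto
  have "limitin T (A i) (A i 0) (at 0)" by (rule difference_quotient_limit_continuous[OF T Ai])
  then have js': "\<And>j. j \<in> set (js @ [i]) \<Longrightarrow> limitin T (A j) (A j 0) (at 0)"
    using Cons.prems(1) by auto
  have "limitin S
     (\<lambda>t. (1 / t) *\<^sub>R (iter_deriv S f (map (\<lambda>j. A j t) (js @ [i]) @ map (\<lambda>i. A i t) is) y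
                     - iter_deriv S f (map (\<lambda>j. A j t) (js @ [i]) @ map (\<lambda>i. A i 0) is) y))
     (\<Sum>ks\<leftarrow>replace_one \<delta> is. iter_deriv S f (map (\<lambda>j. A j 0) ((js @ [i]) @ ks)) y) (at 0)"
    by (rule Cons.IH[OF js']) (use Cons.prems in auto)
  then have rest: "limitin S
     (\<lambda>t. (1 / t) *\<^sub>R (iter_deriv S f (map (\<lambda>j. A j t) js @ A i t # map (\<lambda>i. A i t) is) y
                     - iter_deriv S f (map (\<lambda>j. A j t) js @ A i t # map (\<lambda>i. A i 0) is) y))
     (\<Sum>ks\<leftarrow>replace_one \<delta> is. iter_deriv S f (map (\<lambda>j. A j 0) (js @ i # ks)) y) (at 0)"
    by simp
  \<comment> \<open>Curves are paired with their limits at \<open>0\<close>, because the limit of the difference quotient is not its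
     value at \<open>0\<close>.\<close>
  let ?L = "map (\<lambda>j. (A j, A j 0)) js @ (?q, A (\<delta> i) 0) # map (\<lambda>i. (\<lambda>_. A i 0, A i 0)) is"
  have yT: "y \<in> topspace T" using y openin_subset[OF smooth_on_openin[OF f]] by blast
  have "limitin S (\<lambda>t. iter_deriv S f (map (\<lambda>p. fst p t) ?L) y) (iter_deriv S f (map snd ?L) y) (at 0)"
    by (rule smooth_on_limit[OF f _ y]) (use yT Cons.prems in auto)
  then have slot: "limitin S (\<lambda>t. iter_deriv S f (map (\<lambda>j. A j t) js @ ?q t # map (\<lambda>i. A i 0) is) y)
     (iter_deriv S f (map (\<lambda>j. A j 0) (js @ \<delta> i # is)) y) (at 0)"
    by (simp add: o_def)
  have ev: "eventually (\<lambda>t. \<forall>j\<in>set js. A j t \<in> topspace T) (at 0)"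
    using limitinD[OF Cons.prems(1) openin_topspace limitin_topspace[OF Cons.prems(1)]]
    by (simp add: eventually_ball_finite)
  have "eventually (\<lambda>t. t \<noteq> 0 \<and> ?q t \<in> topspace T) (at 0)"
    using limitinD[OF Ai(2) openin_topspace limitin_topspace[OF Ai(2)]]
    by (auto simp: eventually_conj_iff eventually_at_filter)
  with ev have "eventually (\<lambda>t. iter_deriv S f (map (\<lambda>j. A j t) js @ ?q t # map (\<lambda>i. A i 0) is) y
      = (1 / t) *\<^sub>R (iter_deriv S f (map (\<lambda>j. A j t) js @ A i t # map (\<lambda>i. A i 0) is) y
                     - iter_deriv S f (map (\<lambda>j. A j t) js @ A i 0 # map (\<lambda>i. A i 0) is) y)) (at 0)"
  proof eventually_elim
    case (elim t)
    have "A i t = A i 0 + t *\<^sub>R ?q t" using elim by (simp add: difference_quotient_def)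
    moreover have "iter_deriv S f (map (\<lambda>j. A j t) js @ (A i 0 + t *\<^sub>R ?q t) # map (\<lambda>i. A i 0) is) y
       = iter_deriv S f (map (\<lambda>j. A j t) js @ A i 0 # map (\<lambda>i. A i 0) is) y
         + t *\<^sub>R iter_deriv S f (map (\<lambda>j. A j t) js @ ?q t # map (\<lambda>i. A i 0) is) y"
      using elim Cons.prems by (intro iter_deriv_affine_slot[OF T S f]) (auto simp: y)
    ultimately show ?case using elim by simp
  qed
  from limitin_add[OF S limitin_transform_eventually[OF this slot] rest]
  show ?case by (simp add: scaleR_right_diff_distrib o_def)
qed

text \<open>
  The increment splits into one of the base point, with the slots already at time \<open>t\<close>, and one of the
  slots at the fixed base point. The former is where the mean value argument enters.
\<close>

lemma iter_deriv_along_curves: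
  fixes A :: "'i \<Rightarrow> real \<Rightarrow> 'e::real_vector"
  assumes T: "lcs T" and S: "lcs S" and f: "smooth_on T U S f"
    and c: "c 0 \<in> U" "limitin T (difference_quotient c 0 1) c' (at 0)"
    and ders: "\<And>i. i \<in> set is \<Longrightarrow> A i 0 \<in> topspace T"
      "\<And>i. i \<in> set is \<Longrightarrow> limitin T (difference_quotient (A i) 0 1) (A (\<delta> i) 0) (at 0)"
  shows "limitin S (difference_quotient (\<lambda>t. iter_deriv S f (map (\<lambda>i. A i t) is) (c t)) 0 1)
     (iter_deriv S f (c' # map (\<lambda>i. A i 0) is) (c 0)
       + (\<Sum>ks\<leftarrow>replace_one \<delta> is. iter_deriv S f (map (\<lambda>i. A i 0) ks) (c 0))) (at 0)"
proof -
  let ?F = "at (0::real) \<times>\<^sub>F principal {0..1::real}"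
  let ?q = "difference_quotient c 0 1"
  let ?h = "\<lambda>t. iter_deriv S f (map (\<lambda>i. A i t) is)"
  let ?p = "\<lambda>z. c 0 + (snd z * fst z) *\<^sub>R ?q (fst z)"
  have c0: "c 0 \<in> topspace T" using c(1) openin_subset[OF smooth_on_openin[OF f]] by blast
  have A: "limitin T (A i) (A i 0) (at 0)" if "i \<in> set is" for i
    by (rule difference_quotient_limit_continuous[OF T ders(1)[OF that] ders(2)[OF that]])
  have "limitin T ?p (c 0 + 0 *\<^sub>R c') ?F"
    by (intro limitin_add[OF T] limitin_scale[OF T] tendsto_segment_param limitin_fst_param c(2))
      (use c0 in simp)
  then have p: "limitin T ?p (c 0) ?F" by simp
  have A_ev: "eventually (\<lambda>t. \<forall>i\<in>set is. A i t \<in> topspace T) (at 0)"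
    using limitinD[OF A openin_topspace limitin_topspace[OF A]] by (simp add: eventually_ball_finite)
  moreover have "eventually (\<lambda>t. ?q t \<in> topspace T) (at 0)"
    using limitinD[OF c(2) openin_topspace limitin_topspace[OF c(2)]] .
  ultimately have "eventually (\<lambda>t. ?q t \<in> topspace T \<and> (\<forall>i\<in>set is. A i t \<in> topspace T)) (at 0)"
    by eventually_elim simp
  then have "eventually (\<lambda>z. (?q (fst z) \<in> topspace T \<and> (\<forall>i\<in>set is. A i (fst z) \<in> topspace T)) \<and> True) ?F"
    by (intro eventually_prodI) simp_all
  with limitinD[OF p smooth_on_openin[OF f] c(1)]
  have der: "eventually (\<lambda>z. limitin S (difference_quotient (?h (fst z)) (?p z) (?q (fst z)))
      (iter_deriv S f (?q (fst z) # map (\<lambda>i. A i (fst z)) is) (?p z)) (at 0)) ?F"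
    by eventually_elim (intro smooth_on_has_derivative[OF f lcs_Hausdorff[OF S]], auto)
  \<comment> \<open>As before, curves are paired with their limits.\<close>
  let ?L = "(?q, c') # map (\<lambda>i. (A i, A i 0)) is"
  have "limitin S (\<lambda>z. iter_deriv S f (map (\<lambda>a. fst a (fst z)) ?L) (?p z))
      (iter_deriv S f (map snd ?L) (c 0)) ?F"
    by (rule smooth_on_limit[OF f p c(1)]) (use c(2) A in \<open>auto intro!: limitin_fst_param\<close>)
  then have cont: "limitin S (\<lambda>z. iter_deriv S f (?q (fst z) # map (\<lambda>i. A i (fst z)) is) (?p z))
      (iter_deriv S f (c' # map (\<lambda>i. A i 0) is) (c 0)) ?F"
    by (simp add: o_def)
  have base: "limitin S (\<lambda>t. (1 / t) *\<^sub>R (?h t (c 0 + t *\<^sub>R ?q t) - ?h t (c 0)))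
      (iter_deriv S f (c' # map (\<lambda>i. A i 0) is) (c 0)) (at 0)"
    by (rule quotient_limit_from_derivative[OF S, where h = ?h and y = "\<lambda>t. c 0"
          and q = ?q and D = "\<lambda>t s. iter_deriv S f (?q t # map (\<lambda>i. A i t) is) (?p (t, s))"])
      (use der cont in \<open>simp_all only: case_prod_unfold fst_conv snd_conv\<close>)
  have slots: "limitin S (\<lambda>t. (1 / t) *\<^sub>R (?h t (c 0) - ?h 0 (c 0)))
     (\<Sum>ks\<leftarrow>replace_one \<delta> is. iter_deriv S f (map (\<lambda>i. A i 0) ks) (c 0)) (at 0)"
    using slots_derivative[OF T S f c(1), of "[]" A "is" \<delta>] ders by simp
  have "eventually (\<lambda>t. t \<noteq> (0::real)) (at 0)" by (simp add: eventually_at_filter)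
  \<comment> \<open>For \<open>t \<noteq> 0\<close> the point \<open>c 0 + t ?q t\<close> is \<open>c t\<close>.\<close>
  then have "eventually (\<lambda>t. (1 / t) *\<^sub>R (?h t (c 0 + t *\<^sub>R ?q t) - ?h t (c 0))
        + (1 / t) *\<^sub>R (?h t (c 0) - ?h 0 (c 0))
      = difference_quotient (\<lambda>t. iter_deriv S f (map (\<lambda>i. A i t) is) (c t)) 0 1 t) (at 0)"
    by eventually_elim (simp add: difference_quotient_def scaleR_right_diff_distrib)
  from limitin_transform_eventually[OF this limitin_add[OF S base slots]] show ?thesis .
qed

text \<open>
  The terms of the formula of Faa di Bruno: each \<open>bs\<close> is a list of blocks of directions that partitions
  \<open>vs\<close>. A further direction \<open>v\<close> either differentiates the outer function, which creates the block \<open>[v]\<close>, or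
  one of the inner derivatives, which puts \<open>v\<close> into an existing block.
\<close>

primrec chain_terms :: "'v list \<Rightarrow> 'v list list list" where
  "chain_terms [] = [[]]"
| "chain_terms (v # vs) =
     concat (map (\<lambda>bs. ([v] # bs) # replace_one ((#) v) bs) (chain_terms vs))"

lemma map_replace_one:
  assumes "\<And>i. k (\<delta> i) = \<delta>' (k i)"
  shows "map (map k) (replace_one \<delta> is) = replace_one \<delta>' (map k is)"
proof (induction "is")
  case (Cons i "is")
  have "map (map k) (replace_one \<delta> (i # is))
      = map k (\<delta> i # is) # map ((#) (k i)) (map (map k) (replace_one \<delta> is))"
    by simp
  then show ?case by (simp only: Cons.IH) (simp add: assms)
qed simp

text \<open>
  The shape of the terms does not depend on the directions. Hence for directions \<open>h 0, \<dots>, h (k - 1)\<close> that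
  vary continuously the sum runs over a fixed list, which gives continuity of the iterated derivative of a
  composition.
\<close>

lemma chain_terms_map: "chain_terms (map h vs) = map (map (map h)) (chain_terms vs)"
proof (induction vs)
  case (Cons v vs)
  have "replace_one ((#) (h v)) (map (map h) bs) = map (map (map h)) (replace_one ((#) v) bs)" for bs
    by (rule map_replace_one[symmetric]) simp
  then show ?case by (simp add: Cons map_concat o_def)
qed simp

lemma set_replace_one:
  assumes "ks \<in> set (replace_one \<delta> is)" "k \<in> set ks"
  shows "k \<in> set is \<union> \<delta> ` set is"
  using assms by (induction "is" arbitrary: ks) auto

lemma set_chain_terms:
  assumes "bs \<in> set (chain_terms vs)" "b \<in> set bs"
  shows "set b \<subseteq> set vs"
  using assms
proof (induction vs arbitrary: bs b)
  case (Cons v vs)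
  then obtain cs where cs: "cs \<in> set (chain_terms vs)"
    and bs: "bs = [v] # cs \<or> bs \<in> set (replace_one ((#) v) cs)" by auto
  have IH: "c \<in> set cs \<Longrightarrow> set c \<subseteq> set vs" for c using Cons.IH[OF cs] .
  have "b = [v] \<or> b \<in> set cs \<union> (#) v ` set cs"
    using bs Cons.prems(2) set_replace_one[of bs "(#) v" cs b] by auto
  then show ?case using IH by fastforce
qed simp

lemma sum_list_concat_map: "(\<Sum>x\<leftarrow>concat (map \<psi> xs). \<phi> x) = (\<Sum>x\<leftarrow>xs. \<Sum>y\<leftarrow>\<psi> x. \<phi> y)"
  for \<phi> :: "'b \<Rightarrow> 'c::monoid_add"
  by (induction xs) auto

lemma difference_quotient_sum_list:
  "difference_quotient (\<lambda>z. \<Sum>i\<leftarrow>xs. f i z) x v t = (\<Sum>i\<leftarrow>xs. difference_quotient (f i) x v t)"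
  by (induction xs) (simp_all add: difference_quotient_def algebra_simps)

definition chain_term :: "'f::real_vector topology \<Rightarrow> 'g::real_vector topology
    \<Rightarrow> ('f \<Rightarrow> 'g) \<Rightarrow> ('e::real_vector \<Rightarrow> 'f) \<Rightarrow> 'e list list \<Rightarrow> 'e \<Rightarrow> 'g" where
  "chain_term S R g f bs x = iter_deriv R g (map (\<lambda>b. iter_deriv S f b x) bs) (f x)"

text \<open>
  The line through \<open>x\<close> in direction \<open>v\<close> is mapped by the iterated derivatives of \<open>f\<close> to curves, indexed by
  blocks \<open>b\<close>; the velocity of the curve of \<open>b\<close> is the value of the curve of \<open>v # b\<close>, so that
  \<open>\<delta> = (#) v\<close>.
\<close>

lemma chain_term_derivative:
  assumes lcs: "lcs T" "lcs S" "lcs R"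
    and f: "smooth_on T U S f" and g: "smooth_on S V R g" and fU: "f ` U \<subseteq> V"
    and x: "x \<in> U" and v: "v \<in> topspace T" and bs: "\<And>b. b \<in> set bs \<Longrightarrow> set b \<subseteq> topspace T"
  shows "limitin R (difference_quotient (chain_term S R g f bs) x v)
     (\<Sum>cs\<leftarrow>([v] # bs) # replace_one ((#) v) bs. chain_term S R g f cs x) (at 0)"
proof -
  let ?A = "\<lambda>b t. iter_deriv S f b (x + t *\<^sub>R v)"
  have quot: "difference_quotient (\<lambda>t. h (x + t *\<^sub>R v)) 0 1 = difference_quotient h x v"
    for h :: "'a \<Rightarrow> 'z::real_vector"
    by (simp add: fun_eq_iff difference_quotient_def)
  have A: "limitin S (difference_quotient (?A b) 0 1) (?A (v # b) 0) (at 0)" if "set b \<subseteq> topspace T" for b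
    using smooth_on_has_derivative[OF f lcs_Hausdorff[OF lcs(2)] that v x] by (simp add: quot)
  have "limitin R (difference_quotient (\<lambda>t. iter_deriv R g (map (\<lambda>b. ?A b t) bs) (f (x + t *\<^sub>R v))) 0 1)
     (iter_deriv R g (?A [v] 0 # map (\<lambda>b. ?A b 0) bs) (f (x + 0 *\<^sub>R v))
       + (\<Sum>cs\<leftarrow>replace_one ((#) v) bs. iter_deriv R g (map (\<lambda>b. ?A b 0) cs) (f (x + 0 *\<^sub>R v)))) (at 0)"
  proof (rule iter_deriv_along_curves[OF lcs(2,3) g])
    show "f (x + 0 *\<^sub>R v) \<in> V" using fU x by auto
    show "limitin S (difference_quotient (\<lambda>t. f (x + t *\<^sub>R v)) 0 1) (?A [v] 0) (at 0)"
      using A[of "[]"] by simp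
    show "?A b 0 \<in> topspace S" if "b \<in> set bs" for b
      using smooth_on_iter_deriv_closed[OF f x bs[OF that]] by simp
    show "limitin S (difference_quotient (?A b) 0 1) (?A (v # b) 0) (at 0)" if "b \<in> set bs" for b
      by (rule A[OF bs[OF that]])
  qed
  then show ?thesis
    by (simp add: chain_term_def quot[of "\<lambda>z. iter_deriv R g (map (\<lambda>b. iter_deriv S f b z) bs) (f z)"]
        cong: map_cong) (simp add: chain_term_def[abs_def])
qed

lemma iter_deriv_compose_derivative:
  assumes lcs: "lcs T" "lcs S" "lcs R"
    and f: "smooth_on T U S f" and g: "smooth_on S V R g" and fU: "f ` U \<subseteq> V"
    and x: "x \<in> U" and v: "v \<in> topspace T" and vs: "set vs \<subseteq> topspace T"
  shows "limitin R (difference_quotient (\<lambda>z. \<Sum>bs\<leftarrow>chain_terms vs. chain_term S R g f bs z) x v)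
     (\<Sum>bs\<leftarrow>chain_terms (v # vs). chain_term S R g f bs x) (at 0)"
proof -
  have "limitin R (\<lambda>t. \<Sum>bs\<leftarrow>chain_terms vs. difference_quotient (chain_term S R g f bs) x v t)
      (\<Sum>bs\<leftarrow>chain_terms vs. \<Sum>cs\<leftarrow>([v] # bs) # replace_one ((#) v) bs. chain_term S R g f cs x) (at 0)"
    by (intro limitin_sum_list[OF lcs(3)] chain_term_derivative[OF lcs f g fU x v])
      (use set_chain_terms vs in blast)
  then show ?thesis
    by (simp only: difference_quotient_sum_list[abs_def] chain_terms.simps sum_list_concat_map)
qed

lemma iter_deriv_compose:
  assumes lcs: "lcs T" "lcs S" "lcs R"
    and f: "smooth_on T U S f" and g: "smooth_on S V R g" and fU: "f ` U \<subseteq> V"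
    and vs: "set vs \<subseteq> topspace T" and x: "x \<in> U"
  shows "iter_deriv R (g \<circ> f) vs x = (\<Sum>bs\<leftarrow>chain_terms vs. chain_term S R g f bs x)"
  using vs x
proof (induction vs arbitrary: x)
  case Nil
  show ?case by (simp add: chain_term_def)
next
  case (Cons v vs)
  have "iter_deriv R (g \<circ> f) (v # vs) x = dir_deriv R (iter_deriv R (g \<circ> f) vs) x v" by simp
  also have "\<dots> = dir_deriv R (\<lambda>z. \<Sum>bs\<leftarrow>chain_terms vs. chain_term S R g f bs z) x v"
    by (rule dir_deriv_cong_open[OF lcs_lines_continuous[OF lcs(1)] smooth_on_openin[OF f]])
      (use Cons in \<open>simp_all del: o_apply\<close>)
  also have "\<dots> = (\<Sum>bs\<leftarrow>chain_terms (v # vs). chain_term S R g f bs x)"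
    by (rule dir_deriv_eqI[OF lcs_Hausdorff[OF lcs(3)] iter_deriv_compose_derivative[OF lcs f g fU]])
      (use Cons.prems in auto)
  finally show ?case .
qed

text \<open>
  Differentiability and joint continuity are both read off from the formula of Faa di Bruno.
\<close>

theorem smooth_on_compose:
  assumes lcs: "lcs T" "lcs S" "lcs R"
    and f: "smooth_on T U S f" and g: "smooth_on S V R g" and fU: "f ` U \<subseteq> V"
  shows "smooth_on T U R (g \<circ> f)"
  unfolding smooth_on_def
proof (intro conjI allI impI)
  show "openin T U" by (rule smooth_on_openin[OF f])
  show "(g \<circ> f) ` U \<subseteq> topspace R" using fU smooth_on_image[OF g] by auto
next
  fix vs v x assume *: "set vs \<subseteq> topspace T \<and> v \<in> topspace T \<and> x \<in> U"
  have "limitin R (difference_quotient (iter_deriv R (g \<circ> f) vs) x v) l (at 0)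
      \<longleftrightarrow> limitin R (difference_quotient (\<lambda>z. \<Sum>bs\<leftarrow>chain_terms vs. chain_term S R g f bs z) x v) l (at 0)"
    for l
    by (rule difference_quotient_limit_cong[OF lcs_lines_continuous[OF lcs(1)] smooth_on_openin[OF f]])
      (use * iter_deriv_compose[OF lcs f g fU] in auto)
  then show "\<exists>l. limitin R (difference_quotient (iter_deriv R (g \<circ> f) vs) x v) l (at 0)"
    using iter_deriv_compose_derivative[OF lcs f g fU] * by blast
next
  fix k :: nat
  let ?Z = "prod_topology (subtopology T U) (product_topology (\<lambda>_. T) {..<k})"
  have U: "U \<subseteq> topspace T" using openin_subset[OF smooth_on_openin[OF f]] .
  have fst: "continuous_map ?Z (subtopology T U) fst" by (rule continuous_map_fst)
  have proj: "continuous_map ?Z T (\<lambda>z. snd z i)" if "i < k" for i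
    using continuous_map_compose[OF continuous_map_snd continuous_map_product_projection[of i "{..<k}"]] that
    by (simp add: o_def)
  have inner: "continuous_map ?Z S (\<lambda>z. iter_deriv S f (map (snd z) b) (fst z))" if "set b \<subseteq> {..<k}" for b
    by (rule smooth_on_continuous_map[OF f fst, where A = "\<lambda>i z. snd z i" and ls = b])
      (use proj that in auto)
  have fz: "continuous_map ?Z (subtopology S V) (\<lambda>z. f (fst z))"
    using inner[of "[]"] fU by (auto simp: continuous_map_in_subtopology)
  have "continuous_map ?Z R (\<lambda>z. \<Sum>bs\<leftarrow>chain_terms [0..<k].
      iter_deriv R g (map (\<lambda>b. iter_deriv S f (map (snd z) b) (fst z)) bs) (f (fst z)))"
  proof (rule continuous_map_sum_list[OF lcs(3)])
    fix bs assume bs: "bs \<in> set (chain_terms [0..<k])"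
    show "continuous_map ?Z R
        (\<lambda>z. iter_deriv R g (map (\<lambda>b. iter_deriv S f (map (snd z) b) (fst z)) bs) (f (fst z)))"
      by (rule smooth_on_continuous_map[OF g fz, where
            A = "\<lambda>b z. iter_deriv S f (map (snd z) b) (fst z)" and ls = bs])
        (use inner set_chain_terms[OF bs] in force)
  qed
  moreover have "(\<Sum>bs\<leftarrow>chain_terms [0..<k].
      iter_deriv R g (map (\<lambda>b. iter_deriv S f (map (snd z) b) (fst z)) bs) (f (fst z)))
    = (\<lambda>(x, h). iter_deriv R (g \<circ> f) (map h [0..<k]) x) z" if "z \<in> topspace ?Z" for z
  proof -
    obtain x h where z: "z = (x, h)" by (cases z)
    have "x \<in> U" "set (map h [0..<k]) \<subseteq> topspace T"
      using that U by (auto simp: z PiE_iff)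
    then show ?thesis
      using iter_deriv_compose[OF lcs f g fU, of "map h [0..<k]" x]
      by (simp add: z chain_terms_map chain_term_def o_def)
  qed
  ultimately show "continuous_map ?Z R (\<lambda>(x, h). iter_deriv R (g \<circ> f) (map h [0..<k]) x)"
    by (rule continuous_map_eq)
qed

section \<open>Smoothness is a local property\<close>

lemma continuous_map_local:
  assumes "\<And>x. x \<in> topspace X \<Longrightarrow> \<exists>W g. openin X W \<and> x \<in> W \<and> continuous_map (subtopology X W) Y g \<and> (\<forall>z\<in>W. f z = g z)"
  shows "continuous_map X Y f"
proof (rule pasting_lemma[where T = "\<lambda>W. W" and f = "\<lambda>_. f"])
  let ?I = "{W. openin X W \<and> continuous_map (subtopology X W) Y f}"
  show "openin X W" "continuous_map (subtopology X W) Y f" if "W \<in> ?I" for W using that by auto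
  show "\<exists>W. W \<in> ?I \<and> x \<in> W \<and> f x = f x" if x: "x \<in> topspace X" for x
  proof -
    obtain W g where W: "openin X W" "x \<in> W" "continuous_map (subtopology X W) Y g" "\<forall>z\<in>W. f z = g z"
      using assms[OF x] by blast
    have "continuous_map (subtopology X W) Y f" by (rule continuous_map_eq[OF W(3)]) (use W(4) in auto)
    with W show ?thesis by blast
  qed
qed simp_all

lemma smooth_on_differentiable:
  assumes "smooth_on T U S f" "set vs \<subseteq> topspace T" "v \<in> topspace T" "x \<in> U"
  shows "\<exists>l. limitin S (difference_quotient (iter_deriv S f vs) x v) l (at 0)"
  using assms(1)[unfolded smooth_on_def] assms(2-4) by simp

lemma smooth_on_continuous_deriv:
  assumes "smooth_on T U S f"
  shows "continuous_map (prod_topology (subtopology T U) (product_topology (\<lambda>_. T) {..<k})) S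
     (\<lambda>(x, h). iter_deriv S f (map h [0..<k]) x)"
  using assms unfolding smooth_on_def by simp

lemma smooth_on_subset:
  assumes "smooth_on T U S f" "openin T U'" "U' \<subseteq> U"
  shows "smooth_on T U' S f"
  unfolding smooth_on_def
proof (intro conjI allI impI)
  fix k :: nat
  let ?P = "product_topology (\<lambda>_::nat. T) {..<k}"
  let ?d = "\<lambda>(x, h). iter_deriv S f (map h [0..<k]) x"
  have "prod_topology (subtopology T U') ?P
      = subtopology (prod_topology (subtopology T U) ?P) (U' \<times> topspace ?P)"
    using assms(3) by (simp add: subtopology_Times subtopology_subtopology inf.absorb2 del: topspace_product_topology)
  moreover have "continuous_map (prod_topology (subtopology T U) ?P) S ?d"
    using assms(1) unfolding smooth_on_def by blast
  ultimately show "continuous_map (prod_topology (subtopology T U') ?P) S ?d"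
    using continuous_map_from_subtopology by metis
qed (use assms in \<open>auto simp: smooth_on_def\<close>)

lemma smooth_on_local:
  assumes T: "lines_continuous T"
    and local: "\<And>p. p \<in> U \<Longrightarrow> \<exists>U' g. p \<in> U' \<and> U' \<subseteq> U \<and> smooth_on T U' S g \<and> (\<forall>y\<in>U'. f y = g y)"
  shows "smooth_on T U S f"
proof -
  have deriv: "iter_deriv S f vs x = iter_deriv S g vs x"
    if "smooth_on T U' S g" "\<forall>y\<in>U'. f y = g y" "set vs \<subseteq> topspace T" "x \<in> U'" for U' g vs x
    using iter_deriv_cong_open[OF T smooth_on_openin[OF that(1)]] that by blast
  show ?thesis unfolding smooth_on_def
  proof (intro conjI allI impI)
    show "openin T U"
    proof (subst openin_subopen, intro ballI)
      fix p assume "p \<in> U"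
      then obtain U' g where g: "p \<in> U'" "U' \<subseteq> U" "smooth_on T U' S g" using local by meson
      show "\<exists>W. openin T W \<and> p \<in> W \<and> W \<subseteq> U"
        using smooth_on_openin[OF g(3)] g(1,2) by (intro exI conjI)
    qed
    show "f ` U \<subseteq> topspace S"
    proof clarify
      fix p assume "p \<in> U"
      then obtain U' g where g: "p \<in> U'" "smooth_on T U' S g" "\<forall>y\<in>U'. f y = g y"
        using local by meson
      then show "f p \<in> topspace S" using smooth_on_image by fastforce
    qed
  next
    fix vs v x assume *: "set vs \<subseteq> topspace T \<and> v \<in> topspace T \<and> x \<in> U"
    then obtain U' g where g: "x \<in> U'" "smooth_on T U' S g" "\<forall>y\<in>U'. f y = g y"
      using local by meson
    have "limitin S (difference_quotient (iter_deriv S f vs) x v) l (at 0)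
      \<longleftrightarrow> limitin S (difference_quotient (iter_deriv S g vs) x v) l (at 0)" for l
      by (rule difference_quotient_limit_cong[OF T smooth_on_openin[OF g(2)] g(1)])
        (use * deriv[OF g(2,3)] in auto)
    moreover have "\<exists>l. limitin S (difference_quotient (iter_deriv S g vs) x v) l (at 0)"
      by (rule smooth_on_differentiable[OF g(2)]) (use g(1) * in auto)
    ultimately show "\<exists>l. limitin S (difference_quotient (iter_deriv S f vs) x v) l (at 0)"
      by simp
  next
    fix k :: nat
    let ?P = "product_topology (\<lambda>_::nat. T) {..<k}"
    let ?Z = "prod_topology (subtopology T U) ?P"
    show "continuous_map ?Z S (\<lambda>(x, h). iter_deriv S f (map h [0..<k]) x)"
    proof (rule continuous_map_local)
      fix z assume z: "z \<in> topspace ?Z"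
      then have "fst z \<in> U" by (simp add: mem_Times_iff)
      then obtain U' g where g: "fst z \<in> U'" "U' \<subseteq> U" "smooth_on T U' S g" "\<forall>y\<in>U'. f y = g y"
        using local by meson
      let ?d = "\<lambda>(x, h). iter_deriv S g (map h [0..<k]) x"
      have "openin (subtopology T U) U'"
        using smooth_on_openin[OF g(3)] g(2) by (metis inf.absorb1 openin_subtopology)
      then have "openin ?Z (U' \<times> topspace ?P)"
        by (simp add: openin_prod_Times_iff del: topspace_product_topology)
      moreover have "z \<in> U' \<times> topspace ?P" using z g(1) by (simp add: mem_Times_iff)
      moreover have "subtopology ?Z (U' \<times> topspace ?P) = prod_topology (subtopology T U') ?P"
        using g(2) by (simp add: subtopology_Times subtopology_subtopology inf.absorb2 del: topspace_product_topology)
      moreover have "continuous_map (prod_topology (subtopology T U') ?P) S ?d"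
        by (rule smooth_on_continuous_deriv[OF g(3)])
      moreover have "\<forall>w\<in>U' \<times> topspace ?P. (\<lambda>(x, h). iter_deriv S f (map h [0..<k]) x) w = ?d w"
      proof (rule ballI)
        fix w assume "w \<in> U' \<times> topspace ?P"
        then have "set (map (snd w) [0..<k]) \<subseteq> topspace T" "fst w \<in> U'"
          by (auto simp: mem_Times_iff PiE_iff)
        from deriv[OF g(3,4) this]
        show "(\<lambda>(x, h). iter_deriv S f (map h [0..<k]) x) w = ?d w" by (simp add: case_prod_beta)
      qed
      ultimately show "\<exists>W d. openin ?Z W \<and> z \<in> W \<and> continuous_map (subtopology ?Z W) S d
          \<and> (\<forall>w\<in>W. (\<lambda>(x, h). iter_deriv S f (map h [0..<k]) x) w = d w)"
        by (intro exI[of _ "U' \<times> topspace ?P"] exI[of _ ?d]) (simp only: simp_thms)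
    qed
  qed
qed

section \<open>Smooth maps between manifolds\<close>

text \<open>
  The features of a chart on which locality of smoothness rests. This is weaker than \<^const>\<open>is_chart\<close>, so that it is
  inherited by products with \<^const>\<open>power_top\<close>.
\<close>

definition topological_chart :: "'m topology \<Rightarrow> ('m, 'e::real_vector) chart \<Rightarrow> bool" where
  "topological_chart X \<phi> \<longleftrightarrow>
     openin X (cdom \<phi>) \<and> inj_on (cmap \<phi>) (cdom \<phi>) \<and> lines_continuous (cmodel \<phi>) \<and>
     (\<forall>W. openin X W \<and> W \<subseteq> cdom \<phi> \<longrightarrow> openin (cmodel \<phi>) (cmap \<phi> ` W))"

lemma topological_chartD:
  assumes "topological_chart X \<phi>"
  shows chart_openin: "openin X (cdom \<phi>)"
    and chart_inj: "inj_on (cmap \<phi>) (cdom \<phi>)"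
    and chart_lines: "lines_continuous (cmodel \<phi>)"
    and chart_open_image: "openin X W \<Longrightarrow> W \<subseteq> cdom \<phi> \<Longrightarrow> openin (cmodel \<phi>) (cmap \<phi> ` W)"
  using assms unfolding topological_chart_def by blast+

lemma cinv_cmap: "inj_on (cmap \<phi>) (cdom \<phi>) \<Longrightarrow> x \<in> cdom \<phi> \<Longrightarrow> cinv \<phi> (cmap \<phi> x) = x"
  by (simp add: cinv_def)

lemma is_chart_topological:
  assumes "is_chart X \<phi>"
  shows "topological_chart X \<phi>"
proof -
  have op: "openin X (cdom \<phi>)" and im: "openin (cmodel \<phi>) (cmap \<phi> ` cdom \<phi>)"
    and hom: "homeomorphic_map (subtopology X (cdom \<phi>))
       (subtopology (cmodel \<phi>) (cmap \<phi> ` cdom \<phi>)) (cmap \<phi>)"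
    and lcs: "lcs (cmodel \<phi>)"
    using assms unfolding is_chart_def by auto
  have sub: "cdom \<phi> \<subseteq> topspace X" using op openin_subset by blast
  have inj: "inj_on (cmap \<phi>) (cdom \<phi>)"
    using homeomorphic_imp_injective_map[OF hom] sub by (simp add: inf.absorb2)
  have "openin (cmodel \<phi>) (cmap \<phi> ` W)" if W: "openin X W" "W \<subseteq> cdom \<phi>" for W
  proof -
    have "openin (subtopology X (cdom \<phi>)) W"
      using W by (metis inf.absorb1 openin_subtopology)
    then have "openin (subtopology (cmodel \<phi>) (cmap \<phi> ` cdom \<phi>)) (cmap \<phi> ` W)"
      using homeomorphic_imp_open_map[OF hom] unfolding open_map_def by blast
    then show ?thesis using openin_trans_full im by blast
  qed
  then show ?thesis
    using op inj lcs_lines_continuous[OF lcs] unfolding topological_chart_def by blast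
qed

definition charted :: "('m, 'e::real_vector) manifold \<Rightarrow> bool" where
  "charted M \<longleftrightarrow> (\<forall>\<phi>\<in>atlas M. topological_chart (mtop M) \<phi>)"

lemma chartedD: "charted M \<Longrightarrow> \<phi> \<in> atlas M \<Longrightarrow> topological_chart (mtop M) \<phi>"
  by (simp add: charted_def)

lemma is_manifold_charted: "is_manifold M \<Longrightarrow> charted M"
  by (auto simp: is_manifold_def charted_def is_chart_topological)

lemma charted_open_submanifold:
  assumes "charted M" "openin (mtop M) U"
  shows "charted (open_submanifold M U)"
proof -
  have "topological_chart (subtopology (mtop M) U) (\<phi>\<lparr>cdom := cdom \<phi> \<inter> U\<rparr>)" if "\<phi> \<in> atlas M" for \<phi>
    using chartedD[OF assms(1) that] assms(2) unfolding topological_chart_def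
    by (auto simp: openin_open_subtopology inj_on_def)
  then show ?thesis by (auto simp: charted_def open_submanifold_def)
qed

lemma charted_prod_lcs:
  assumes M: "charted M" and P: "lines_continuous P"
  shows "charted (prod_manifold M (lcs_manifold P))"
proof -
  let ?c = "\<lambda>\<phi>. \<lparr>cdom = cdom \<phi> \<times> topspace P, cmap = map_prod (cmap \<phi>) (\<lambda>v. v),
                cmodel = prod_topology (cmodel \<phi>) P\<rparr>"
  have "topological_chart (prod_topology (mtop M) P) (?c \<phi>)" if \<phi>: "\<phi> \<in> atlas M" for \<phi>
  proof -
    note ch = chartedD[OF M \<phi>]
    have "openin (prod_topology (cmodel \<phi>) P) (map_prod (cmap \<phi>) (\<lambda>v. v) ` W)"
      if W: "openin (prod_topology (mtop M) P) W" "W \<subseteq> cdom \<phi> \<times> topspace P" for W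
      unfolding openin_prod_topology_alt
    proof (intro allI impI)
      fix e v assume "(e, v) \<in> map_prod (cmap \<phi>) (\<lambda>v. v) ` W"
      then obtain x where x: "(x, v) \<in> W" "e = cmap \<phi> x" by auto
      then obtain A B where AB: "openin (mtop M) A" "openin P B" "x \<in> A" "v \<in> B" "A \<times> B \<subseteq> W"
        using W(1) unfolding openin_prod_topology_alt by meson
      then have "A \<subseteq> cdom \<phi>" using W(2) by blast
      with AB(1) have "openin (cmodel \<phi>) (cmap \<phi> ` A)" by (rule chart_open_image[OF ch])
      moreover have "cmap \<phi> ` A \<times> B \<subseteq> map_prod (cmap \<phi>) (\<lambda>v. v) ` W" using AB(5) by force
      ultimately show "\<exists>E B. openin (cmodel \<phi>) E \<and> openin P B \<and> e \<in> E \<and> v \<in> B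
          \<and> E \<times> B \<subseteq> map_prod (cmap \<phi>) (\<lambda>v. v) ` W"
        using AB x(2) by blast
    qed
    moreover have "lines_continuous (prod_topology (cmodel \<phi>) P)"
      using chart_lines[OF ch] P unfolding lines_continuous_def
      by (auto simp: limitin_pairwise o_def)
    ultimately show ?thesis
      using chart_openin[OF ch] chart_inj[OF ch] unfolding topological_chart_def
      by (auto simp: openin_prod_Times_iff inj_on_def)
  qed
  then show ?thesis
    by (auto simp: charted_def prod_manifold_def lcs_manifold_def id_chart_def)
qed

lemma openin_chart_preimage:
  assumes "continuous_map (mtop M) (mtop N) f" "\<phi> \<in> atlas M" "\<psi> \<in> atlas N"
    and "charted M" "openin (mtop N) (cdom \<psi>)"
  shows "openin (mtop M) {x \<in> cdom \<phi>. f x \<in> cdom \<psi>}"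
proof -
  note op = chart_openin[OF chartedD[OF assms(4,2)]]
  have "{x \<in> cdom \<phi>. f x \<in> cdom \<psi>} = cdom \<phi> \<inter> {x \<in> points M. f x \<in> cdom \<psi>}"
    using openin_subset[OF op] by blast
  then show ?thesis
    using op openin_continuous_map_preimage[OF assms(1,5)] by auto
qed

lemma smooth_map_open_submanifold:
  assumes M: "charted M" and N: "charted N" and f: "smooth_map M N f" and U: "openin (mtop M) U"
  shows "smooth_map (open_submanifold M U) N f"
  unfolding smooth_map_def
proof (intro conjI ballI)
  have cont: "continuous_map (mtop M) (mtop N) f" using f by (simp add: smooth_map_def)
  then show "continuous_map (mtop (open_submanifold M U)) (mtop N) f"
    by (simp add: open_submanifold_def continuous_map_from_subtopology)
  fix \<phi>' \<psi> assume \<phi>': "\<phi>' \<in> atlas (open_submanifold M U)" and \<psi>: "\<psi> \<in> atlas N"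
  then obtain \<phi> where \<phi>: "\<phi> \<in> atlas M" "\<phi>' = \<phi>\<lparr>cdom := cdom \<phi> \<inter> U\<rparr>"
    by (auto simp: open_submanifold_def)
  note ch = chartedD[OF M \<phi>(1)]
  let ?W = "{x \<in> cdom \<phi>. f x \<in> cdom \<psi>}" and ?W' = "{x \<in> cdom \<phi> \<inter> U. f x \<in> cdom \<psi>}"
  have "openin (mtop M) (?W \<inter> U)"
    using openin_chart_preimage[OF cont \<phi>(1) \<psi> M chart_openin[OF chartedD[OF N \<psi>]]] U by blast
  moreover have "?W \<inter> U = ?W'" by blast
  ultimately have op: "openin (cmodel \<phi>) (cmap \<phi> ` ?W')"
    using chart_open_image[OF ch] by auto
  have "smooth_on (cmodel \<phi>) (cmap \<phi> ` ?W) (cmodel \<psi>) (cmap \<psi> \<circ> f \<circ> cinv \<phi>)"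
    using f \<phi>(1) \<psi> unfolding smooth_map_def by blast
  then have sm: "smooth_on (cmodel \<phi>) (cmap \<phi> ` ?W') (cmodel \<psi>) (cmap \<psi> \<circ> f \<circ> cinv \<phi>)"
    by (rule smooth_on_subset[OF _ op]) auto
  have "inj_on (cmap \<phi>') (cdom \<phi>')"
    using chart_inj[OF ch] by (auto simp: \<phi>(2) inj_on_def)
  then have "cinv \<phi>' (cmap \<phi> x) = cinv \<phi> (cmap \<phi> x)" if "x \<in> ?W'" for x
    using cinv_cmap[of \<phi>' x] cinv_cmap[OF chart_inj[OF ch], of x] that by (simp add: \<phi>(2))
  then have "smooth_on (cmodel \<phi>) (cmap \<phi> ` ?W') (cmodel \<psi>) (cmap \<psi> \<circ> f \<circ> cinv \<phi>')"
    by (intro smooth_on_local[OF chart_lines[OF ch]] exI[of _ "cmap \<phi> ` ?W'"]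
        exI[of _ "cmap \<psi> \<circ> f \<circ> cinv \<phi>"]) (use sm in auto)
  then show "smooth_on (cmodel \<phi>') (cmap \<phi>' ` {x \<in> cdom \<phi>'. f x \<in> cdom \<psi>}) (cmodel \<psi>)
      (cmap \<psi> \<circ> f \<circ> cinv \<phi>')"
    by (simp add: \<phi>(2))
qed

lemma smooth_map_local:
  assumes M: "charted M"
    and local: "\<And>p. p \<in> points M \<Longrightarrow> \<exists>W g. openin (mtop M) W \<and> p \<in> W \<and>
        smooth_map (open_submanifold M W) N g \<and> (\<forall>x\<in>W. f x = g x)"
  shows "smooth_map M N f"
  unfolding smooth_map_def
proof (intro conjI ballI)
  show "continuous_map (mtop M) (mtop N) f"
  proof (rule continuous_map_local)
    show "\<exists>W g. openin (mtop M) W \<and> p \<in> W \<and> continuous_map (subtopology (mtop M) W) (mtop N) g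
        \<and> (\<forall>z\<in>W. f z = g z)" if "p \<in> points M" for p
      using local[OF that] by (auto simp: smooth_map_def open_submanifold_def)
  qed
  fix \<phi> \<psi> assume \<phi>: "\<phi> \<in> atlas M" and \<psi>: "\<psi> \<in> atlas N"
  note ch = chartedD[OF M \<phi>]
  let ?U = "{x \<in> cdom \<phi>. f x \<in> cdom \<psi>}"
  show "smooth_on (cmodel \<phi>) (cmap \<phi> ` ?U) (cmodel \<psi>) (cmap \<psi> \<circ> f \<circ> cinv \<phi>)"
  proof (rule smooth_on_local[OF chart_lines[OF ch]])
    fix e assume "e \<in> cmap \<phi> ` ?U"
    then obtain x where x: "x \<in> cdom \<phi>" "f x \<in> cdom \<psi>" "e = cmap \<phi> x" by auto
    then have "x \<in> points M" using openin_subset[OF chart_openin[OF ch]] by blast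
    then obtain W g where W: "x \<in> W" "smooth_map (open_submanifold M W) N g" "\<forall>x\<in>W. f x = g x"
      using local by meson
    let ?\<phi> = "\<phi>\<lparr>cdom := cdom \<phi> \<inter> W\<rparr>" and ?W = "{x \<in> cdom \<phi> \<inter> W. g x \<in> cdom \<psi>}"
    have "?\<phi> \<in> atlas (open_submanifold M W)" using \<phi> by (simp add: open_submanifold_def)
    then have "smooth_on (cmodel ?\<phi>) (cmap ?\<phi> ` {x \<in> cdom ?\<phi>. g x \<in> cdom \<psi>}) (cmodel \<psi>)
        (cmap \<psi> \<circ> g \<circ> cinv ?\<phi>)"
      using W(2) \<psi> unfolding smooth_map_def by blast
    then have "smooth_on (cmodel \<phi>) (cmap \<phi> ` ?W) (cmodel \<psi>) (cmap \<psi> \<circ> g \<circ> cinv ?\<phi>)" by simp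
    moreover have "inj_on (cmap ?\<phi>) (cdom ?\<phi>)"
      using chart_inj[OF ch] by (auto simp: inj_on_def)
    then have "cinv ?\<phi> (cmap \<phi> z) = z" "cinv \<phi> (cmap \<phi> z) = z" if "z \<in> ?W" for z
      using cinv_cmap[of ?\<phi> z] cinv_cmap[OF chart_inj[OF ch], of z] that by simp_all
    then have "\<forall>y\<in>cmap \<phi> ` ?W. (cmap \<psi> \<circ> f \<circ> cinv \<phi>) y = (cmap \<psi> \<circ> g \<circ> cinv ?\<phi>) y"
      using W(3) by auto
    moreover have "e \<in> cmap \<phi> ` ?W" "cmap \<phi> ` ?W \<subseteq> cmap \<phi> ` ?U" using x W(1,3) by auto
    ultimately show "\<exists>U' h. e \<in> U' \<and> U' \<subseteq> cmap \<phi> ` ?U \<and> smooth_on (cmodel \<phi>) U' (cmodel \<psi>) h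
        \<and> (\<forall>y\<in>U'. (cmap \<psi> \<circ> f \<circ> cinv \<phi>) y = h y)"
      by (intro exI conjI)
  qed
qed

lemma is_manifold_lcs: "is_manifold M \<Longrightarrow> \<phi> \<in> atlas M \<Longrightarrow> lcs (cmodel \<phi>)"
  by (auto simp: is_manifold_def is_chart_def)

text \<open>
  Near a given point the composition in charts factors through a chart of the middle manifold; locality
  glues the resulting compositions. The composite \<open>h\<close> is only described on the points of \<open>M\<close>, because
  arrows are extensional.
\<close>

lemma smooth_map_compose:
  assumes M: "is_manifold M" and N: "is_manifold N" and P: "is_manifold P"
    and f: "smooth_map M N f" and g: "smooth_map N P g"
    and h: "\<And>x. x \<in> points M \<Longrightarrow> h x = g (f x)"
  shows "smooth_map M P h"
  unfolding smooth_map_def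
proof (intro conjI ballI)
  have cf: "continuous_map (mtop M) (mtop N) f" and cg: "continuous_map (mtop N) (mtop P) g"
    using f g by (simp_all add: smooth_map_def)
  show ch: "continuous_map (mtop M) (mtop P) h"
    by (rule continuous_map_eq[OF continuous_map_compose[OF cf cg]]) (simp add: h)
  fix \<phi> \<kappa> assume \<phi>: "\<phi> \<in> atlas M" and \<kappa>: "\<kappa> \<in> atlas P"
  note cM = is_manifold_charted[OF M] and cN = is_manifold_charted[OF N] and cP = is_manifold_charted[OF P]
  note ch\<phi> = chartedD[OF cM \<phi>]
  have dom\<phi>: "cdom \<phi> \<subseteq> points M" using openin_subset[OF chart_openin[OF ch\<phi>]] .
  let ?U = "{x \<in> cdom \<phi>. h x \<in> cdom \<kappa>}"
  show "smooth_on (cmodel \<phi>) (cmap \<phi> ` ?U) (cmodel \<kappa>) (cmap \<kappa> \<circ> h \<circ> cinv \<phi>)"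
  proof (rule smooth_on_local[OF chart_lines[OF ch\<phi>]])
    fix e assume "e \<in> cmap \<phi> ` ?U"
    then obtain x where x: "x \<in> cdom \<phi>" "h x \<in> cdom \<kappa>" "e = cmap \<phi> x" by auto
    have "f x \<in> points N" using continuous_map_image_subset_topspace[OF cf] x(1) dom\<phi> by blast
    then obtain \<psi> where \<psi>: "\<psi> \<in> atlas N" "f x \<in> cdom \<psi>"
      using N unfolding is_manifold_def by blast
    let ?V = "{x \<in> cdom \<phi>. f x \<in> cdom \<psi>}" and ?V' = "{y \<in> cdom \<psi>. g y \<in> cdom \<kappa>}"
    let ?f = "cmap \<psi> \<circ> f \<circ> cinv \<phi>" and ?g = "cmap \<kappa> \<circ> g \<circ> cinv \<psi>"
    have sf: "smooth_on (cmodel \<phi>) (cmap \<phi> ` ?V) (cmodel \<psi>) ?f"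
      using f \<phi> \<psi>(1) unfolding smooth_map_def by blast
    have sg: "smooth_on (cmodel \<psi>) (cmap \<psi> ` ?V') (cmodel \<kappa>) ?g"
      using g \<psi>(1) \<kappa> unfolding smooth_map_def by blast
    have i\<phi>: "cinv \<phi> (cmap \<phi> z) = z" if "z \<in> cdom \<phi>" for z
      using cinv_cmap[OF chart_inj[OF ch\<phi>] that] .
    have i\<psi>: "cinv \<psi> (cmap \<psi> z) = z" if "z \<in> cdom \<psi>" for z
      using cinv_cmap[OF chart_inj[OF chartedD[OF cN \<psi>(1)]] that] .
    have "openin (mtop M) (?U \<inter> ?V)"
      by (intro openin_Int openin_chart_preimage[OF ch \<phi> \<kappa> cM] openin_chart_preimage[OF cf \<phi> \<psi>(1) cM]
          chart_openin[OF chartedD[OF cP \<kappa>]] chart_openin[OF chartedD[OF cN \<psi>(1)]])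
    then have op: "openin (cmodel \<phi>) (cmap \<phi> ` (?U \<inter> ?V))"
      by (rule chart_open_image[OF ch\<phi>]) auto
    have "smooth_on (cmodel \<phi>) (cmap \<phi> ` (?U \<inter> ?V)) (cmodel \<psi>) ?f"
      by (rule smooth_on_subset[OF sf op]) auto
    moreover have "?f ` (cmap \<phi> ` (?U \<inter> ?V)) \<subseteq> cmap \<psi> ` ?V'"
      using i\<phi> dom\<phi> h by (auto intro!: imageI)
    ultimately have "smooth_on (cmodel \<phi>) (cmap \<phi> ` (?U \<inter> ?V)) (cmodel \<kappa>) (?g \<circ> ?f)"
      by (intro smooth_on_compose[OF is_manifold_lcs[OF M \<phi>] is_manifold_lcs[OF N \<psi>(1)]
            is_manifold_lcs[OF P \<kappa>] _ sg])
    moreover have "e \<in> cmap \<phi> ` (?U \<inter> ?V)" using x \<psi>(2) by blast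
    moreover have "\<forall>y\<in>cmap \<phi> ` (?U \<inter> ?V). (cmap \<kappa> \<circ> h \<circ> cinv \<phi>) y = (?g \<circ> ?f) y"
      using i\<phi> i\<psi> dom\<phi> h by auto
    ultimately show "\<exists>U' k. e \<in> U' \<and> U' \<subseteq> cmap \<phi> ` ?U \<and> smooth_on (cmodel \<phi>) U' (cmodel \<kappa>) k
        \<and> (\<forall>y\<in>U'. (cmap \<kappa> \<circ> h \<circ> cinv \<phi>) y = k y)"
      by (intro exI conjI) auto
  qed
qed

text \<open>
  In charts the identity is a chart change.
\<close>

lemma smooth_map_identity:
  assumes M: "is_manifold M" and id: "\<And>x. x \<in> points M \<Longrightarrow> f x = x"
  shows "smooth_map M M f"
  unfolding smooth_map_def
proof (intro conjI ballI)
  show "continuous_map (mtop M) (mtop M) f"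
    by (rule continuous_map_eq[OF continuous_map_id]) (simp add: id)
  fix \<phi> \<psi> assume \<phi>: "\<phi> \<in> atlas M" and \<psi>: "\<psi> \<in> atlas M"
  note ch = chartedD[OF is_manifold_charted[OF M] \<phi>]
  have f: "f x = x" if "x \<in> cdom \<phi>" for x
    using id that openin_subset[OF chart_openin[OF ch]] by blast
  then have "{x \<in> cdom \<phi>. f x \<in> cdom \<psi>} = cdom \<phi> \<inter> cdom \<psi>" by auto
  moreover have "smooth_on (cmodel \<phi>) (cmap \<phi> ` (cdom \<phi> \<inter> cdom \<psi>)) (cmodel \<psi>) (cmap \<psi> \<circ> cinv \<phi>)"
    using M \<phi> \<psi> unfolding is_manifold_def by blast
  then have "smooth_on (cmodel \<phi>) (cmap \<phi> ` (cdom \<phi> \<inter> cdom \<psi>)) (cmodel \<psi>) (cmap \<psi> \<circ> f \<circ> cinv \<phi>)"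
    by (intro smooth_on_local[OF chart_lines[OF ch]] exI[of _ "cmap \<phi> ` (cdom \<phi> \<inter> cdom \<psi>)"]
        exI[of _ "cmap \<psi> \<circ> cinv \<phi>"]) (auto simp: f cinv_cmap[OF chart_inj[OF ch]])
  ultimately show "smooth_on (cmodel \<phi>) (cmap \<phi> ` {x \<in> cdom \<phi>. f x \<in> cdom \<psi>}) (cmodel \<psi>)
      (cmap \<psi> \<circ> f \<circ> cinv \<phi>)"
    by simp
qed

section \<open>Gluing of forms\<close>

text \<open>
  The topology is pulled back from a product, so a line is continuous as soon as its components are.
\<close>

lemma power_top_lines_continuous:
  assumes F: "lcs F"
  shows "lines_continuous (power_top F k)"
  unfolding lines_continuous_def
proof (intro ballI)
  let ?A = "{h. (\<forall>i<k. h i \<in> topspace F) \<and> (\<forall>i\<ge>k. h i = 0)}"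
  let ?P = "product_topology (\<lambda>_. F) {..<k}"
  fix x v assume "x \<in> topspace (power_top F k)" and "v \<in> topspace (power_top F k)"
  then have x: "x \<in> ?A" and v: "v \<in> ?A"
    by (simp_all only: power_top_def topspace_pullback_topology Int_iff)
  have line: "x + t *\<^sub>R v \<in> ?A" for t
    using x v lcs_subspace[OF F] by (auto simp: scaleR_fun_def subspace_add subspace_scale)
  have "restrict (x + t *\<^sub>R v) {..<k} \<in> topspace ?P" for t
    using line[of t] by (simp add: PiE_iff)
  moreover have "limitin F (\<lambda>t. x i + t *\<^sub>R v i) (x i) (at 0)" if "i < k" for i
    using lcs_lines_continuous[OF F] x v that unfolding lines_continuous_def by simp
  ultimately have lim: "limitin ?P (\<lambda>t. restrict (x + t *\<^sub>R v) {..<k}) (restrict x {..<k}) (at 0)"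
    unfolding limitin_componentwise by (auto simp: scaleR_fun_def)
  show "limitin (power_top F k) (\<lambda>t. x + t *\<^sub>R v) x (at 0)"
    unfolding limitin_def
  proof (intro conjI allI impI)
    show "x \<in> topspace (power_top F k)" by fact
    fix W assume "openin (power_top F k) W \<and> x \<in> W"
    then obtain Q where Q: "openin ?P Q" "W = (\<lambda>h. restrict h {..<k}) -` Q \<inter> ?A" "x \<in> W"
      unfolding power_top_def openin_pullback_topology by blast
    have "restrict x {..<k} \<in> Q" using Q(2,3) by blast
    from limitinD[OF lim Q(1) this]
    show "eventually (\<lambda>t. x + t *\<^sub>R v \<in> W) (at 0)"
      by (rule eventually_mono) (use line Q(2) in blast)
  qed
qed

lemma open_submanifold_nested:
  assumes "W \<subseteq> U"
  shows "open_submanifold (open_submanifold M U) W = open_submanifold M W"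
  using assms
  by (simp add: open_submanifold_def subtopology_subtopology image_image inf.absorb2 Int_assoc)

lemma prod_manifold_lcs:
  "prod_manifold M (lcs_manifold P) =
     \<lparr>mtop = prod_topology (mtop M) P,
      atlas = (\<lambda>\<phi>. \<lparr>cdom = cdom \<phi> \<times> topspace P, cmap = map_prod (cmap \<phi>) (\<lambda>v. v),
          cmodel = prod_topology (cmodel \<phi>) P\<rparr>) ` atlas M\<rparr>"
  by (auto simp: prod_manifold_def lcs_manifold_def id_chart_def)

lemma open_submanifold_prod_lcs:
  "open_submanifold (prod_manifold M (lcs_manifold P)) (W \<times> topspace P)
     = prod_manifold (open_submanifold M W) (lcs_manifold P)"
  by (simp add: open_submanifold_def prod_manifold_lcs subtopology_Times image_image Times_Int_Times)

lemma charted_real: "charted (lcs_manifold euclideanreal)"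
proof -
  have "((\<lambda>t. x + t * v) \<longlongrightarrow> x) (at 0)" for x v :: real
    by (rule tendsto_eq_intros refl | simp)+
  then show ?thesis
    by (simp add: charted_def lcs_manifold_def topological_chart_def id_chart_def lines_continuous_def
        image_def)
qed

text \<open>
  The open sets \<open>V\<close> on which the local models are smooth may extend beyond \<open>U\<close>. So restriction (a single
  \<open>V \<supseteq> U\<close>) and gluing are treated at once.
\<close>

lemma smooth_map_glue:
  assumes M: "charted M" and N: "charted N" and U: "openin (mtop M) U"
    and local: "\<And>x. x \<in> U \<Longrightarrow> \<exists>W V g. openin (mtop M) W \<and> x \<in> W \<and> W \<subseteq> U \<and> W \<subseteq> V \<and> openin (mtop M) V \<and>
        smooth_map (open_submanifold M V) N g \<and> (\<forall>y\<in>W. f y = g y)"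
  shows "smooth_map (open_submanifold M U) N f"
proof (rule smooth_map_local[OF charted_open_submanifold[OF M U]])
  fix x assume "x \<in> points (open_submanifold M U)"
  then have "x \<in> U" by (simp add: open_submanifold_def)
  then obtain W V g where W: "openin (mtop M) W" "x \<in> W" "W \<subseteq> U" "W \<subseteq> V" "openin (mtop M) V"
      "smooth_map (open_submanifold M V) N g" "\<forall>y\<in>W. f y = g y"
    using local by meson
  have "openin (mtop (open_submanifold M V)) W"
    using W(1,4) by (auto simp: open_submanifold_def openin_subtopology)
  then have "smooth_map (open_submanifold (open_submanifold M V) W) N g"
    by (rule smooth_map_open_submanifold[OF charted_open_submanifold[OF M W(5)] N W(6)])
  then have "smooth_map (open_submanifold (open_submanifold M U) W) N g"
    by (simp add: open_submanifold_nested W(3,4))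
  moreover have "openin (mtop (open_submanifold M U)) W"
    using W(1,3) by (auto simp: open_submanifold_def openin_subtopology)
  ultimately show "\<exists>W g. openin (mtop (open_submanifold M U)) W \<and> x \<in> W \<and>
      smooth_map (open_submanifold (open_submanifold M U) W) N g \<and> (\<forall>y\<in>W. f y = g y)"
    using W(2,7) by (intro exI conjI)
qed

text \<open>
  The forms are a sheaf. The smoothness condition in a local trivialization over \<open>T\<close> concerns the manifold
  \<open>(U \<inter> T) \<times> F\<^sup>k\<close>, which is an open submanifold of the product of the whole base with \<open>F\<^sup>k\<close>; in
  this way it is covered by the gluing lemma for smooth maps.
\<close>

lemma forms_glue:
  assumes M: "is_manifold (base A)" and U: "opens A U"
    and vanish: "\<And>x vs. (x, vs) \<notin> tuples A U k \<Longrightarrow> \<omega> x vs = 0"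
    and local: "\<And>x. x \<in> U \<Longrightarrow> \<exists>W V \<omega>'. opens A W \<and> x \<in> W \<and> W \<subseteq> U \<and> W \<subseteq> V \<and> opens A V \<and>
        \<omega>' \<in> forms A k V \<and> (\<forall>y\<in>W. \<omega> y = \<omega>' y)"
  shows "\<omega> \<in> forms A k U"
proof (cases "k = 0")
  case True
  have "smooth_map (open_submanifold (base A) U) (lcs_manifold euclideanreal) (\<lambda>x. \<omega> x [])"
  proof (rule smooth_map_glue[OF is_manifold_charted[OF M] charted_real U])
    fix x assume "x \<in> U"
    then obtain W V \<omega>' where W: "opens A W" "x \<in> W" "W \<subseteq> U" "W \<subseteq> V" "opens A V"
        "\<omega>' \<in> forms A k V" "\<forall>y\<in>W. \<omega> y = \<omega>' y"
      using local by meson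
    have "smooth_map (open_submanifold (base A) V) (lcs_manifold euclideanreal) (\<lambda>x. \<omega>' x [])"
      using W(6) True by (simp add: forms_def smooth_functions_def)
    moreover have "\<forall>y\<in>W. \<omega> y [] = \<omega>' y []" using W(7) by simp
    ultimately show "\<exists>W V g. opens A W \<and> x \<in> W \<and> W \<subseteq> U \<and> W \<subseteq> V \<and> opens A V \<and>
        smooth_map (open_submanifold (base A) V) (lcs_manifold euclideanreal) g \<and> (\<forall>y\<in>W. \<omega> y [] = g y)"
      using W(1-5) by (intro exI conjI)
  qed
  then show ?thesis using True vanish by (simp add: forms_def smooth_functions_def)
next
  case False
  have "alternating_multilinear A x k (\<omega> x) \<and>
      continuous_map (product_topology (\<lambda>_. subtopology (mtop (total A)) (fibre A x)) {..<k})
         euclideanreal (\<lambda>h. \<omega> x (map h [0..<k]))" if x: "x \<in> U" for x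
  proof -
    obtain W V \<omega>' where W: "x \<in> W" "W \<subseteq> V" "\<omega>' \<in> forms A k V" "\<forall>y\<in>W. \<omega> y = \<omega>' y"
      using local[OF x] by meson
    then have "\<omega> x = \<omega>' x" "x \<in> V" by auto
    with W(3) False show ?thesis by (simp add: forms_def)
  qed
  moreover have "smooth_map
       (prod_manifold (open_submanifold (base A) (U \<inter> T)) (lcs_manifold (power_top F k)))
       (lcs_manifold euclideanreal)
       (\<lambda>(x, h). \<omega> x (map (\<lambda>i. inv_into (over A T) \<phi> (x, h i)) [0..<k]))"
    if \<phi>: "local_triv A T F \<phi>" for T F \<phi>
  proof -
    let ?P = "power_top F k"
    let ?M = "prod_manifold (base A) (lcs_manifold ?P)"
    let ?e = "\<lambda>\<omega> (x, h). \<omega> x (map (\<lambda>i. inv_into (over A T) \<phi> (x, h i)) [0..<k]) :: real"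
    have T: "opens A T" and F: "lcs F" using \<phi> unfolding local_triv_def by auto
    have ch: "charted ?M"
      by (rule charted_prod_lcs[OF is_manifold_charted[OF M] power_top_lines_continuous[OF F]])
    have op: "openin (mtop ?M) (S \<times> topspace ?P)" if "opens A S" for S
      using that by (simp add: prod_manifold_def lcs_manifold_def openin_prod_Times_iff)
    have "smooth_map (open_submanifold ?M ((U \<inter> T) \<times> topspace ?P)) (lcs_manifold euclideanreal) (?e \<omega>)"
    proof (rule smooth_map_glue[OF ch charted_real op])
      show "opens A (U \<inter> T)" using U T by blast
      fix z assume z: "z \<in> (U \<inter> T) \<times> topspace ?P"
      then obtain W V \<omega>' where W: "opens A W" "fst z \<in> W" "W \<subseteq> U" "W \<subseteq> V" "opens A V"
          "\<omega>' \<in> forms A k V" "\<forall>y\<in>W. \<omega> y = \<omega>' y"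
        using local[of "fst z"] by (metis IntD1 mem_Times_iff)
      have "smooth_map (prod_manifold (open_submanifold (base A) (V \<inter> T)) (lcs_manifold ?P))
          (lcs_manifold euclideanreal) (?e \<omega>')"
        using W(6) False \<phi> by (simp add: forms_def)
      then have "smooth_map (open_submanifold ?M ((V \<inter> T) \<times> topspace ?P)) (lcs_manifold euclideanreal) (?e \<omega>')"
        by (simp add: open_submanifold_prod_lcs)
      moreover have "openin (mtop ?M) ((W \<inter> T) \<times> topspace ?P)" "openin (mtop ?M) ((V \<inter> T) \<times> topspace ?P)"
        using W(1,5) T by (auto intro!: op)
      moreover have "z \<in> (W \<inter> T) \<times> topspace ?P" using z W(2) by (simp add: mem_Times_iff)
      moreover have "(W \<inter> T) \<times> topspace ?P \<subseteq> (U \<inter> T) \<times> topspace ?P"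
          "(W \<inter> T) \<times> topspace ?P \<subseteq> (V \<inter> T) \<times> topspace ?P"
        using W(3,4) by auto
      moreover have "\<forall>y\<in>(W \<inter> T) \<times> topspace ?P. ?e \<omega> y = ?e \<omega>' y" using W(7) by auto
      ultimately show "\<exists>W V g. openin (mtop ?M) W \<and> z \<in> W \<and> W \<subseteq> (U \<inter> T) \<times> topspace ?P \<and> W \<subseteq> V \<and>
          openin (mtop ?M) V \<and> smooth_map (open_submanifold ?M V) (lcs_manifold euclideanreal) g \<and>
          (\<forall>y\<in>W. ?e \<omega> y = g y)"
        by (intro exI conjI)
    qed
    then show ?thesis by (simp add: open_submanifold_prod_lcs)
  qed
  ultimately show ?thesis using False vanish by (simp add: forms_def)
qed

section \<open>Locality of the Lie algebroid differential\<close>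

lemma vf_deriv_local:
  assumes M: "is_manifold M" and X: "X x \<in> tangent_vectors M" "fst (X x) = x" "Y x = X x"
    and W: "openin (mtop M) W" "x \<in> W" and h: "\<And>y. y \<in> W \<Longrightarrow> h y = g y"
  shows "vf_deriv M F X h x = vf_deriv M F Y g x"
proof -
  obtain t where t: "X x = (x, t)" using X(2) by (cases "X x") auto
  define \<phi> where "\<phi> = (SOME \<phi>. \<phi> \<in> charts_at M x)"
  have "x \<in> points M" using X(1) unfolding t tangent_vectors_def by blast
  then have "\<exists>\<phi>. \<phi> \<in> charts_at M x" using M by (auto simp: is_manifold_def charts_at_def)
  then have \<phi>': "\<phi> \<in> charts_at M x" unfolding \<phi>_def by (rule someI_ex)
  then have \<phi>: "\<phi> \<in> atlas M" "x \<in> cdom \<phi>" by (auto simp: charts_at_def)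
  note ch = chartedD[OF is_manifold_charted[OF M] \<phi>(1)]
  have t\<phi>: "t \<phi> \<in> topspace (cmodel \<phi>)"
    using X(1) \<phi>' unfolding t tangent_vectors_def by blast
  have "openin (mtop M) (cdom \<phi> \<inter> W)" using chart_openin[OF ch] W(1) by blast
  then have op: "openin (cmodel \<phi>) (cmap \<phi> ` (cdom \<phi> \<inter> W))"
    by (rule chart_open_image[OF ch]) auto
  have "dir_deriv F ((\<lambda>v. v) \<circ> h \<circ> cinv \<phi>) (cmap \<phi> x) (t \<phi>)
      = dir_deriv F ((\<lambda>v. v) \<circ> g \<circ> cinv \<phi>) (cmap \<phi> x) (t \<phi>)"
    by (rule dir_deriv_cong_open[OF chart_lines[OF ch] op _ t\<phi>])
      (use \<phi>(2) W(2) h in \<open>auto simp: cinv_cmap[OF chart_inj[OF ch]]\<close>)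
  then show ?thesis
    using h[OF W(2)] by (simp add: vf_deriv_def tangent_map_def X(3) t lcs_manifold_def charts_at_def
        id_chart_def Let_def \<phi>_def[unfolded charts_at_def])
qed

lemma tangent_manifold_points: "points (tangent_manifold M) \<subseteq> tangent_vectors M"
  by (auto simp: tangent_manifold_def tangent_chart_def topology_generated_by_topspace)

lemma sections_value:
  assumes "\<xi> \<in> sections A U" "opens A U" "x \<in> U"
  shows "\<xi> x \<in> points (total A)" "proj A (\<xi> x) = x"
proof -
  have "x \<in> points (base A)" using assms(2,3) openin_subset by blast
  moreover have "continuous_map (subtopology (mtop (base A)) U) (mtop (total A)) \<xi>"
    using assms(1) by (simp add: sections_def smooth_map_def open_submanifold_def)
  ultimately show "\<xi> x \<in> points (total A)"
    using continuous_map_image_subset_topspace assms(3) by fastforce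
  show "proj A (\<xi> x) = x" using assms by (simp add: sections_def)
qed

lemma sections_restrict:
  assumes A: "vector_bundle A" and \<xi>: "\<xi> \<in> sections A U" and U: "opens A U" "opens A V" "V \<subseteq> U"
  shows "restrict \<xi> V \<in> sections A V"
proof -
  have M: "is_manifold (base A)" "is_manifold (total A)" using A by (simp_all add: vector_bundle_def)
  have "smooth_map (open_submanifold (base A) V) (total A) (restrict \<xi> V)"
  proof (rule smooth_map_glue[OF is_manifold_charted[OF M(1)] is_manifold_charted[OF M(2)] U(2)])
    fix x assume "x \<in> V"
    moreover have "smooth_map (open_submanifold (base A) U) (total A) \<xi>"
      using \<xi> by (simp add: sections_def)
    moreover have "\<forall>y\<in>V. restrict \<xi> V y = \<xi> y" by simp
    ultimately show "\<exists>W V' g. opens A W \<and> x \<in> W \<and> W \<subseteq> V \<and> W \<subseteq> V' \<and> opens A V' \<and>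
        smooth_map (open_submanifold (base A) V') (total A) g \<and> (\<forall>y\<in>W. restrict \<xi> V y = g y)"
      using U by (intro exI[of _ V] exI[of _ U] exI[of _ \<xi>]) simp
  qed
  then show ?thesis using \<xi> U(3) by (auto simp: sections_def)
qed

lemma anchor_section:
  assumes L: "first_order_lie_algebroid L" and \<xi>: "\<xi> \<in> sections (vb L) U" "opens (vb L) U" "x \<in> U"
  shows "anchor L (\<xi> x) \<in> tangent_vectors (base (vb L))" "fst (anchor L (\<xi> x)) = x"
proof -
  have a: "vb_morphism (vb L) (tangent_bundle (base (vb L))) (anchor L) (\<lambda>x. x)"
    using L by (simp add: first_order_lie_algebroid_def)
  note \<xi>x = sections_value[OF \<xi>]
  have "continuous_map (mtop (total (vb L))) (mtop (tangent_manifold (base (vb L)))) (anchor L)"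
    using a by (simp add: vb_morphism_def smooth_map_def tangent_bundle_def)
  from continuous_map_image_subset_topspace[OF this]
  show "anchor L (\<xi> x) \<in> tangent_vectors (base (vb L))" using \<xi>x(1) tangent_manifold_points by blast
  show "fst (anchor L (\<xi> x)) = x"
    using a \<xi>x by (simp add: vb_morphism_def tangent_bundle_def)
qed

text \<open>
  Each ingredient of the formula for the differential is local: the derivative along a vector field sees
  only germs, and the bracket commutes with restriction.
\<close>

lemma koszul_local:
  assumes L: "first_order_lie_algebroid L" and V: "opens (vb L) V" "x \<in> V"
    and W: "opens (vb L) W" "x \<in> W" "W \<subseteq> V"
    and eq: "\<And>y. y \<in> W \<Longrightarrow> \<alpha> y = \<beta> y"
    and \<xi>s: "set \<xi>s \<subseteq> sections (vb L) V" "length \<xi>s = Suc k"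
  shows "koszul L W k \<beta> (map (\<lambda>\<xi>. restrict \<xi> W) \<xi>s) x = koszul L V k \<alpha> \<xi>s x"
proof -
  let ?r = "map (\<lambda>\<xi>. restrict \<xi> W) \<xi>s"
  have M: "is_manifold (base (vb L))" and br: "bracket_sheaf_morphism L"
    using L by (simp_all add: first_order_lie_algebroid_def vector_bundle_def)
  have sec: "\<xi>s ! j \<in> sections (vb L) V" if "j \<le> k" for j
    using \<xi>s that by (simp add: subset_iff)
  have nths_eq: "map (\<lambda>\<xi>. \<xi> y) (nths ?r J) = map (\<lambda>\<xi>. \<xi> y) (nths \<xi>s J)" if "y \<in> W" for y J
    using that by (simp add: nths_map o_def)
  have "vf_deriv (base (vb L)) euclideanreal (anchor L \<circ> ?r ! j)
          (\<lambda>y. \<beta> y (map (\<lambda>\<xi>. \<xi> y) (nths ?r (- {j})))) x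
      = vf_deriv (base (vb L)) euclideanreal (anchor L \<circ> \<xi>s ! j)
          (\<lambda>y. \<alpha> y (map (\<lambda>\<xi>. \<xi> y) (nths \<xi>s (- {j})))) x" if "j \<le> k" for j
  proof -
    have j: "?r ! j = restrict (\<xi>s ! j) W" using that \<xi>s(2) by simp
    show ?thesis
    proof (rule vf_deriv_local[OF M _ _ _ W(1,2)])
      show "(anchor L \<circ> ?r ! j) x \<in> tangent_vectors (base (vb L))" "fst ((anchor L \<circ> ?r ! j) x) = x"
        "(anchor L \<circ> \<xi>s ! j) x = (anchor L \<circ> ?r ! j) x"
        using anchor_section[OF L sec[OF that] V] W(2) by (simp_all add: j)
      show "\<beta> y (map (\<lambda>\<xi>. \<xi> y) (nths ?r (- {j}))) = \<alpha> y (map (\<lambda>\<xi>. \<xi> y) (nths \<xi>s (- {j})))"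
        if "y \<in> W" for y
        using nths_eq[OF that] eq[OF that] by simp
    qed
  qed
  moreover have "bracket L W (?r ! i) (?r ! j) x = bracket L V (\<xi>s ! i) (\<xi>s ! j) x"
    if "i < j" "j \<le> k" for i j
  proof -
    have "bracket L W (restrict (\<xi>s ! i) W) (restrict (\<xi>s ! j) W) = restrict (bracket L V (\<xi>s ! i) (\<xi>s ! j)) W"
      using br V(1) W(1,3) sec[of i] sec[of j] that unfolding bracket_sheaf_morphism_def by simp
    then show ?thesis using that \<xi>s(2) W(2) by simp
  qed
  ultimately show ?thesis
    unfolding koszul_def using nths_eq[OF W(2)] eq[OF W(2)]
    by (intro arg_cong2[where f = "(+)"] sum.cong refl) auto
qed

text \<open>
  The differential is defined by a definite description that ranges over all local sections with the given
  values. Restricting these sections to \<open>W\<close> shows that exactly the same numbers satisfy the two descriptions.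
  The families \<open>\<alpha>\<close> and \<open>\<beta>\<close> are arbitrary, because the representative that is chosen from a germ of a form
  may be any family that agrees with the form near the point.
\<close>

lemma lie_d_local:
  assumes L: "first_order_lie_algebroid L" and U: "opens (vb L) U" "opens (vb L) U'"
    and W: "opens (vb L) W" "x \<in> W" "W \<subseteq> U" "W \<subseteq> U'"
    and eq: "\<And>y. y \<in> W \<Longrightarrow> \<alpha> y = \<beta> y"
  shows "lie_d L k U \<alpha> x = lie_d L k U' \<beta> x"
proof (rule ext)
  fix vs
  \<comment> \<open>The condition on \<open>r\<close> under the definite description in \<^const>\<open>lie_d\<close>.\<close>
  define Q where "Q U \<alpha> r \<longleftrightarrow> (\<forall>V \<xi>s. opens (vb L) V \<and> x \<in> V \<and> V \<subseteq> U \<and>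
       set \<xi>s \<subseteq> sections (vb L) V \<and> map (\<lambda>\<xi>. \<xi> x) \<xi>s = vs \<longrightarrow> koszul L V k \<alpha> \<xi>s x = r)" for U \<alpha> r
  have Q: "Q U \<alpha> r" if r: "Q U' \<beta> r" and W': "W \<subseteq> U" "W \<subseteq> U'" and eq': "\<forall>y\<in>W. \<alpha> y = \<beta> y"
    and vs: "length vs = Suc k" for U U' \<alpha> \<beta> r
    unfolding Q_def
  proof (intro allI impI)
    fix V \<xi>s assume V: "opens (vb L) V \<and> x \<in> V \<and> V \<subseteq> U \<and>
       set \<xi>s \<subseteq> sections (vb L) V \<and> map (\<lambda>\<xi>. \<xi> x) \<xi>s = vs"
    have op: "opens (vb L) (V \<inter> W)" using V W(1) by blast
    let ?r = "map (\<lambda>\<xi>. restrict \<xi> (V \<inter> W)) \<xi>s"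
    have vb: "vector_bundle (vb L)" using L by (simp add: first_order_lie_algebroid_def)
    have "set ?r \<subseteq> sections (vb L) (V \<inter> W)"
      using V sections_restrict[OF vb _ _ op, of _ V] by auto
    moreover have "map (\<lambda>\<xi>. \<xi> x) ?r = vs" using V W(2) by auto
    ultimately have "koszul L (V \<inter> W) k \<beta> ?r x = r"
      using r op V W(2) W' unfolding Q_def by blast
    moreover have "length \<xi>s = Suc k" using V vs by auto
    then have "koszul L (V \<inter> W) k \<beta> ?r x = koszul L V k \<alpha> \<xi>s x"
      using V W(2) eq' by (intro koszul_local[OF L _ _ op]) auto
    ultimately show "koszul L V k \<alpha> \<xi>s x = r" by simp
  qed
  have "(x, vs) \<in> tuples (vb L) U (Suc k) \<longleftrightarrow> (x, vs) \<in> tuples (vb L) U' (Suc k)"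
    using W by (auto simp: tuples_def)
  moreover have "(THE r. Q U \<alpha> r) = (THE r. Q U' \<beta> r)" if "(x, vs) \<in> tuples (vb L) U (Suc k)"
  proof -
    have len: "length vs = Suc k" using that by (simp add: tuples_def)
    have "Q U \<alpha> r \<longleftrightarrow> Q U' \<beta> r" for r
      using Q[OF _ W(3,4) _ len] Q[OF _ W(4,3) _ len] eq by (metis (full_types))
    then show ?thesis by simp
  qed
  ultimately show "lie_d L k U \<alpha> x vs = lie_d L k U' \<beta> x vs"
    unfolding lie_d_def cut_off_def Q_def[symmetric] by simp
qed

section \<open>Morphisms in terms of honest pullbacks\<close>

lemma vb_morphism_fibre:
  assumes "vb_morphism A B F f" "a \<in> fibre A x"
  shows "F a \<in> fibre B (f x)"
proof -
  have "continuous_map (mtop (total A)) (mtop (total B)) F"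
    using assms(1) by (simp add: vb_morphism_def smooth_map_def)
  from continuous_map_image_subset_topspace[OF this] assms
  show ?thesis by (auto simp: vb_morphism_def over_def)
qed

lemma vb_morphism_continuous_base:
  "vb_morphism A B F f \<Longrightarrow> continuous_map (mtop (base A)) (mtop (base B)) f"
  by (simp add: vb_morphism_def smooth_map_def)

definition preimage :: "('m, 'e, 'a, 'f) vbundle \<Rightarrow> ('m \<Rightarrow> 'n) \<Rightarrow> 'n set \<Rightarrow> 'm set" where
  "preimage A f V = {x \<in> points (base A). f x \<in> V}"

lemma opens_preimage:
  "vb_morphism A B F f \<Longrightarrow> opens B V \<Longrightarrow> opens A (preimage A f V)"
  unfolding preimage_def by (rule openin_continuous_map_preimage[OF vb_morphism_continuous_base])

lemma tuples_vb_morphism: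
  assumes "vb_morphism A B F f" "(x, vs) \<in> tuples A U k" "f x \<in> V"
  shows "(f x, map F vs) \<in> tuples B V k"
  using assms vb_morphism_fibre[OF assms(1)] by (fastforce simp: tuples_def)

lemma forms_sheaf_simps:
  "dg_top (forms_sheaf L) = mtop (base (vb L))"
  "dg_sec (forms_sheaf L) = forms (vb L)"
  "dg_res (forms_sheaf L) = (\<lambda>V. cut_off (V \<times> UNIV))"
  "dg_add (forms_sheaf L) = (\<lambda>k U \<alpha> \<beta> x vs. \<alpha> x vs + \<beta> x vs)"
  "dg_scale (forms_sheaf L) = (\<lambda>k U r \<alpha> x vs. r * \<alpha> x vs)"
  "dg_mult (forms_sheaf L) = (\<lambda>k l U. wedge k l)"
  "dg_one (forms_sheaf L) = (\<lambda>U. cut_off (tuples (vb L) U 0) (\<lambda>_ _. 1))"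
  "dg_d (forms_sheaf L) = lie_d L"
  by (simp_all add: forms_sheaf_def)

lemma dga_sheaf_morphismD:
  assumes "dga_sheaf_morphism X Y H" "openin (dg_top X) U" "s \<in> dg_sec X k U"
  shows "H k U s \<in> dg_sec Y k U" "H (Suc k) U (dg_d X k U s) = dg_d Y k U (H k U s)"
  using assms unfolding dga_sheaf_morphism_def by simp_all

text \<open>
  The chosen representative of a germ agrees with the given one on a whole neighbourhood. Values at the base
  point suffice for the algebraic operations, whereas the differential needs the neighbourhood.
\<close>

lemma germ_rep_forms:
  assumes V: "opens (vb L) V" "y \<in> V" and rep: "germ_rep (germ (forms_sheaf L) y (V, s)) = (V', s')"
  obtains W where "opens (vb L) V'" "y \<in> V'" "opens (vb L) W" "y \<in> W" "W \<subseteq> V" "W \<subseteq> V'"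
    "\<And>z. z \<in> W \<Longrightarrow> s' z = s z"
proof -
  have "(V, s) \<in> germ (forms_sheaf L) y (V, s)"
    using V by (auto simp: germ_def forms_sheaf_simps)
  then have "germ_rep (germ (forms_sheaf L) y (V, s)) \<in> germ (forms_sheaf L) y (V, s)"
    unfolding germ_rep_def by (rule someI)
  then obtain W where "opens (vb L) V'" "y \<in> V'" "opens (vb L) W" "y \<in> W" "W \<subseteq> V \<inter> V'"
      and eq: "cut_off (W \<times> UNIV) s = cut_off (W \<times> UNIV) s'"
    unfolding rep by (auto simp: germ_def forms_sheaf_simps)
  moreover have "s' z = s z" if "z \<in> W" for z
    using fun_cong[OF eq, of z] that by (simp add: cut_off_def)
  ultimately show thesis using that by simp
qed

lemma germ_rep_forms_value:
  assumes "opens (vb L) V" "y \<in> V"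
  shows "snd (germ_rep (germ (forms_sheaf L) y (V, s))) y = s y"
proof -
  obtain V' s' where rep: "germ_rep (germ (forms_sheaf L) y (V, s)) = (V', s')" by fastforce
  then show ?thesis using germ_rep_forms[OF assms rep] by (metis snd_conv)
qed

lemma sharp_apply:
  "sharp A F f k U s x vs
     = (if (x, vs) \<in> tuples A U k then snd (germ_rep (s x)) (f x) (map F vs) else 0)"
  by (simp add: sharp_def pullback_def cut_off_def)

lemma wedge_cong:
  assumes "\<alpha> x = \<alpha>' y" "\<beta> x = \<beta>' y"
  shows "wedge k l \<alpha> \<beta> x vs = wedge k l \<alpha>' \<beta>' y vs"
  using assms by (simp add: wedge_def)

text \<open>
  On tuples of vectors in the fibre both factors are pullbacks. For any other list of length \<open>k + l\<close> the
  product vanishes in each summand, because an entry outside the fibre goes to one of the two factors.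
\<close>

lemma wedge_pullback:
  assumes x: "x \<in> U"
    and \<alpha>: "\<And>ws. \<alpha>' x ws = (if (x, ws) \<in> tuples A U k then \<alpha> (f x) (map F ws) else 0)"
    and \<beta>: "\<And>ws. \<beta>' x ws = (if (x, ws) \<in> tuples A U l then \<beta> (f x) (map F ws) else 0)"
  shows "wedge k l \<alpha>' \<beta>' x vs
     = (if (x, vs) \<in> tuples A U (k + l) then wedge k l \<alpha> \<beta> (f x) (map F vs) else 0)"
proof (cases "length vs = k + l")
  case len: True
  show ?thesis
  proof (cases "set vs \<subseteq> fibre A x")
    case True
    have "\<alpha>' x (nths vs S) = \<alpha> (f x) (nths (map F vs) S) \<and> \<beta>' x (nths vs (- S)) = \<beta> (f x) (nths (map F vs) (- S))"
      if S: "S \<subseteq> {..<k + l}" "card S = k" for S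
    proof -
      have "{i. i < length vs \<and> i \<in> S} = S" "{i. i < length vs \<and> i \<in> - S} = {..<k + l} - S"
        using S(1) len by auto
      then have "length (nths vs S) = k" "length (nths vs (- S)) = l"
        using S by (auto simp: length_nths card_Diff_subset finite_subset[OF S(1)])
      moreover have "set (nths vs S) \<subseteq> fibre A x" "set (nths vs (- S)) \<subseteq> fibre A x"
        using True set_nths_subset by fast+
      ultimately show ?thesis using x by (simp add: \<alpha> \<beta> tuples_def nths_map)
    qed
    then show ?thesis using len True x by (auto simp: wedge_def tuples_def intro!: sum.cong)
  next
    case False
    then obtain i where i: "i < length vs" "vs ! i \<notin> fibre A x"
      by (metis in_set_conv_nth subsetI)
    have "\<alpha>' x (nths vs S) * \<beta>' x (nths vs (- S)) = 0" for S
    proof (cases "i \<in> S")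
      case True
      then have "vs ! i \<in> set (nths vs S)" using i(1) by (auto simp: set_nths)
      then show ?thesis using i(2) by (auto simp: \<alpha> tuples_def)
    next
      case False
      then have "vs ! i \<in> set (nths vs (- S))" using i(1) by (auto simp: set_nths)
      then show ?thesis using i(2) by (auto simp: \<beta> tuples_def)
    qed
    then have "wedge k l \<alpha>' \<beta>' x vs = 0" by (auto simp: wedge_def intro!: sum.neutral)
    then show ?thesis using False by (simp add: tuples_def)
  qed
qed (simp add: wedge_def tuples_def)

text \<open>
  The differential on the inverse image sheaf is computed from a chosen representative of the germ. Since the
  representative agrees with \<open>t\<close> near \<open>f x\<close>, locality makes its differential agree with that of \<open>t\<close>.
\<close>

lemma sharp_derivative:
  assumes L': "first_order_lie_algebroid L'" and mor: "vb_morphism A (vb L') F f"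
    and V: "opens (vb L') V" "f x \<in> V" and x: "x \<in> U"
    and s: "s x = germ (forms_sheaf L') (f x) (V, t)"
  shows "sharp A F f (Suc k) U (dg_d (inverse_image T f (forms_sheaf L')) k U s) x vs
     = (if (x, vs) \<in> tuples A U (Suc k) then lie_d L' k V t (f x) (map F vs) else 0)"
proof -
  obtain V' s' where rep: "germ_rep (s x) = (V', s')" by fastforce
  then obtain W where W: "opens (vb L') V'" "f x \<in> V'" "opens (vb L') W" "f x \<in> W" "W \<subseteq> V" "W \<subseteq> V'"
      "\<And>z. z \<in> W \<Longrightarrow> s' z = t z"
    using germ_rep_forms[OF V] unfolding s by metis
  have "snd (germ_rep (dg_d (inverse_image T f (forms_sheaf L')) k U s x)) (f x) = lie_d L' k V' s' (f x)"
    using x rep by (simp add: inverse_image_def forms_sheaf_simps germ_rep_forms_value[OF W(1,2)])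
  also have "\<dots> = lie_d L' k V t (f x)"
    by (rule lie_d_local[OF L' W(1) V(1) W(3,4,6,5,7)])
  finally show ?thesis by (simp add: sharp_apply)
qed

text \<open>
  The condition on the sheaf morphism \<open>F\<^sup>\<sharp>\<close> says no more than that pullback along \<open>F\<close> maps forms over each
  open \<open>V\<close> to forms over its preimage and commutes with the differential there. Indeed, a form over \<open>V\<close>
  defines a section of the inverse image sheaf over the preimage. Conversely, every section of the inverse
  image sheaf is locally of this kind, forms glue, the differential is local, and the compatibility with
  restriction, unit and algebraic operations holds pointwise for every bundle morphism.
\<close>

lemma algebroid_morphism_iff:
  assumes L: "first_order_lie_algebroid L" and L': "first_order_lie_algebroid L'"
  shows "algebroid_morphism L L' F f \<longleftrightarrow> vb_morphism (vb L) (vb L') F f \<and>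
    (\<forall>k V. opens (vb L') V \<longrightarrow> (\<forall>t\<in>forms (vb L') k V.
       pullback (vb L) F f k (preimage (vb L) f V) t \<in> forms (vb L) k (preimage (vb L) f V) \<and>
       pullback (vb L) F f (Suc k) (preimage (vb L) f V) (lie_d L' k V t)
         = lie_d L k (preimage (vb L) f V) (pullback (vb L) F f k (preimage (vb L) f V) t)))"
    (is "?lhs \<longleftrightarrow> ?vb \<and> ?forms")
proof -
  let ?A = "vb L" and ?X = "forms_sheaf L'" and ?I = "inverse_image (mtop (base (vb L))) f (forms_sheaf L')"
  let ?H = "sharp (vb L) F f"
  have iff: "?forms \<longleftrightarrow> dga_sheaf_morphism ?I (forms_sheaf L) ?H" if mor: ?vb
  proof
    assume dga: "dga_sheaf_morphism ?I (forms_sheaf L) ?H"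
    show ?forms
    proof (intro allI impI ballI)
      fix k V t assume V: "opens (vb L') V" and t: "t \<in> forms (vb L') k V"
      let ?U = "preimage ?A f V"
      \<comment> \<open>The section of the inverse image sheaf that is represented globally by the form \<open>t\<close>.\<close>
      let ?s = "\<lambda>x\<in>?U. germ ?X (f x) (V, t)"
      have U: "opens ?A ?U" by (rule opens_preimage[OF mor V])
      have fV: "f x \<in> V" if "x \<in> ?U" for x using that by (simp add: preimage_def)
      have s: "?s x = germ ?X (f x) (V, t)" if "x \<in> ?U" for x using that by simp
      have "?s \<in> dg_sec ?I k ?U"
      proof -
        have "\<exists>W V t. opens ?A W \<and> x \<in> W \<and> W \<subseteq> ?U \<and> opens (vb L') V \<and> f ` W \<subseteq> V \<and>
            t \<in> forms (vb L') k V \<and> (\<forall>z\<in>W. ?s z = germ ?X (f z) (V, t))" if "x \<in> ?U" for x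
          using that U V t fV by (intro exI[of _ ?U] exI[of _ V] exI[of _ t]) auto
        then show ?thesis by (simp add: inverse_image_def forms_sheaf_simps)
      qed
      moreover have "openin (dg_top ?I) ?U" using U by (simp add: inverse_image_def)
      ultimately have H: "?H k ?U ?s \<in> forms ?A k ?U"
          "?H (Suc k) ?U (dg_d ?I k ?U ?s) = lie_d L k ?U (?H k ?U ?s)"
        using dga_sheaf_morphismD[OF dga] unfolding forms_sheaf_simps by blast+
      have 1: "?H k ?U ?s = pullback ?A F f k ?U t"
      proof (intro ext)
        fix x vs
        have "snd (germ_rep (?s x)) (f x) = t (f x)" if "x \<in> ?U"
          using germ_rep_forms_value[OF V fV[OF that]] that by simp
        then show "?H k ?U ?s x vs = pullback ?A F f k ?U t x vs"
          by (auto simp: sharp_apply pullback_def cut_off_def tuples_def)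
      qed
      have 2: "?H (Suc k) ?U (dg_d ?I k ?U ?s) = pullback ?A F f (Suc k) ?U (lie_d L' k V t)"
      proof (intro ext)
        fix x vs
        show "?H (Suc k) ?U (dg_d ?I k ?U ?s) x vs = pullback ?A F f (Suc k) ?U (lie_d L' k V t) x vs"
        proof (cases "x \<in> ?U")
          case True
          show ?thesis
            using sharp_derivative[OF L' mor V fV[OF True] True, of ?s t k "mtop (base (vb L))" vs] s[OF True]
            by (simp add: pullback_def cut_off_def)
        qed (simp add: sharp_apply pullback_def cut_off_def tuples_def)
      qed
      show "pullback ?A F f k ?U t \<in> forms ?A k ?U \<and>
          pullback ?A F f (Suc k) ?U (lie_d L' k V t) = lie_d L k ?U (pullback ?A F f k ?U t)"
        using H unfolding 1 2 by simp
    qed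
  next
    assume ?forms
    then have pull: "pullback ?A F f k (preimage ?A f V) t \<in> forms ?A k (preimage ?A f V)"
      "pullback ?A F f (Suc k) (preimage ?A f V) (lie_d L' k V t)
         = lie_d L k (preimage ?A f V) (pullback ?A F f k (preimage ?A f V) t)"
      if "opens (vb L') V" "t \<in> forms (vb L') k V" for V t k
      using that by blast+
    have M: "is_manifold (base ?A)" using L by (simp add: first_order_lie_algebroid_def vector_bundle_def)
    have fpt: "f x \<in> points (base (vb L'))" if "opens ?A U" "x \<in> U" for x U
      using continuous_map_image_subset_topspace[OF vb_morphism_continuous_base[OF mor]]
        openin_subset[OF that(1)] that(2) by blast
    have local_rep: "\<exists>W V t. opens ?A W \<and> x \<in> W \<and> W \<subseteq> U \<and> W \<subseteq> preimage ?A f V \<and> opens (vb L') V \<and>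
        t \<in> forms (vb L') k V \<and> (\<forall>z\<in>W. f z \<in> V \<and> s z = germ ?X (f z) (V, t))"
      if s: "s \<in> dg_sec ?I k U" and x: "x \<in> U" for s k U x
    proof -
      obtain W V t where W: "opens ?A W" "x \<in> W" "W \<subseteq> U" "opens (vb L') V" "f ` W \<subseteq> V"
          "t \<in> forms (vb L') k V" "\<forall>z\<in>W. s z = germ ?X (f z) (V, t)"
        using s x by (auto simp: inverse_image_def forms_sheaf_simps)
      moreover have "W \<subseteq> preimage ?A f V"
        using W(5) openin_subset[OF W(1)] by (auto simp: preimage_def)
      ultimately show ?thesis by blast
    qed
    have rep: "\<exists>V t. germ_rep (s x) = (V, t) \<and> opens (vb L') V \<and> f x \<in> V"
      if s: "s \<in> dg_sec ?I k U" and x: "x \<in> U" for s k U x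
    proof -
      obtain V t where V: "opens (vb L') V" "f x \<in> V" "s x = germ ?X (f x) (V, t)"
        using local_rep[OF s x] by blast
      obtain V' t' where r: "germ_rep (s x) = (V', t')" by fastforce
      then have "opens (vb L') V'" "f x \<in> V'"
        using germ_rep_forms[OF V(1,2)] unfolding V(3) by metis+
      with r show ?thesis by blast
    qed
    have sharp_local: "?H k U s z = pullback ?A F f k (preimage ?A f V) t z"
      if "z \<in> U" "z \<in> preimage ?A f V" "opens (vb L') V" "s z = germ ?X (f z) (V, t)" for k U s z V t
    proof
      fix vs
      have "snd (germ_rep (s z)) (f z) = t (f z)"
        using germ_rep_forms_value[OF that(3), of "f z"] that by (simp add: preimage_def)
      then show "?H k U s z vs = pullback ?A F f k (preimage ?A f V) t z vs"
        using that(1,2) by (simp add: sharp_apply pullback_def cut_off_def tuples_def)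
    qed
    have sec: "?H k U s \<in> forms ?A k U" if U: "opens ?A U" and s: "s \<in> dg_sec ?I k U" for k U s
    proof (rule forms_glue[OF M U])
      show "?H k U s x vs = 0" if "(x, vs) \<notin> tuples ?A U k" for x vs using that by (simp add: sharp_apply)
      fix x assume "x \<in> U"
      then obtain W V t where W: "opens ?A W" "x \<in> W" "W \<subseteq> U" "W \<subseteq> preimage ?A f V" "opens (vb L') V"
          "t \<in> forms (vb L') k V" "\<forall>z\<in>W. f z \<in> V \<and> s z = germ ?X (f z) (V, t)"
        using local_rep[OF s] by meson
      have "\<forall>z\<in>W. ?H k U s z = pullback ?A F f k (preimage ?A f V) t z"
      proof
        fix z assume "z \<in> W"
        then have "z \<in> U" "z \<in> preimage ?A f V" "s z = germ ?X (f z) (V, t)" using W(3,4,7) by auto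
        then show "?H k U s z = pullback ?A F f k (preimage ?A f V) t z" using sharp_local W(5) by simp
      qed
      then show "\<exists>W V \<omega>. opens ?A W \<and> x \<in> W \<and> W \<subseteq> U \<and> W \<subseteq> V \<and> opens ?A V \<and> \<omega> \<in> forms ?A k V
          \<and> (\<forall>z\<in>W. ?H k U s z = \<omega> z)"
        using W(1-4) opens_preimage[OF mor W(5)] pull(1)[OF W(5,6)] by (intro exI conjI)
    qed
    have diff: "?H (Suc k) U (dg_d ?I k U s) = lie_d L k U (?H k U s)"
      if U: "opens ?A U" and s: "s \<in> dg_sec ?I k U" for k U s
    proof
      fix x
      show "?H (Suc k) U (dg_d ?I k U s) x = lie_d L k U (?H k U s) x"
      proof (cases "x \<in> U")
        case True
        then obtain W V t where W: "opens ?A W" "x \<in> W" "W \<subseteq> U" "W \<subseteq> preimage ?A f V" "opens (vb L') V"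
            "t \<in> forms (vb L') k V" "\<forall>z\<in>W. f z \<in> V \<and> s z = germ ?X (f z) (V, t)"
          using local_rep[OF s] by meson
        have xV: "f x \<in> V" "s x = germ ?X (f x) (V, t)" "x \<in> preimage ?A f V" using W by auto
        have "?H (Suc k) U (dg_d ?I k U s) x = pullback ?A F f (Suc k) (preimage ?A f V) (lie_d L' k V t) x"
        proof
          fix vs
          show "?H (Suc k) U (dg_d ?I k U s) x vs
              = pullback ?A F f (Suc k) (preimage ?A f V) (lie_d L' k V t) x vs"
            using sharp_derivative[OF L' mor W(5) xV(1) True, of s t k "mtop (base (vb L))" vs] xV True
            by (simp add: pullback_def cut_off_def tuples_def)
        qed
        also have "\<dots> = lie_d L k (preimage ?A f V) (pullback ?A F f k (preimage ?A f V) t) x"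
          by (simp only: pull(2)[OF W(5,6)])
        also have "\<dots> = lie_d L k U (?H k U s) x"
        proof (rule lie_d_local[OF L opens_preimage[OF mor W(5)] U W(1,2,4,3)])
          show "pullback ?A F f k (preimage ?A f V) t z = ?H k U s z" if "z \<in> W" for z
          proof -
            have "z \<in> U" "z \<in> preimage ?A f V" "s z = germ ?X (f z) (V, t)" using that W(3,4,7) by auto
            then show ?thesis using sharp_local W(5) by simp
          qed
        qed
        finally show ?thesis .
      qed (auto simp: fun_eq_iff sharp_apply lie_d_def cut_off_def tuples_def)
    qed
    have pointwise:
      "?H k V (dg_res ?I V s) = dg_res (forms_sheaf L) V (?H k U s)"
      if "V \<subseteq> U" for k U V s
      using that by (auto simp: fun_eq_iff sharp_apply inverse_image_def forms_sheaf_simps cut_off_def tuples_def)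
    have add: "?H k U (dg_add ?I k U s t) = dg_add (forms_sheaf L) k U (?H k U s) (?H k U t)"
      if s: "s \<in> dg_sec ?I k U" and t: "t \<in> dg_sec ?I k U" for k U s t
    proof (intro ext)
      fix x vs
      show "?H k U (dg_add ?I k U s t) x vs = dg_add (forms_sheaf L) k U (?H k U s) (?H k U t) x vs"
      proof (cases "x \<in> U")
        case True
        obtain V s' W t' where r: "germ_rep (s x) = (V, s')" "opens (vb L') V" "f x \<in> V"
          "germ_rep (t x) = (W, t')" "opens (vb L') W" "f x \<in> W"
          using rep[OF s True] rep[OF t True] by blast
        then have "opens (vb L') (V \<inter> W)" "f x \<in> V \<inter> W" by auto
        from germ_rep_forms_value[OF this] r True show ?thesis
          by (simp add: sharp_apply inverse_image_def forms_sheaf_simps cut_off_def)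
      qed (simp add: sharp_apply forms_sheaf_simps tuples_def)
    qed
    have scale: "?H k U (dg_scale ?I k U r s) = dg_scale (forms_sheaf L) k U r (?H k U s)"
      if s: "s \<in> dg_sec ?I k U" for k U s r
    proof (intro ext)
      fix x vs
      show "?H k U (dg_scale ?I k U r s) x vs = dg_scale (forms_sheaf L) k U r (?H k U s) x vs"
      proof (cases "x \<in> U")
        case True
        obtain V s' where r: "germ_rep (s x) = (V, s')" "opens (vb L') V" "f x \<in> V"
          using rep[OF s True] by blast
        from germ_rep_forms_value[OF r(2,3)] r(1) True show ?thesis
          by (simp add: sharp_apply inverse_image_def forms_sheaf_simps)
      qed (simp add: sharp_apply forms_sheaf_simps tuples_def)
    qed
    have mult: "?H (k + l) U (dg_mult ?I k l U s t) = dg_mult (forms_sheaf L) k l U (?H k U s) (?H l U t)"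
      if s: "s \<in> dg_sec ?I k U" and t: "t \<in> dg_sec ?I l U" for k l U s t
    proof (intro ext)
      fix x vs
      show "?H (k + l) U (dg_mult ?I k l U s t) x vs = dg_mult (forms_sheaf L) k l U (?H k U s) (?H l U t) x vs"
      proof (cases "x \<in> U")
        case True
        obtain V s' W t' where r: "germ_rep (s x) = (V, s')" "opens (vb L') V" "f x \<in> V"
          "germ_rep (t x) = (W, t')" "opens (vb L') W" "f x \<in> W"
          using rep[OF s True] rep[OF t True] by blast
        then have V: "opens (vb L') (V \<inter> W)" "f x \<in> V \<inter> W" by auto
        let ?c = "cut_off ((V \<inter> W) \<times> UNIV)"
        \<comment> \<open>The restrictions of the representatives to \<open>V \<inter> W\<close> have the same values at \<open>f x\<close>.\<close>
        have "wedge k l (?c s') (?c t') (f x) ws = wedge k l s' t' (f x) ws" for ws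
          using V(2) by (intro wedge_cong) (auto simp: cut_off_def)
        then have "?H (k + l) U (dg_mult ?I k l U s t) x vs
            = (if (x, vs) \<in> tuples ?A U (k + l) then wedge k l s' t' (f x) (map F vs) else 0)"
          using germ_rep_forms_value[OF V] r True
          by (simp add: sharp_apply inverse_image_def forms_sheaf_simps)
        also have "\<dots> = wedge k l (?H k U s) (?H l U t) x vs"
          by (rule wedge_pullback[symmetric, OF True]) (simp_all add: sharp_apply r)
        finally show ?thesis by (simp add: forms_sheaf_simps)
      qed (simp add: sharp_apply forms_sheaf_simps tuples_def wedge_def)
    qed
    have one: "?H 0 U (dg_one ?I U) = dg_one (forms_sheaf L) U" if U: "opens ?A U" for U
    proof (intro ext)
      fix x vs
      show "?H 0 U (dg_one ?I U) x vs = dg_one (forms_sheaf L) U x vs"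
      proof (cases "x \<in> U")
        case True
        from germ_rep_forms_value[OF openin_topspace fpt[OF U True]] True fpt[OF U True] show ?thesis
          by (auto simp: sharp_apply inverse_image_def forms_sheaf_simps cut_off_def tuples_def)
      qed (simp add: sharp_apply forms_sheaf_simps tuples_def cut_off_def)
    qed
    have top: "dg_top ?I = mtop (base ?A)" "dg_top (forms_sheaf L) = mtop (base ?A)"
      by (simp_all add: inverse_image_def forms_sheaf_simps)
    show "dga_sheaf_morphism ?I (forms_sheaf L) ?H"
      unfolding dga_sheaf_morphism_def top
      using one sec pointwise add scale mult diff by (simp add: forms_sheaf_simps(2,8))
  qed
  then show ?thesis unfolding algebroid_morphism_def by blast
qed

section \<open>The category of first-order Lie algebroids\<close>

lemma vb_morphism_identity:
  assumes A: "vector_bundle A"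
  shows "vb_morphism A A (\<lambda>a\<in>points (total A). a) (\<lambda>x\<in>points (base A). x)"
proof -
  have M: "is_manifold (base A)" "is_manifold (total A)" and p: "smooth_map (total A) (base A) (proj A)"
    and ops: "\<And>x. x \<in> points (base A) \<Longrightarrow> vector_space_ops (fibre A x) (vadd A) (vscale A) (vzero A x)"
    using A by (simp_all add: vector_bundle_def)
  have proj: "proj A a \<in> points (base A)" if "a \<in> points (total A)" for a
    using p that continuous_map_image_subset_topspace unfolding smooth_map_def by blast
  have "vadd A a b \<in> points (total A)" "vscale A r a \<in> points (total A)"
    if "x \<in> points (base A)" "a \<in> fibre A x" "b \<in> fibre A x" for x a b r
    using ops[OF that(1)] that(2,3) unfolding vector_space_ops_def by (auto simp: over_def)
  moreover have "a \<in> points (total A)" if "a \<in> fibre A x" for a x using that by (simp add: over_def)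
  ultimately show ?thesis
    using proj smooth_map_identity[OF M(1)] smooth_map_identity[OF M(2)]
    by (simp add: vb_morphism_def)
qed

lemma vb_morphism_compose:
  assumes A: "vector_bundle A" and B: "vector_bundle B" and C: "vector_bundle C"
    and F: "vb_morphism A B F f" and G: "vb_morphism B C G g"
  shows "vb_morphism A C (compose (points (total A)) G F) (compose (points (base A)) g f)"
proof -
  have M: "is_manifold (base A)" "is_manifold (total A)" "is_manifold (base B)" "is_manifold (total B)"
      "is_manifold (base C)" "is_manifold (total C)"
    and p: "smooth_map (total A) (base A) (proj A)"
    and ops: "\<And>x. x \<in> points (base A) \<Longrightarrow> vector_space_ops (fibre A x) (vadd A) (vscale A) (vzero A x)"
    using A B C by (simp_all add: vector_bundle_def)
  have proj: "proj A a \<in> points (base A)" if "a \<in> points (total A)" for a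
    using p that continuous_map_image_subset_topspace unfolding smooth_map_def by blast
  have fpt: "f x \<in> points (base B)" if "x \<in> points (base A)" for x
    using continuous_map_image_subset_topspace[OF vb_morphism_continuous_base[OF F]] that by blast
  have smooth: "smooth_map (base A) (base C) (compose (points (base A)) g f)"
      "smooth_map (total A) (total C) (compose (points (total A)) G F)"
    using F G M unfolding vb_morphism_def
    by (auto intro: smooth_map_compose[of "base A" "base B" "base C" f g]
        smooth_map_compose[of "total A" "total B" "total C" F G] simp: compose_def)
  have closed: "vadd A a b \<in> points (total A)" "vscale A r a \<in> points (total A)"
    if "x \<in> points (base A)" "a \<in> fibre A x" "b \<in> fibre A x" for x a b r
    using ops[OF that(1)] that(2,3) unfolding vector_space_ops_def by (auto simp: over_def)
  have pt: "a \<in> points (total A)" if "a \<in> fibre A x" for a x using that by (simp add: over_def)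
  have "proj C (G (F a)) = g (f (proj A a))" if "a \<in> points (total A)" for a
    using F G vb_morphism_fibre[OF F, of a "proj A a"] that
    by (simp add: vb_morphism_def over_def)
  moreover have "G (F (vadd A a b)) = vadd C (G (F a)) (G (F b))" "G (F (vscale A r a)) = vscale C r (G (F a))"
    if "x \<in> points (base A)" "a \<in> fibre A x" "b \<in> fibre A x" for x a b r
    using F G vb_morphism_fibre[OF F that(2)] vb_morphism_fibre[OF F that(3)] that fpt[OF that(1)]
    unfolding vb_morphism_def by simp_all
  ultimately show ?thesis
    using smooth proj closed pt unfolding vb_morphism_def by (simp add: compose_def)
qed

text \<open>
  Forms and their differentials vanish outside their domain of tuples, hence they equal their pullbacks
  along the extensional identity.
\<close>

lemma algebroid_morphism_identity:
  assumes L: "first_order_lie_algebroid L"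
  shows "algebroid_morphism L L (\<lambda>a\<in>points (total (vb L)). a) (\<lambda>x\<in>points (base (vb L)). x)"
proof -
  let ?A = "vb L"
  let ?F = "\<lambda>a\<in>points (total ?A). a" and ?f = "\<lambda>x\<in>points (base ?A). x"
  have A: "vector_bundle ?A" using L by (simp add: first_order_lie_algebroid_def)
  have pre: "preimage ?A ?f V = V" if "opens ?A V" for V
    using openin_subset[OF that] by (auto simp: preimage_def)
  have pull: "pullback ?A ?F ?f k V t = t"
    if V: "opens ?A V" and t: "\<And>x vs. (x, vs) \<notin> tuples ?A V k \<Longrightarrow> t x vs = 0" for k V t
  proof (intro ext)
    fix x vs
    have "map ?F vs = vs" "?f x = x" if "(x, vs) \<in> tuples ?A V k"
      using that openin_subset[OF V] by (auto simp: tuples_def over_def intro!: map_idI)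
    then show "pullback ?A ?F ?f k V t x vs = t x vs" using t by (simp add: pullback_def cut_off_def)
  qed
  have "pullback ?A ?F ?f k V t = t" "pullback ?A ?F ?f (Suc k) V (lie_d L k V t) = lie_d L k V t"
    if "opens ?A V" "t \<in> forms ?A k V" for k V t
    using that by (auto intro!: pull simp: forms_def lie_d_def cut_off_def)
  then show ?thesis
    unfolding algebroid_morphism_iff[OF L L] using vb_morphism_identity[OF A] pre by simp
qed

lemma pullback_compose:
  assumes F: "vb_morphism A B F f" and U: "U \<subseteq> points (base A)"
    and V: "\<And>x. x \<in> U \<Longrightarrow> f x \<in> V"
  shows "pullback A (compose (points (total A)) G F) (compose (points (base A)) g f) k U t
    = pullback A F f k U (pullback B G g k V t)"
proof (intro ext)
  fix x vs
  show "pullback A (compose (points (total A)) G F) (compose (points (base A)) g f) k U t x vs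
      = pullback A F f k U (pullback B G g k V t) x vs"
  proof (cases "(x, vs) \<in> tuples A U k")
    case True
    then have x: "x \<in> U" by (simp add: tuples_def)
    have "map (compose (points (total A)) G F) vs = map G (map F vs)"
      using True by (auto simp: tuples_def over_def compose_def)
    moreover have "compose (points (base A)) g f x = g (f x)" using x U by (auto simp: compose_def)
    ultimately show ?thesis
      using True tuples_vb_morphism[OF F True V[OF x]]
      by (simp add: pullback_def cut_off_def cong: map_cong)
  qed (simp add: pullback_def cut_off_def)
qed

text \<open>
  The preimage of \<open>V\<close> under the composite is the preimage of the preimage, and over it pullback is
  functorial. That \<open>G\<^sup>*t\<close> is a form again is what allows the condition on \<open>F\<close> to be applied to it.
\<close>

lemma algebroid_morphism_compose:
  assumes L: "first_order_lie_algebroid L" "first_order_lie_algebroid L'" "first_order_lie_algebroid L''"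
    and F: "algebroid_morphism L L' F f" and G: "algebroid_morphism L' L'' G g"
  shows "algebroid_morphism L L'' (compose (points (total (vb L))) G F) (compose (points (base (vb L))) g f)"
proof -
  let ?A = "vb L" and ?B = "vb L'" and ?C = "vb L''"
  let ?GF = "compose (points (total ?A)) G F" and ?gf = "compose (points (base ?A)) g f"
  have vb: "vb_morphism ?A ?B F f" "vb_morphism ?B ?C G g"
    using F G by (simp_all add: algebroid_morphism_def)
  have bundles: "vector_bundle ?A" "vector_bundle ?B" "vector_bundle ?C"
    using L by (simp_all add: first_order_lie_algebroid_def)
  have "pullback ?A ?GF ?gf k (preimage ?A ?gf V) t \<in> forms ?A k (preimage ?A ?gf V) \<and>
      pullback ?A ?GF ?gf (Suc k) (preimage ?A ?gf V) (lie_d L'' k V t)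
        = lie_d L k (preimage ?A ?gf V) (pullback ?A ?GF ?gf k (preimage ?A ?gf V) t)"
    if V: "opens ?C V" and t: "t \<in> forms ?C k V" for k V t
  proof -
    let ?V' = "preimage ?B g V" and ?U = "preimage ?A ?gf V"
    have V': "opens ?B ?V'" by (rule opens_preimage[OF vb(2) V])
    have U: "?U = preimage ?A f ?V'"
      using continuous_map_image_subset_topspace[OF vb_morphism_continuous_base[OF vb(1)]]
      by (auto simp: preimage_def compose_def)
    have "?U \<subseteq> points (base ?A)" by (auto simp: preimage_def)
    moreover have "f x \<in> ?V'" if "x \<in> ?U" for x using that unfolding U by (simp add: preimage_def)
    ultimately have pull: "pullback ?A ?GF ?gf j ?U s = pullback ?A F f j ?U (pullback ?B G g j ?V' s)" for j s
      by (rule pullback_compose[OF vb(1)])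
    have G': "pullback ?B G g k ?V' t \<in> forms ?B k ?V'"
        "pullback ?B G g (Suc k) ?V' (lie_d L'' k V t) = lie_d L' k ?V' (pullback ?B G g k ?V' t)"
      using G V t unfolding algebroid_morphism_iff[OF L(2,3)] by blast+
    have "pullback ?A F f k ?U (pullback ?B G g k ?V' t) \<in> forms ?A k ?U"
        "pullback ?A F f (Suc k) ?U (lie_d L' k ?V' (pullback ?B G g k ?V' t))
          = lie_d L k ?U (pullback ?A F f k ?U (pullback ?B G g k ?V' t))"
      using F V' G'(1) unfolding algebroid_morphism_iff[OF L(1,2)] U by blast+
    then show ?thesis by (simp only: pull G'(2) simp_thms)
  qed
  then show ?thesis
    unfolding algebroid_morphism_iff[OF L(1,3)] using vb_morphism_compose[OF bundles vb] by blast
qed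

lemma arrow_maps:
  assumes "u \<in> algebroid_arrows"
  shows "a \<in> points (total (vb (source u))) \<Longrightarrow> total_map u a \<in> points (total (vb (target u)))"
    and "x \<in> points (base (vb (source u))) \<Longrightarrow> base_map u x \<in> points (base (vb (target u)))"
proof -
  have vb: "vb_morphism (vb (source u)) (vb (target u)) (total_map u) (base_map u)"
    using assms by (simp add: algebroid_arrows_def algebroid_morphism_def)
  then have "continuous_map (mtop (total (vb (source u)))) (mtop (total (vb (target u)))) (total_map u)"
    by (simp add: vb_morphism_def smooth_map_def)
  from continuous_map_image_subset_topspace[OF this]
  show "a \<in> points (total (vb (source u))) \<Longrightarrow> total_map u a \<in> points (total (vb (target u)))" by blast
  from continuous_map_image_subset_topspace[OF vb_morphism_continuous_base[OF vb]]
  show "x \<in> points (base (vb (source u))) \<Longrightarrow> base_map u x \<in> points (base (vb (target u)))" by blast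
qed

theorem corollary3p4:
  shows "category
    (algebroids :: ('m, 'e::real_vector, 'a, 'f::real_vector) algebroid set)
    algebroid_arrows source target id_arrow comp_arrow"
proof
  fix u v w :: "('m, 'e, 'a, 'f) algebroid_arrow" and A :: "('m, 'e, 'a, 'f) algebroid"
  show "u \<in> algebroid_arrows \<Longrightarrow> source u \<in> algebroids" "u \<in> algebroid_arrows \<Longrightarrow> target u \<in> algebroids"
    by (simp_all add: algebroid_arrows_def)
  show "A \<in> algebroids \<Longrightarrow> id_arrow A \<in> algebroid_arrows"
    using algebroid_morphism_identity[of A]
    by (simp add: algebroid_arrows_def algebroids_def id_arrow_def)
  show "A \<in> algebroids \<Longrightarrow> source (id_arrow A) = A" "A \<in> algebroids \<Longrightarrow> target (id_arrow A) = A"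
    by (simp_all add: id_arrow_def)
  show "source (comp_arrow v u) = source u" "target (comp_arrow v u) = target v"
    by (simp_all add: comp_arrow_def)
  show "comp_arrow v u \<in> algebroid_arrows"
    if "u \<in> algebroid_arrows" "v \<in> algebroid_arrows" "target u = source v"
    using that algebroid_morphism_compose[of "source u" "target u" "target v"
        "total_map u" "base_map u" "total_map v" "base_map v"]
    by (simp add: algebroid_arrows_def algebroids_def comp_arrow_def compose_def)
  show "comp_arrow w (comp_arrow v u) = comp_arrow (comp_arrow w v) u"
    if "u \<in> algebroid_arrows" "v \<in> algebroid_arrows" "w \<in> algebroid_arrows"
      "target u = source v" "target v = source w"
    using arrow_maps[OF that(1)] that(4) by (auto simp: comp_arrow_def compose_def fun_eq_iff)
  show "comp_arrow u (id_arrow (source u)) = u" if u: "u \<in> algebroid_arrows"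
  proof -
    have "total_map u \<in> extensional (points (total (vb (source u))))"
        "base_map u \<in> extensional (points (base (vb (source u))))"
      using u by (simp_all add: algebroid_arrows_def)
    then show ?thesis
      by (cases u) (auto simp: comp_arrow_def id_arrow_def compose_def fun_eq_iff extensional_def)
  qed
  show "comp_arrow (id_arrow (target u)) u = u" if u: "u \<in> algebroid_arrows"
  proof -
    have "total_map u \<in> extensional (points (total (vb (source u))))"
        "base_map u \<in> extensional (points (base (vb (source u))))"
      using u by (simp_all add: algebroid_arrows_def)
    then show ?thesis using arrow_maps[OF u]
      by (cases u) (auto simp: comp_arrow_def id_arrow_def compose_def fun_eq_iff extensional_def)
  qed
qed

end
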